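(* Let $\pi$ be a probability measure on $\mathsf{E}=\mathbb{R}^d$ with a positive density with respect to Lebesgue measure, and let $\mathsf{d}$ be a metric on $\mathsf{E}$. Let $\pi$ have a regular, concave isoperimetric minorant $\tilde I_\pi$ with respect to $\mathsf{d}$, let $\varepsilon,\delta>0$, and let $P$ be a $(\mathsf{d},\delta,\varepsilon)$-close coupling, $\pi$-reversible, positive Markov kernel. Then: 1. for $v\in(0,\frac12]$, $\Phi_P(v)\ge\frac14\cdot\varepsilon\cdot\min\left\{1,\frac12\cdot\delta\cdot\frac{\tilde I_\pi(v/2)}{v/2}\right\}$; 2. $\Phi_P^*\ge\frac14\cdot\varepsilon\cdot\min\left\{1,2\cdot\delta\cdot\tilde I_\pi\left(\frac14\right)\right\}$; 3. $\gamma_P\ge\frac12\left[\Phi_P^*\right]^2\ge2^{-5}\cdot\varepsilon^2\cdot\min\left\{1,4\cdot\delta^2\cdot\tilde I_\pi\left(\frac14\right)^2\right\}$. Furthermore, let $\varepsilon_{\mathrm{Mix}}\in(0,8)$, let $\mu\ll\pi$ be a probability measure and $u_0:=\chi^2(\mu,\pi)$. To ensure that $\chi^2(\mu P^n,\pi)\le\varepsilon_{\mathrm{Mix}}$ it suffices to take \begin{align*} n\ge\;&2+2^6\cdot\varepsilon^{-2}\cdot\max\left\{\log\left(\frac{u_0}{4\cdot v_*^{-1}}\right),0\right\}\\ &+2^8\cdot\varepsilon^{-2}\cdot\delta^{-2}\cdot\int_{\max\{\min\{2u_0^{-1},1/4\},\,v_*/2\}}^{1/4}\frac{\xi}{\tilde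 I_\pi(\xi)^2}\,\mathrm{d}\xi\\ &+2^4\cdot\max\left\{1,2^{-2}\cdot\delta^{-2}\cdot\tilde I_\pi\left(\tfrac14\right)^{-2}\right\}\cdot\varepsilon^{-2}\cdot\log\left(\max\left\{\frac{\min\{u_0,8\}}{\varepsilon_{\mathrm{Mix}}},1\right\}\right), \end{align*} where $$v_*:=\min\left\{\frac12,\max\left\{0,\sup\left\{v>0:1\le\frac12\cdot\delta\cdot\frac{\tilde I_\pi(\frac12 v)}{\frac12 v}\right\}\right\}\right\}.$$
   Context: Isoperimetric profile: for Borel $A$ and $r\ge0$, $A_r:=\{x\in\mathsf{E}:\mathsf{d}(x,A)<r\}$, where $\mathsf{d}(x,A)=\inf_{y\in A}\mathsf{d}(x,y)$; $\pi^+(A)=\liminf_{r\to0^+}\frac{\pi(A_r)-\pi(A)}{r}$; $I_\pi(p):=\inf\{\pi^+(A):A\text{ Borel},\pi(A)=p\}$ for $p\in(0,1)$. An isoperimetric minorant of $\pi$ (w.r.t. $\mathsf{d}$) is a function $\tilde I_\pi:(0,1)\to(0,\infty)$ with $\tilde I_\pi\le I_\pi$ pointwise; it is regular if it is symmetric about $\frac12$, continuous, and monotone increasing on $(0,\frac12]$. Close coupling: $P$ is $(\mathsf{d},\delta,\varepsilon)$-close coupling if for all $x,y\in\mathsf{E}$, $\mathsf{d}(x,y)\le\delta$ implies $\|P(x,\cdot)-P(y,\cdot)\|_{\mathrm{TV}}\le1-\varepsilon$. Here $\|\mu-\nu\|_{\mathrm{TV}}=\sup_A|\mu(A)-\nu(A)|$.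 Conductance profile: $\Phi_P(v):=\inf\left\{\frac{(\pi\otimes P)(A\times A^\complement)}{\pi(A)}:A\text{ Borel},0<\pi(A)\le v\right\}$ for $v\in(0,\frac12]$, where $(\pi\otimes P)(\mathrm{d}x,\mathrm{d}y)=\pi(\mathrm{d}x)P(x,\mathrm{d}y)$; conductance: $\Phi_P^*:=\Phi_P(\frac12)$. $P$ acts on $\mathrm{L}^2(\pi)$; it is positive if $\langle f,Pf\rangle\ge0$ for all $f\in\mathrm{L}^2(\pi)$. The spectral gap is $\gamma_P:=1-\sup|\mathcal{S}_0(P)|$, where $\mathcal{S}_0(P)$ is the spectrum of $P$ restricted to $\mathrm{L}^2_0(\pi)=\{f\in\mathrm{L}^2(\pi):\pi(f)=0\}$. $\chi^2(\mu,\pi):=\left\|\frac{\mathrm{d}\mu}{\mathrm{d}\pi}-1\right\|_{\mathrm{L}^2(\pi)}^2$. Conventions: $1/0=\infty$, $1/\infty=0$, $\log 0=-\infty$, $\sup\emptyset=-\infty$; in the definition of $v_*$, $v$ ranges over values for which $\tilde I_\pi(\frac12v)$ is defined. *)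

theory Defs
  imports "HOL-Probability.Probability"
begin

section \<open>Isoperimetry with respect to a metric \<open>d\<close>\<close>

definition enlargement :: "('a \<Rightarrow> 'a \<Rightarrow> real) \<Rightarrow> 'a set \<Rightarrow> real \<Rightarrow> 'a set" where
  "enlargement d A r = {x. (INF y\<in>A. ereal (d x y)) < ereal r}"

text \<open>The metric need not induce the topology that generates the Borel sets, so an enlargement
  of a Borel set may fail to be Borel, and then \<^const>\<open>measure\<close> gives it the value 0. This does
  not affect isoperimetric minorants: if one exists and \<open>0 < measure M A < 1\<close>, the lower limit
  below is positive, which forces the enlargements of \<open>A\<close> to be Borel for all small \<open>r > 0\<close>.\<close>

definition minkowski_content ::
  "('a \<Rightarrow> 'a \<Rightarrow> real) \<Rightarrow> 'a measure \<Rightarrow> 'a set \<Rightarrow> ereal" where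
  "minkowski_content d M A =
     Liminf (at_right 0) (\<lambda>r. ereal ((measure M (enlargement d A r) - measure M A) / r))"

definition isoperimetric_profile ::
  "('a \<Rightarrow> 'a \<Rightarrow> real) \<Rightarrow> 'a measure \<Rightarrow> real \<Rightarrow> ereal" where
  "isoperimetric_profile d M p = (INF A\<in>{A \<in> sets M. measure M A = p}. minkowski_content d M A)"

text \<open>A minorant is a function on the open unit interval; its values elsewhere are irrelevant.\<close>

definition isoperimetric_minorant ::
  "('a \<Rightarrow> 'a \<Rightarrow> real) \<Rightarrow> 'a measure \<Rightarrow> (real \<Rightarrow> real) \<Rightarrow> bool" where
  "isoperimetric_minorant d M I \<longleftrightarrow>
     (\<forall>p\<in>{0<..<1}. 0 < I p \<and> ereal (I p) \<le> isoperimetric_profile d M p)"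

definition regular_minorant :: "(real \<Rightarrow> real) \<Rightarrow> bool" where
  "regular_minorant I \<longleftrightarrow>
     (\<forall>p\<in>{0<..<1}. I (1 - p) = I p) \<and> continuous_on {0<..<1} I \<and> mono_on {0<..1/2} I"

section \<open>Markov kernels\<close>

definition tv_dist :: "'a measure \<Rightarrow> 'a measure \<Rightarrow> real" where
  "tv_dist \<mu> \<nu> = (SUP A\<in>sets \<mu>. \<bar>measure \<mu> A - measure \<nu> A\<bar>)"

definition close_coupling ::
  "('a \<Rightarrow> 'a \<Rightarrow> real) \<Rightarrow> real \<Rightarrow> real \<Rightarrow> ('a \<Rightarrow> 'a measure) \<Rightarrow> bool" where
  "close_coupling d \<delta> \<epsilon> P \<longleftrightarrow> (\<forall>x y. d x y \<le> \<delta> \<longrightarrow> tv_dist (P x) (P y) \<le> 1 - \<epsilon>)"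

definition joint_law :: "'a measure \<Rightarrow> ('a \<Rightarrow> 'a measure) \<Rightarrow> ('a \<times> 'a) measure" where
  "joint_law M P = M \<bind> (\<lambda>x. distr (P x) (M \<Otimes>\<^sub>M M) (Pair x))"

lemma emeasure_joint_law:
  assumes "prob_space M" "P \<in> M \<rightarrow>\<^sub>M prob_algebra M" "A \<in> sets M" "B \<in> sets M"
  shows "emeasure (joint_law M P) (A \<times> B) = (\<integral>\<^sup>+x\<in>A. emeasure (P x) B \<partial>M)"
proof -
  have [measurable]: "P \<in> M \<rightarrow>\<^sub>M prob_algebra M" "A \<in> sets M" "B \<in> sets M"
    using assms by auto
  have M: "M \<in> space (prob_algebra M)"
    using assms(1) by (simp add: space_prob_algebra)
  have K: "(\<lambda>x. distr (P x) (M \<Otimes>\<^sub>M M) (Pair x)) \<in> M \<rightarrow>\<^sub>M prob_algebra (M \<Otimes>\<^sub>M M)"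
    by measurable
  have "emeasure (joint_law M P) (A \<times> B) =
      (\<integral>\<^sup>+x. emeasure (distr (P x) (M \<Otimes>\<^sub>M M) (Pair x)) (A \<times> B) \<partial>M)"
    unfolding joint_law_def by (rule emeasure_bind_prob_algebra[OF M K]) simp
  also have "\<dots> = (\<integral>\<^sup>+x\<in>A. emeasure (P x) B \<partial>M)"
  proof (rule nn_integral_cong)
    fix x assume x: "x \<in> space M"
    then have "P x \<in> space (prob_algebra M)"
      by (rule measurable_space[OF assms(2)])
    then have sets: "sets (P x) = sets M"
      by (simp add: space_prob_algebra)
    have "Pair x \<in> P x \<rightarrow>\<^sub>M M \<Otimes>\<^sub>M M"
      using measurable_Pair1'[OF x] by (simp cong: measurable_cong_sets add: sets)
    moreover have "Pair x -` (A \<times> B) \<inter> space (P x) = (if x \<in> A then B else {})"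
      using sets.sets_into_space[OF assms(4)] sets_eq_imp_space_eq[OF sets] by auto
    ultimately show "emeasure (distr (P x) (M \<Otimes>\<^sub>M M) (Pair x)) (A \<times> B) =
        emeasure (P x) B * indicator A x"
      by (subst emeasure_distr) auto
  qed
  finally show ?thesis .
qed

definition reversible :: "'a measure \<Rightarrow> ('a \<Rightarrow> 'a measure) \<Rightarrow> bool" where
  "reversible M P \<longleftrightarrow> distr (joint_law M P) (M \<Otimes>\<^sub>M M) (\<lambda>(x, y). (y, x)) = joint_law M P"

definition conductance_profile :: "'a measure \<Rightarrow> ('a \<Rightarrow> 'a measure) \<Rightarrow> real \<Rightarrow> real" where
  "conductance_profile M P v =
     (INF A\<in>{A \<in> sets M. 0 < measure M A \<and> measure M A \<le> v}.
        measure (joint_law M P) (A \<times> (space M - A)) / measure M A)"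

definition conductance :: "'a measure \<Rightarrow> ('a \<Rightarrow> 'a measure) \<Rightarrow> real" where
  "conductance M P = conductance_profile M P (1/2)"

definition push_iter :: "'a measure \<Rightarrow> ('a \<Rightarrow> 'a measure) \<Rightarrow> nat \<Rightarrow> 'a measure" where
  "push_iter \<mu> P n = ((\<lambda>\<nu>. \<nu> \<bind> P) ^^ n) \<mu>"

section \<open>Action on square-integrable functions\<close>

text \<open>Elements of the Lebesgue space are represented by functions; equality of elements is
  equality almost everywhere.\<close>

definition L2 ::
  "'a measure \<Rightarrow> ('a \<Rightarrow> 'b::{banach, second_countable_topology}) set" where
  "L2 M = {f \<in> borel_measurable M. integrable M (\<lambda>x. (norm (f x))\<^sup>2)}"

definition L2_0 ::
  "'a measure \<Rightarrow> ('a \<Rightarrow> 'b::{banach, second_countable_topology}) set" where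
  "L2_0 M = {f \<in> L2 M. (\<integral>x. f x \<partial>M) = 0}"

definition L2_norm ::
  "'a measure \<Rightarrow> ('a \<Rightarrow> 'b::{banach, second_countable_topology}) \<Rightarrow> real" where
  "L2_norm M f = sqrt (\<integral>x. (norm (f x))\<^sup>2 \<partial>M)"

definition kernel_op ::
  "('a \<Rightarrow> 'a measure) \<Rightarrow> ('a \<Rightarrow> 'b::{banach, second_countable_topology}) \<Rightarrow> 'a \<Rightarrow> 'b" where
  "kernel_op P f x = (\<integral>y. f y \<partial>P x)"

definition positive_kernel :: "'a measure \<Rightarrow> ('a \<Rightarrow> 'a measure) \<Rightarrow> bool" where
  "positive_kernel M P \<longleftrightarrow> (\<forall>f::'a \<Rightarrow> real. f \<in> L2 M \<longrightarrow> 0 \<le> (\<integral>x. f x * kernel_op P f x \<partial>M))"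

text \<open>The complex number \<open>c\<close> is in the resolvent set if \<open>P - c\<close> is a bijection of the complex
  space of mean-zero functions onto itself and its inverse is bounded.\<close>

definition resolvent_set_0 :: "'a measure \<Rightarrow> ('a \<Rightarrow> 'a measure) \<Rightarrow> complex set" where
  "resolvent_set_0 M P =
     {c. (\<forall>g\<in>L2_0 M. \<exists>f\<in>L2_0 M. (AE x in M. kernel_op P f x - c * f x = g x) \<and>
            (\<forall>f'\<in>L2_0 M. (AE x in M. kernel_op P f' x - c * f' x = g x) \<longrightarrow>
               (AE x in M. f' x = f x))) \<and>
         (\<exists>C. \<forall>f\<in>L2_0 M. L2_norm M f \<le> C * L2_norm M (\<lambda>x. kernel_op P f x - c * f x))}"

definition spectrum_0 :: "'a measure \<Rightarrow> ('a \<Rightarrow> 'a measure) \<Rightarrow> complex set" where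
  "spectrum_0 M P = - resolvent_set_0 M P"

definition spectral_gap :: "'a measure \<Rightarrow> ('a \<Rightarrow> 'a measure) \<Rightarrow> ereal" where
  "spectral_gap M P = 1 - (SUP c\<in>spectrum_0 M P. ereal (cmod c))"

section \<open>Chi-squared divergence and the mixing-time bound\<close>

text \<open>Without absolute continuity there is no density, and the usual value is infinity.\<close>

definition chi_squared :: "'a measure \<Rightarrow> 'a measure \<Rightarrow> ennreal" where
  "chi_squared \<mu> M =
     (if absolutely_continuous M \<mu>
      then \<integral>\<^sup>+x. ennreal ((enn2real (RN_deriv M \<mu> x) - 1)\<^sup>2) \<partial>M else \<infinity>)"

definition log_ereal :: "ereal \<Rightarrow> ereal" where
  "log_ereal x =
     (if x = \<infinity> then \<infinity> else if x \<le> 0 then -\<infinity> else ereal (ln (real_of_ereal x)))"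

text \<open>The supremum is taken in the extended reals, where that of the empty set is
  \<open>-\<infinity>\<close>. The bound \<open>v < 2\<close> says that \<open>v/2\<close> is in the domain of \<open>I\<close>.\<close>

definition v_star :: "real \<Rightarrow> (real \<Rightarrow> real) \<Rightarrow> ereal" where
  "v_star \<delta> I =
     min (1/2) (max 0 (SUP v\<in>{v. 0 < v \<and> v < 2 \<and> 1 \<le> 1/2 * \<delta> * (I (v/2) / (v/2))}. ereal v))"

end

theory Submission
  imports Defs
begin

text \<open>If the flow out of \<open>A\<close> is small, most points of \<open>A\<close> and of its complement rarely cross to the
  other side. By the close coupling, two such points on opposite sides are at distance more than
  \<open>\<delta>\<close>, so isoperimetry gives mass of order \<open>\<delta> * I\<close> to the remaining points, which do cross with
  probability at least \<open>\<epsilon>/2\<close>. This bounds the conductance profile.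

  Applying the co-area formula to squares gives Cheeger's inequality for functions of small support.
  Splitting at the median turns it into a Poincare inequality. As \<open>P\<close> is positive, this bounds the
  operator norm on mean-zero functions, and a Neumann series locates the spectrum.

  For the mixing time, the density \<open>f\<close> of \<open>\<mu> P\<^sup>n\<close> with \<open>u = \<parallel>f\<parallel>\<^sup>2 - 1\<close> is truncated at level \<open>u/4\<close>: the
  positive part of \<open>f - u/4\<close> has support of mass at most \<open>4/u\<close> and keeps half of the variance, so
  one step multiplies \<open>u\<close> by at most \<open>1 - \<Phi>(4/u)\<^sup>2/4\<close>. In the variable \<open>\<xi> = 2/u\<close> the number of steps
  until \<open>u \<le> 8\<close> is at most an integral over \<open>\<xi>\<close>. From then on the spectral gap is used.\<close>

section \<open>Square-integrable functions\<close>

text \<open>The Minkowski content is a lower limit at radius 0, so isoperimetry supplies only a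
  growth rate; it has to be propagated up to distance \<open>\<delta>\<close>, through enlargements
  that may fail to be Borel. In the flow bound half of the mass of \<open>A\<close> and half of
  \<open>\<epsilon>\<close> are given up, whence \<open>\<epsilon>/4\<close> and the argument
  \<open>v/2\<close>. Concavity makes \<open>I p / p\<close> antitone: a bound at the mass of each
  single set becomes one at \<open>v\<close>, and \<open>v_star\<close> cuts the range of
  \<open>\<xi>\<close> into two intervals. Positivity acts in two ways. It gives
  \<open>P^2 \<le> P\<close> as quadratic forms, so that lost energy is lost chi-squared divergence
  after a single step. It also allows completing a square, which turns a bound on the quadratic form
  into a bound on the operator norm without any functional calculus. The level 8 is where
  \<open>4/u\<close> reaches 1/2, the largest argument of the profile. The constants of the mixing
  bound come from \<open>\<Phi> \<ge> \<epsilon>/4 * min 1 w\<close>: the early rate is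
  \<open>\<Phi>^2/4\<close>, the late one \<open>\<Phi>^2/2\<close>. An infinite initial divergence
  is covered because it makes the prescribed number of steps infinite.\<close>

lemma L2_real_iff:
  fixes f :: "'a \<Rightarrow> real"
  shows "f \<in> L2 M \<longleftrightarrow> f \<in> borel_measurable M \<and> integrable M (\<lambda>x. (f x)\<^sup>2)"
  by (simp add: L2_def)

lemma L2_measurable [measurable_dest]: "f \<in> L2 M \<Longrightarrow> f \<in> borel_measurable M"
  by (simp add: L2_def)

lemma L2_iff_nn_integral:
  fixes f :: "'a \<Rightarrow> 'b::{banach, second_countable_topology}"
  shows "f \<in> L2 M \<longleftrightarrow> f \<in> borel_measurable M \<and> (\<integral>\<^sup>+x. ennreal ((norm (f x))\<^sup>2) \<partial>M) < \<infinity>"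
  by (auto simp: L2_def integrable_iff_bounded)

lemma L2_norm_eq_nn_integral:
  fixes f :: "'a \<Rightarrow> 'b::{banach, second_countable_topology}"
  assumes "f \<in> L2 M"
  shows "ennreal ((L2_norm M f)\<^sup>2) = (\<integral>\<^sup>+x. ennreal ((norm (f x))\<^sup>2) \<partial>M)"
  using assms by (subst nn_integral_eq_integral) (auto simp: L2_def L2_norm_def)

lemma L2_norm_sq: "(L2_norm M f)\<^sup>2 = (\<integral>x. (norm (f x))\<^sup>2 \<partial>M)"
  by (simp add: L2_norm_def)

lemma L2_norm_nonneg [simp]: "0 \<le> L2_norm M f"
  by (simp add: L2_norm_def)

lemma L2_bound:
  fixes f :: "'a \<Rightarrow> 'b::{banach, second_countable_topology}"
    and g :: "'a \<Rightarrow> 'c::{banach, second_countable_topology}"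
  assumes "f \<in> L2 M" "g \<in> borel_measurable M" "AE x in M. norm (g x) \<le> norm (f x)"
  shows "g \<in> L2 M"
proof -
  have "(\<integral>\<^sup>+x. ennreal ((norm (g x))\<^sup>2) \<partial>M) \<le> (\<integral>\<^sup>+x. ennreal ((norm (f x))\<^sup>2) \<partial>M)"
    using assms(3) by (intro nn_integral_mono_AE) (auto elim!: eventually_mono intro!: ennreal_leI power_mono)
  with assms show ?thesis
    by (auto simp: L2_iff_nn_integral order.strict_trans1)
qed

lemma L2_add:
  fixes f g :: "'a \<Rightarrow> 'b::{banach, second_countable_topology}"
  assumes "f \<in> L2 M" "g \<in> L2 M"
  shows "(\<lambda>x. f x + g x) \<in> L2 M"
proof -
  have [measurable]: "f \<in> borel_measurable M" "g \<in> borel_measurable M"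
    using assms by (auto simp: L2_def)
  have "integrable M (\<lambda>x. (norm (f x + g x))\<^sup>2)"
  proof (rule Bochner_Integration.integrable_bound)
    show "integrable M (\<lambda>x. 2 * (norm (f x))\<^sup>2 + 2 * (norm (g x))\<^sup>2)"
      using assms by (auto simp: L2_def)
    have "(norm (f x + g x))\<^sup>2 \<le> 2 * (norm (f x))\<^sup>2 + 2 * (norm (g x))\<^sup>2" for x
    proof -
      have "(norm (f x + g x))\<^sup>2 \<le> (norm (f x) + norm (g x))\<^sup>2"
        by (intro power_mono norm_triangle_ineq) auto
      also have "\<dots> \<le> 2 * (norm (f x))\<^sup>2 + 2 * (norm (g x))\<^sup>2"
        using sum_squares_bound[of "norm (f x)" "norm (g x)"] by (simp add: power2_sum)
      finally show ?thesis .
    qed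
    then show "AE x in M. norm ((norm (f x + g x))\<^sup>2) \<le> norm (2 * (norm (f x))\<^sup>2 + 2 * (norm (g x))\<^sup>2)"
      by auto
  qed simp
  then show ?thesis by (simp add: L2_def)
qed

lemma L2_cmult:
  fixes f :: "'a \<Rightarrow> 'b::{banach, second_countable_topology, real_normed_field}"
  assumes "f \<in> L2 M"
  shows "(\<lambda>x. c * f x) \<in> L2 M"
  using assms by (auto simp: L2_def norm_mult power_mult_distrib)

lemma L2_diff:
  fixes f g :: "'a \<Rightarrow> 'b::{banach, second_countable_topology, real_normed_field}"
  assumes "f \<in> L2 M" "g \<in> L2 M"
  shows "(\<lambda>x. f x - g x) \<in> L2 M"
  using L2_add[OF assms(1) L2_cmult[OF assms(2), of "-1"]] by simp

lemma (in finite_measure) L2_const: "(\<lambda>x. c) \<in> L2 M"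
  by (simp add: L2_def)

lemma L2_mult_integrable:
  fixes f g :: "'a \<Rightarrow> real"
  assumes "f \<in> L2 M" "g \<in> L2 M"
  shows "integrable M (\<lambda>x. f x * g x)"
proof (rule Bochner_Integration.integrable_bound)
  show "integrable M (\<lambda>x. (f x)\<^sup>2 + (g x)\<^sup>2)"
    using assms by (auto simp: L2_def)
  show "(\<lambda>x. f x * g x) \<in> borel_measurable M"
    using assms by (auto simp: L2_def)
  have "\<bar>f x * g x\<bar> \<le> (f x)\<^sup>2 + (g x)\<^sup>2" for x
    using sum_squares_bound[of "\<bar>f x\<bar>" "\<bar>g x\<bar>"] mult_nonneg_nonneg[OF abs_ge_zero[of "f x"] abs_ge_zero[of "g x"]]
    by (simp only: abs_mult power2_abs)
  then show "AE x in M. norm (f x * g x) \<le> norm ((f x)\<^sup>2 + (g x)\<^sup>2)"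
    by auto
qed

lemma (in finite_measure) L2_integrable:
  fixes f :: "'a \<Rightarrow> 'b::{banach, second_countable_topology}"
  assumes "f \<in> L2 M"
  shows "integrable M f"
proof -
  have [measurable]: "f \<in> borel_measurable M"
    using assms by (auto simp: L2_def)
  show ?thesis
  proof (rule Bochner_Integration.integrable_bound)
    show "integrable M (\<lambda>x. 1 + (norm (f x))\<^sup>2)"
      using assms by (simp add: L2_def)
    have "norm (f x) \<le> 1 + (norm (f x))\<^sup>2" for x
    proof -
      have "2 * norm (f x) \<le> 1 + (norm (f x))\<^sup>2"
        using sum_squares_bound[of 1 "norm (f x)"] by simp
      with norm_ge_zero[of "f x"] show ?thesis by linarith
    qed
    then show "AE x in M. norm (f x) \<le> norm (1 + (norm (f x))\<^sup>2)"
      by auto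
  qed simp
qed

lemma L2_Cauchy_Schwarz:
  fixes f g :: "'a \<Rightarrow> real"
  assumes "f \<in> L2 M" "g \<in> L2 M"
  shows "(\<integral>x. \<bar>f x * g x\<bar> \<partial>M) \<le> L2_norm M f * L2_norm M g"
proof -
  have [measurable]: "f \<in> borel_measurable M" "g \<in> borel_measurable M"
    using assms by (auto simp: L2_def)
  have "ennreal ((\<integral>x. \<bar>f x * g x\<bar> \<partial>M)\<^sup>2) = (\<integral>\<^sup>+x. ennreal \<bar>f x\<bar> * ennreal \<bar>g x\<bar> \<partial>M)\<^sup>2"
    using L2_mult_integrable[OF assms]
    by (subst ennreal_power[symmetric], simp, subst nn_integral_eq_integral[symmetric])
       (auto simp flip: ennreal_mult' simp: abs_mult[symmetric])
  also have "\<dots> \<le> (\<integral>\<^sup>+x. (ennreal \<bar>f x\<bar>)\<^sup>2 \<partial>M) * (\<integral>\<^sup>+x. (ennreal \<bar>g x\<bar>)\<^sup>2 \<partial>M)"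
    by (rule Cauchy_Schwarz_nn_integral) auto
  also have "\<dots> = ennreal ((L2_norm M f * L2_norm M g)\<^sup>2)"
    using assms by (simp add: L2_norm_eq_nn_integral power_mult_distrib ennreal_mult ennreal_power)
  finally have "(\<integral>x. \<bar>f x * g x\<bar> \<partial>M)\<^sup>2 \<le> (L2_norm M f * L2_norm M g)\<^sup>2"
    by simp
  then show ?thesis
    by (rule power2_le_imp_le) simp
qed

lemma L2_norm_triangle:
  fixes f g :: "'a \<Rightarrow> 'b::{banach, second_countable_topology}"
  assumes "f \<in> L2 M" "g \<in> L2 M"
  shows "L2_norm M (\<lambda>x. f x + g x) \<le> L2_norm M f + L2_norm M g"
proof -
  let ?f = "\<lambda>x. norm (f x)" and ?g = "\<lambda>x. norm (g x)"
  have n: "?f \<in> L2 M" "?g \<in> L2 M"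
    using assms by (auto simp: L2_def)
  have "(L2_norm M (\<lambda>x. f x + g x))\<^sup>2 \<le> (\<integral>x. (?f x)\<^sup>2 + (?g x)\<^sup>2 + 2 * \<bar>?f x * ?g x\<bar> \<partial>M)"
    unfolding L2_norm_sq
  proof (rule integral_mono)
    show "integrable M (\<lambda>x. (norm (f x + g x))\<^sup>2)"
      using L2_add[OF assms] by (simp add: L2_def)
    show "integrable M (\<lambda>x. (?f x)\<^sup>2 + (?g x)\<^sup>2 + 2 * \<bar>?f x * ?g x\<bar>)"
      using n L2_mult_integrable[OF n] by (auto simp: L2_def)
    show "(norm (f x + g x))\<^sup>2 \<le> (?f x)\<^sup>2 + (?g x)\<^sup>2 + 2 * \<bar>?f x * ?g x\<bar>" for x
      using power_mono[OF norm_triangle_ineq[of "f x" "g x"], of 2]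
      by (simp add: power2_sum abs_mult)
  qed
  also have "\<dots> = (L2_norm M f)\<^sup>2 + (L2_norm M g)\<^sup>2 + 2 * (\<integral>x. \<bar>?f x * ?g x\<bar> \<partial>M)"
    using n L2_mult_integrable[OF n] by (simp add: L2_norm_sq L2_def)
  also have "\<dots> \<le> (L2_norm M f)\<^sup>2 + (L2_norm M g)\<^sup>2 + 2 * (L2_norm M f * L2_norm M g)"
    using L2_Cauchy_Schwarz[OF n] by (simp add: L2_norm_def)
  also have "\<dots> = (L2_norm M f + L2_norm M g)\<^sup>2"
    by (simp add: power2_sum)
  finally show ?thesis
    by (rule power2_le_imp_le) simp
qed

section \<open>Reversible kernels\<close>

locale reversible_kernel = prob_space M for M :: "'a measure" +
  fixes P :: "'a \<Rightarrow> 'a measure"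
  assumes kernel [measurable]: "P \<in> M \<rightarrow>\<^sub>M prob_algebra M"
    and rev: "reversible M P"
begin

abbreviation "J \<equiv> joint_law M P"
abbreviation "T \<equiv> kernel_op P"

lemma kernel_subprob [measurable]: "P \<in> M \<rightarrow>\<^sub>M subprob_algebra M"
  using kernel by (rule measurable_prob_algebraD)

lemma kernel_space:
  assumes "x \<in> space M"
  shows "prob_space (P x)" "sets (P x) = sets M" "space (P x) = space M"
  using measurable_space[OF kernel assms]
  by (auto simp: space_prob_algebra dest: sets_eq_imp_space_eq)

lemma M_in_prob_algebra: "M \<in> space (prob_algebra M)"
  by (simp add: space_prob_algebra prob_space_axioms)

lemma J_kernel: "(\<lambda>x. distr (P x) (M \<Otimes>\<^sub>M M) (Pair x)) \<in> M \<rightarrow>\<^sub>M prob_algebra (M \<Otimes>\<^sub>M M)"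
  by measurable

lemma sets_J [simp, measurable_cong]: "sets J = sets (M \<Otimes>\<^sub>M M)"
  unfolding joint_law_def by (rule sets_bind'[OF M_in_prob_algebra J_kernel])

lemma space_J [simp]: "space J = space M \<times> space M"
  using sets_eq_imp_space_eq[OF sets_J] by (simp add: space_pair_measure)

lemma prob_space_J: "prob_space J"
  unfolding joint_law_def by (rule prob_space_bind'[OF M_in_prob_algebra J_kernel])

sublocale J: prob_space J by (rule prob_space_J)

lemma nn_integral_J:
  assumes [measurable]: "h \<in> borel_measurable (M \<Otimes>\<^sub>M M)"
  shows "(\<integral>\<^sup>+z. h z \<partial>J) = (\<integral>\<^sup>+x. \<integral>\<^sup>+y. h (x, y) \<partial>P x \<partial>M)"
proof -
  have "(\<integral>\<^sup>+z. h z \<partial>J) = (\<integral>\<^sup>+x. \<integral>\<^sup>+z. h z \<partial>distr (P x) (M \<Otimes>\<^sub>M M) (Pair x) \<partial>M)"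
    unfolding joint_law_def
    by (rule nn_integral_bind[OF assms measurable_prob_algebraD[OF J_kernel]])
  also have "\<dots> = (\<integral>\<^sup>+x. \<integral>\<^sup>+y. h (x, y) \<partial>P x \<partial>M)"
  proof (rule nn_integral_cong)
    fix x assume x: "x \<in> space M"
    have "Pair x \<in> P x \<rightarrow>\<^sub>M M \<Otimes>\<^sub>M M"
      using measurable_Pair1'[OF x] kernel_space(2)[OF x] by (simp cong: measurable_cong_sets)
    then show "(\<integral>\<^sup>+z. h z \<partial>distr (P x) (M \<Otimes>\<^sub>M M) (Pair x)) = (\<integral>\<^sup>+y. h (x, y) \<partial>P x)"
      by (subst nn_integral_distr) auto
  qed
  finally show ?thesis .
qed

lemma distr_J_swap: "distr J (M \<Otimes>\<^sub>M M) (\<lambda>(x, y). (y, x)) = J"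
  using rev by (simp add: reversible_def)

lemma nn_integral_J_swap:
  assumes [measurable]: "(\<lambda>(x, y). h x y) \<in> borel_measurable (M \<Otimes>\<^sub>M M)"
  shows "(\<integral>\<^sup>+(x, y). h y x \<partial>J) = (\<integral>\<^sup>+(x, y). h x y \<partial>J)"
proof -
  have "(\<integral>\<^sup>+(x, y). h x y \<partial>J) = (\<integral>\<^sup>+(x, y). h x y \<partial>distr J (M \<Otimes>\<^sub>M M) (\<lambda>(x, y). (y, x)))"
    by (simp add: distr_J_swap)
  also have "\<dots> = (\<integral>\<^sup>+(x, y). h y x \<partial>J)"
    by (subst nn_integral_distr) (auto simp: case_prod_beta' )
  finally show ?thesis by simp
qed

lemma integral_J_swap:
  fixes h :: "'a \<Rightarrow> 'a \<Rightarrow> real"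
  assumes [measurable]: "(\<lambda>(x, y). h x y) \<in> borel_measurable (M \<Otimes>\<^sub>M M)"
  shows "(\<integral>(x, y). h y x \<partial>J) = (\<integral>(x, y). h x y \<partial>J)"
proof -
  have "(\<integral>(x, y). h x y \<partial>J) = (\<integral>(x, y). h x y \<partial>distr J (M \<Otimes>\<^sub>M M) (\<lambda>(x, y). (y, x)))"
    by (simp add: distr_J_swap)
  also have "\<dots> = (\<integral>(x, y). h y x \<partial>J)"
    by (subst integral_distr) (auto simp: case_prod_beta')
  finally show ?thesis by simp
qed

lemma nn_integral_kernel_const: "x \<in> space M \<Longrightarrow> (\<integral>\<^sup>+y. c \<partial>P x) = c"
  using prob_space.emeasure_space_1[OF kernel_space(1), of x] by simp

lemma nn_integral_J_fst:
  assumes [measurable]: "f \<in> borel_measurable M"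
  shows "(\<integral>\<^sup>+z. f (fst z) \<partial>J) = (\<integral>\<^sup>+x. f x \<partial>M)"
  by (subst nn_integral_J) (auto intro!: nn_integral_cong simp: nn_integral_kernel_const simp del: nn_integral_const)

lemma distr_J_fst: "distr J M fst = M"
proof (rule measure_eqI)
  fix A assume "A \<in> sets (distr J M fst)"
  then have [measurable]: "A \<in> sets M" by simp
  have "emeasure (distr J M fst) A = (\<integral>\<^sup>+z. indicator A (fst z) \<partial>J)"
    by (subst nn_integral_indicator[symmetric], simp, subst nn_integral_distr) auto
  then show "emeasure (distr J M fst) A = emeasure M A"
    by (simp add: nn_integral_J_fst)
qed simp

text \<open>This is the invariance of \<open>M\<close>: reversibility exchanges the two marginals,
  and the first one is \<open>M\<close> because every \<open>P x\<close> has mass 1.\<close>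

lemma distr_J_snd: "distr J M snd = M"
proof -
  have "distr J M snd = distr (distr J (M \<Otimes>\<^sub>M M) (\<lambda>(x, y). (y, x))) M snd"
    by (simp add: distr_J_swap)
  also have "\<dots> = distr J M fst"
    by (subst distr_distr) (auto intro!: distr_cong)
  finally show ?thesis by (simp add: distr_J_fst)
qed

lemma nn_integral_J_snd:
  assumes [measurable]: "f \<in> borel_measurable M"
  shows "(\<integral>\<^sup>+z. f (snd z) \<partial>J) = (\<integral>\<^sup>+x. f x \<partial>M)"
  by (subst (2) distr_J_snd[symmetric], subst nn_integral_distr) auto

lemma nn_integral_kernel:
  assumes [measurable]: "f \<in> borel_measurable M"
  shows "(\<integral>\<^sup>+x. \<integral>\<^sup>+y. f y \<partial>P x \<partial>M) = (\<integral>\<^sup>+x. f x \<partial>M)"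
  using nn_integral_J_snd[of f] by (simp add: nn_integral_J)

lemma L2_J_marginals:
  fixes f :: "'a \<Rightarrow> real"
  assumes f: "f \<in> L2 M"
  shows "(\<lambda>z. f (fst z)) \<in> L2 J" "(\<lambda>z. f (snd z)) \<in> L2 J"
proof -
  have [measurable]: "f \<in> borel_measurable M" using f by (simp add: L2_def)
  show "(\<lambda>z. f (fst z)) \<in> L2 J"
    using f nn_integral_J_fst[of "\<lambda>x. ennreal ((norm (f x))\<^sup>2)"] by (auto simp: L2_iff_nn_integral)
  show "(\<lambda>z. f (snd z)) \<in> L2 J"
    using f nn_integral_J_snd[of "\<lambda>x. ennreal ((norm (f x))\<^sup>2)"] by (auto simp: L2_iff_nn_integral)
qed

lemma integral_J_fst:
  fixes f :: "'a \<Rightarrow> real"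
  assumes [measurable]: "f \<in> borel_measurable M"
  shows "(\<integral>z. f (fst z) \<partial>J) = (\<integral>x. f x \<partial>M)"
  by (subst (2) distr_J_fst[symmetric], subst integral_distr) auto

lemma integral_J_snd:
  fixes f :: "'a \<Rightarrow> real"
  assumes [measurable]: "f \<in> borel_measurable M"
  shows "(\<integral>z. f (snd z) \<partial>J) = (\<integral>x. f x \<partial>M)"
  by (subst (2) distr_J_snd[symmetric], subst integral_distr) auto

lemma integral_J:
  fixes h :: "'a \<times> 'a \<Rightarrow> real"
  assumes h: "integrable J h"
  shows "AE x in M. integrable (P x) (\<lambda>y. h (x, y))"
    and "(\<integral>z. h z \<partial>J) = (\<integral>x. \<integral>y. h (x, y) \<partial>P x \<partial>M)"
proof -
  have [measurable]: "h \<in> borel_measurable (M \<Otimes>\<^sub>M M)"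
    using borel_measurable_integrable[OF h] by simp
  have m: "(\<lambda>y. h (x, y)) \<in> borel_measurable (P x)" if "x \<in> space M" for x
    using that kernel_space(2)[OF that] measurable_Pair1'[OF that, of M]
    by (auto cong: measurable_cong_sets intro!: measurable_compose[OF _ \<open>h \<in> borel_measurable (M \<Otimes>\<^sub>M M)\<close>])
  \<comment> \<open>Since \<open>ennreal\<close> truncates at 0, \<open>n 1 x\<close> and
    \<open>n (-1) x\<close> are the integrals of the positive and the negative part of
    \<open>h (x, _)\<close>. The signed identity is the difference of the two nonnegative
    ones.\<close>
  define n where "n = (\<lambda>s x. \<integral>\<^sup>+y. ennreal (s * h (x, y)) \<partial>P x)"
  have [measurable]: "n s \<in> borel_measurable M" for s
    unfolding n_def by (rule nn_integral_measurable_subprob_algebra2[OF _ kernel_subprob]) simp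
  have int_n: "(\<integral>\<^sup>+x. n s x \<partial>M) = (\<integral>\<^sup>+z. ennreal (s * h z) \<partial>J)" for s
    unfolding n_def by (subst nn_integral_J) auto
  have fin: "(\<integral>\<^sup>+x. n s x \<partial>M) < \<infinity>" for s
  proof -
    have "integrable J (\<lambda>z. s * h z)" using h by simp
    then have "(\<integral>\<^sup>+z. ennreal (norm (s * h z)) \<partial>J) < \<infinity>"
      unfolding integrable_iff_bounded by simp
    moreover have "(\<integral>\<^sup>+z. ennreal (s * h z) \<partial>J) \<le> (\<integral>\<^sup>+z. ennreal (norm (s * h z)) \<partial>J)"
      by (intro nn_integral_mono ennreal_leI) auto
    ultimately show ?thesis unfolding int_n by (rule order.strict_trans1[rotated])
  qed
  have AE_fin: "AE x in M. n s x < \<infinity>" for s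
    using nn_integral_PInf_AE[of "n s" M] fin[of s] by (auto simp: less_top)
  have sum: "(\<integral>\<^sup>+y. ennreal (norm (h (x, y))) \<partial>P x) = n 1 x + n (-1) x" if "x \<in> space M" for x
    unfolding n_def using m[OF that]
    by (subst nn_integral_add[symmetric])
       (auto intro!: nn_integral_cong simp: ennreal_neg abs_if)
  show AE_int: "AE x in M. integrable (P x) (\<lambda>y. h (x, y))"
    using AE_fin[of 1] AE_fin[of "-1"] AE_space
    by eventually_elim (auto simp: integrable_iff_bounded m sum simp del: real_norm_def)
  have real_n: "integrable M (\<lambda>x. enn2real (n s x))"
    "(\<integral>x. enn2real (n s x) \<partial>M) = enn2real (\<integral>\<^sup>+z. ennreal (s * h z) \<partial>J)" for s
  proof -
    have "(\<integral>\<^sup>+x. ennreal (enn2real (n s x)) \<partial>M) = (\<integral>\<^sup>+x. n s x \<partial>M)"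
      using AE_fin[of s] by (intro nn_integral_cong_AE) (auto elim!: eventually_mono)
    with fin[of s] int_n[of s]
    have eq: "(\<integral>\<^sup>+x. ennreal (enn2real (n s x)) \<partial>M) = (\<integral>\<^sup>+z. ennreal (s * h z) \<partial>J)"
      and "(\<integral>\<^sup>+x. ennreal (enn2real (n s x)) \<partial>M) < \<infinity>"
      by simp_all
    then show "integrable M (\<lambda>x. enn2real (n s x))"
      by (intro integrableI_nonneg) auto
    show "(\<integral>x. enn2real (n s x) \<partial>M) = enn2real (\<integral>\<^sup>+z. ennreal (s * h z) \<partial>J)"
      by (subst integral_eq_nn_integral) (auto simp: eq)
  qed
  have "(\<integral>x. \<integral>y. h (x, y) \<partial>P x \<partial>M) = (\<integral>x. enn2real (n 1 x) - enn2real (n (-1) x) \<partial>M)"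
  proof (rule integral_cong_AE)
    show "(\<lambda>x. \<integral>y. h (x, y) \<partial>P x) \<in> borel_measurable M"
    proof -
      have "(\<lambda>x. \<integral>z. h z \<partial>distr (P x) (M \<Otimes>\<^sub>M M) (Pair x)) \<in> borel_measurable M"
        by (rule measurable_compose[OF measurable_prob_algebraD[OF J_kernel]
              integral_measurable_subprob_algebra]) simp
      moreover have "(\<integral>z. h z \<partial>distr (P x) (M \<Otimes>\<^sub>M M) (Pair x)) = (\<integral>y. h (x, y) \<partial>P x)"
        if "x \<in> space M" for x
        using measurable_Pair1'[OF that, of M] kernel_space(2)[OF that]
        by (subst integral_distr) (auto cong: measurable_cong_sets)
      ultimately show ?thesis
        by (simp cong: measurable_cong)
    qed
    show "AE x in M. (\<integral>y. h (x, y) \<partial>P x) = enn2real (n 1 x) - enn2real (n (-1) x)"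
      using AE_int by eventually_elim (simp add: real_lebesgue_integral_def n_def)
  qed auto
  also have "\<dots> = (\<integral>z. h z \<partial>J)"
    by (simp add: real_n real_lebesgue_integral_def[OF h])
  finally show "(\<integral>z. h z \<partial>J) = (\<integral>x. \<integral>y. h (x, y) \<partial>P x \<partial>M)" ..
qed

lemma kernel_op_measurable [measurable]:
  fixes f :: "'a \<Rightarrow> 'b::{banach, second_countable_topology}"
  assumes [measurable]: "f \<in> borel_measurable M"
  shows "T f \<in> borel_measurable M"
  unfolding kernel_op_def by measurable

lemma norm_kernel_op_sq_le:
  fixes f :: "'a \<Rightarrow> 'b::{banach, second_countable_topology}"
  assumes [measurable]: "f \<in> borel_measurable M" and x: "x \<in> space M"
  shows "ennreal ((norm (T f x))\<^sup>2) \<le> (\<integral>\<^sup>+y. ennreal ((norm (f y))\<^sup>2) \<partial>P x)"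
proof -
  have [measurable]: "f \<in> borel_measurable (P x)"
    using kernel_space(2)[OF x] by (simp cong: measurable_cong_sets)
  \<comment> \<open>Where \<open>f\<close> is not integrable under \<open>P x\<close>, the Bochner
    integral is 0 by convention, so the bound holds at every point. What follows is Jensen's
    inequality, obtained as Cauchy-Schwarz against the constant 1.\<close>
  have "ennreal (norm (T f x)) \<le> (\<integral>\<^sup>+y. ennreal (norm (f y)) \<partial>P x)"
    unfolding kernel_op_def
    by (cases "integrable (P x) f") (auto intro: integral_norm_bound_ennreal simp: not_integrable_integral_eq)
  then have "ennreal ((norm (T f x))\<^sup>2) \<le> (\<integral>\<^sup>+y. ennreal (norm (f y)) * 1 \<partial>P x)\<^sup>2"
    by (simp add: ennreal_power[symmetric] power_mono)
  also have "\<dots> \<le> (\<integral>\<^sup>+y. (ennreal (norm (f y)))\<^sup>2 \<partial>P x) * (\<integral>\<^sup>+y. 1\<^sup>2 \<partial>P x)"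
    by (rule Cauchy_Schwarz_nn_integral) auto
  also have "\<dots> = (\<integral>\<^sup>+y. ennreal ((norm (f y))\<^sup>2) \<partial>P x)"
    by (simp add: prob_space.emeasure_space_1[OF kernel_space(1)[OF x]] ennreal_power)
  finally show ?thesis .
qed

lemma kernel_op_L2:
  fixes f :: "'a \<Rightarrow> 'b::{banach, second_countable_topology}"
  assumes f: "f \<in> L2 M"
  shows "T f \<in> L2 M"
proof -
  have [measurable]: "f \<in> borel_measurable M"
    using f by (simp add: L2_def)
  have "(\<integral>\<^sup>+x. ennreal ((norm (T f x))\<^sup>2) \<partial>M) \<le> (\<integral>\<^sup>+x. \<integral>\<^sup>+y. ennreal ((norm (f y))\<^sup>2) \<partial>P x \<partial>M)"
    by (intro nn_integral_mono norm_kernel_op_sq_le) auto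
  also have "\<dots> < \<infinity>"
    using f by (simp add: nn_integral_kernel L2_iff_nn_integral)
  finally show ?thesis
    by (simp add: L2_iff_nn_integral)
qed

text \<open>Invariance carries integrability over to almost every \<open>P x\<close>. Only at such
  points is \<open>T\<close> additive, which is why later identities for \<open>T\<close> hold
  almost everywhere.\<close>

lemma AE_kernel_integrable:
  fixes f :: "'a \<Rightarrow> 'b::{banach, second_countable_topology}"
  assumes f: "integrable M f"
  shows "AE x in M. integrable (P x) f"
proof -
  have [measurable]: "f \<in> borel_measurable M"
    using f by simp
  have "(\<integral>\<^sup>+x. \<integral>\<^sup>+y. ennreal (norm (f y)) \<partial>P x \<partial>M) < \<infinity>"
    using f by (simp add: nn_integral_kernel integrable_iff_bounded)
  then have "AE x in M. (\<integral>\<^sup>+y. ennreal (norm (f y)) \<partial>P x) \<noteq> \<infinity>"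
    by (intro nn_integral_PInf_AE) auto
  then show ?thesis
    using AE_space
  proof eventually_elim
    case (elim x)
    have "f \<in> borel_measurable (P x)"
      using kernel_space(2)[OF elim(2)] by (simp cong: measurable_cong_sets)
    then show ?case
      using elim(1) by (simp add: integrable_iff_bounded less_top)
  qed
qed

lemma integral_kernel_op:
  fixes f :: "'a \<Rightarrow> real"
  assumes f: "integrable M f"
  shows "(\<integral>x. T f x \<partial>M) = (\<integral>x. f x \<partial>M)"
proof -
  have [measurable]: "f \<in> borel_measurable M" using f by simp
  have "integrable J (\<lambda>z. f (snd z))"
    using f nn_integral_J_snd[of "\<lambda>x. ennreal (norm (f x))"] by (simp add: integrable_iff_bounded)
  from integral_J(2)[OF this] show ?thesis
    by (simp add: integral_J_snd kernel_op_def)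
qed

text \<open>For square-integrable functions this is the inner product of \<open>f\<close> with
  \<open>P g\<close>; written over \<open>J\<close>, self-adjointness of \<open>P\<close> is the
  symmetry of \<open>J\<close>.\<close>

definition form :: "('a \<Rightarrow> real) \<Rightarrow> ('a \<Rightarrow> real) \<Rightarrow> real" where
  "form f g = (\<integral>z. f (fst z) * g (snd z) \<partial>J)"

text \<open>Twice the usual Dirichlet form. With this normalisation Cheeger's inequality carries no
  factor 1/2; the factor reappears in the gap.\<close>

definition energy :: "('a \<Rightarrow> real) \<Rightarrow> real" where
  "energy f = (\<integral>z. (f (fst z) - f (snd z))\<^sup>2 \<partial>J)"

lemma form_integrable:
  fixes f g :: "'a \<Rightarrow> real"
  assumes "f \<in> L2 M" "g \<in> L2 M"
  shows "integrable J (\<lambda>z. f (fst z) * g (snd z))"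
  using L2_mult_integrable[OF L2_J_marginals(1)[OF assms(1)] L2_J_marginals(2)[OF assms(2)]] .

lemma energy_integrable:
  fixes f :: "'a \<Rightarrow> real"
  assumes "f \<in> L2 M"
  shows "integrable J (\<lambda>z. (f (fst z) - f (snd z))\<^sup>2)"
  using L2_diff[OF L2_J_marginals(1)[OF assms] L2_J_marginals(2)[OF assms]] by (simp add: L2_real_iff)

lemma form_eq:
  assumes "f \<in> L2 M" "g \<in> L2 M"
  shows "form f g = (\<integral>x. f x * T g x \<partial>M)"
  using integral_J(2)[OF form_integrable[OF assms]] by (simp add: form_def kernel_op_def)

lemma form_sym:
  assumes [measurable]: "f \<in> borel_measurable M" "g \<in> borel_measurable M"
  shows "form f g = form g f"
  using integral_J_swap[of "\<lambda>x y. f x * g y"] by (simp add: form_def case_prod_beta case_prod_beta' mult.commute)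

lemma energy_eq:
  assumes "f \<in> L2 M"
  shows "energy f = 2 * (\<integral>x. (f x)\<^sup>2 \<partial>M) - 2 * form f f"
proof -
  note i = L2_J_marginals[OF assms] form_integrable[OF assms assms]
  have [measurable]: "f \<in> borel_measurable M" using assms by (simp add: L2_def)
  have "energy f = (\<integral>z. (f (fst z))\<^sup>2 + (f (snd z))\<^sup>2 - 2 * (f (fst z) * f (snd z)) \<partial>J)"
    by (simp add: energy_def power2_diff mult.assoc)
  also have "\<dots> = (\<integral>z. (f (fst z))\<^sup>2 \<partial>J) + (\<integral>z. (f (snd z))\<^sup>2 \<partial>J) - 2 * form f f"
    using i unfolding form_def L2_real_iff by simp
  finally show ?thesis
    by (simp add: integral_J_fst[of "\<lambda>x. (f x)\<^sup>2"] integral_J_snd[of "\<lambda>x. (f x)\<^sup>2"])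
qed

lemma energy_nonneg: "0 \<le> energy f"
  by (simp add: energy_def)

text \<open>As a quadratic polynomial in \<open>t\<close> this is nonnegative for positive
  \<open>P\<close>. It is applied with \<open>g = T f\<close>, at \<open>t = 1\<close> and at
  \<open>t = 1/l\<close>.\<close>

lemma form_expand:
  assumes f: "f \<in> L2 M" and g: "g \<in> L2 M"
  shows "form (\<lambda>x. f x - t * g x) (\<lambda>x. f x - t * g x) = form f f - 2 * t * form f g + t\<^sup>2 * form g g"
proof -
  have [measurable]: "f \<in> borel_measurable M" "g \<in> borel_measurable M"
    using f g by (auto simp: L2_def)
  note i = form_integrable[OF f f] form_integrable[OF f g] form_integrable[OF g f] form_integrable[OF g g]
  have "form (\<lambda>x. f x - t * g x) (\<lambda>x. f x - t * g x) =
    (\<integral>z. f (fst z) * f (snd z) - t * (f (fst z) * g (snd z)) - t * (g (fst z) * f (snd z))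
       + t\<^sup>2 * (g (fst z) * g (snd z)) \<partial>J)"
    unfolding form_def by (intro Bochner_Integration.integral_cong) (auto simp: algebra_simps power2_eq_square)
  also have "\<dots> = form f f - t * form f g - t * form g f + t\<^sup>2 * form g g"
    using i by (simp add: form_def)
  finally show ?thesis
    using form_sym[of f g] by simp
qed

end

section \<open>Cheeger's inequality\<close>

lemma (in prob_space) median_exists:
  fixes f :: "'a \<Rightarrow> real"
  assumes [measurable]: "f \<in> borel_measurable M"
  obtains m where "prob {x \<in> space M. m < f x} \<le> 1/2" "prob {x \<in> space M. f x < m} \<le> 1/2"
proof -
  interpret N: real_distribution "distr M borel f"
    by (rule real_distribution_distr) simp
  let ?F = "cdf (distr M borel f)"
  define S where "S = {t. 1/2 \<le> ?F t}"
  \<comment> \<open>The least point where the distribution function reaches 1/2: right continuity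
    controls the mass above \<open>m\<close>, the left limit the mass below it.\<close>
  define m where "m = Inf S"
  have "\<forall>\<^sub>F t in at_top. 1/2 < ?F t"
    by (rule order_tendstoD(1)[OF N.cdf_lim_at_top_prob]) simp
  then obtain t1 where "1/2 < ?F t1"
    by (auto simp: eventually_at_top_linorder)
  then have ne: "S \<noteq> {}"
    by (auto simp: S_def intro!: exI[of _ t1])
  have "\<forall>\<^sub>F t in at_bot. ?F t < 1/2"
    by (rule order_tendstoD(2)[OF N.cdf_lim_at_bot]) simp
  then obtain t0 where t0: "\<And>t. t \<le> t0 \<Longrightarrow> ?F t < 1/2"
    by (auto simp: eventually_at_bot_linorder)
  have bdd: "bdd_below S"
  proof (rule bdd_belowI[of _ t0])
    show "t0 \<le> t" if "t \<in> S" for t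
      using that t0[of t] by (cases "t \<le> t0") (auto simp: S_def)
  qed
  have above: "1/2 \<le> ?F t" if "m < t" for t
  proof -
    obtain s where "s \<in> S" "s < t"
      using \<open>m < t\<close> cInf_less_iff[OF ne bdd] by (auto simp: m_def)
    then show ?thesis
      using N.cdf_nondecreasing[of s t] by (auto simp: S_def)
  qed
  have below: "?F t < 1/2" if "t < m" for t
    using that cInf_lower[OF _ bdd, of t] by (force simp: m_def S_def)
  have "1/2 \<le> ?F m"
  proof (rule tendsto_lowerbound)
    show "(?F \<longlongrightarrow> ?F m) (at_right m)"
      using N.cdf_is_right_cont[of m] by (simp add: continuous_within)
    show "\<forall>\<^sub>F t in at_right m. 1/2 \<le> ?F t"
      using above by (auto simp: eventually_at_filter)
  qed simp
  moreover have "?F m = prob {x \<in> space M. f x \<le> m}"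
    unfolding cdf_def by (subst measure_distr) (auto intro!: arg_cong[where f=prob])
  moreover have "prob {x \<in> space M. m < f x} = 1 - prob {x \<in> space M. f x \<le> m}"
    using prob_compl[of "{x \<in> space M. f x \<le> m}"]
    by (simp add: set_diff_eq not_le cong: conj_cong)
  ultimately have 1: "prob {x \<in> space M. m < f x} \<le> 1/2"
    by simp
  have "measure (distr M borel f) {..<m} \<le> 1/2"
  proof (rule tendsto_upperbound[OF N.cdf_at_left])
    show "\<forall>\<^sub>F t in at_left m. ?F t \<le> 1/2"
      using below by (auto simp: eventually_at_filter less_imp_le)
  qed simp
  moreover have "measure (distr M borel f) {..<m} = prob {x \<in> space M. f x < m}"
    by (subst measure_distr) (auto intro!: arg_cong[where f=prob])
  ultimately have "prob {x \<in> space M. f x < m} \<le> 1/2"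
    by simp
  with 1 show ?thesis by (rule that)
qed

text \<open>Layer-cake formula for the positive part of a difference: if \<open>b < a\<close>, both
  sides are 0.\<close>

lemma ennreal_diff_eq_nn_integral:
  fixes a b :: real
  shows "ennreal (b - a) = (\<integral>\<^sup>+t. (if a \<le> t \<and> t < b then 1 else 0) \<partial>lborel)"
proof -
  have "(\<integral>\<^sup>+t. (if a \<le> t \<and> t < b then 1 else 0) \<partial>lborel) = (\<integral>\<^sup>+t. indicator {a..<b} t \<partial>lborel)"
    by (intro nn_integral_cong) auto
  also have "\<dots> = ennreal (b - a)"
    by (cases "a \<le> b") (auto simp: ennreal_neg)
  finally show ?thesis ..
qed

context reversible_kernel
begin

abbreviation "\<Phi> \<equiv> conductance_profile M P"

text \<open>Cleared of the division, the inequality includes the null sets, over which the infimum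
  does not range.\<close>

lemma conductance_profile_le:
  assumes "A \<in> sets M" "prob A \<le> v"
  shows "\<Phi> v * prob A \<le> measure J (A \<times> (space M - A))"
proof (cases "prob A = 0")
  case False
  then have pos: "0 < prob A"
    by (simp add: zero_less_measure_iff)
  have "\<Phi> v \<le> measure J (A \<times> (space M - A)) / prob A"
    unfolding conductance_profile_def
    by (rule cINF_lower) (use assms pos in \<open>auto intro!: bdd_belowI[of _ 0]\<close>)
  then show ?thesis
    using pos by (simp add: field_simps)
qed simp

text \<open>By Fubini both sides are integrals over the level \<open>t\<close> of quantities of the
  set where \<open>h > t\<close>: its mass, and the flow out of it. For \<open>t \<ge> 0\<close>
  this set has mass at most \<open>v\<close>, so the profile applies level by level.\<close>

lemma coarea_conductance:
  fixes h :: "'a \<Rightarrow> real"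
  assumes [measurable]: "h \<in> borel_measurable M" and nonneg: "\<And>x. 0 \<le> h x"
    and supp: "prob {x \<in> space M. 0 < h x} \<le> v"
  shows "ennreal (\<Phi> v) * (\<integral>\<^sup>+x. ennreal (h x) \<partial>M) \<le> (\<integral>\<^sup>+z. ennreal (h (fst z) - h (snd z)) \<partial>J)"
proof -
  interpret M1: pair_sigma_finite M lborel ..
  interpret J1: pair_sigma_finite J lborel ..
  have "(\<integral>\<^sup>+x. ennreal (h x) \<partial>M) = (\<integral>\<^sup>+x. \<integral>\<^sup>+t. (if 0 \<le> t \<and> t < h x then 1 else 0) \<partial>lborel \<partial>M)"
    using ennreal_diff_eq_nn_integral[of _ 0] by simp
  also have "\<dots> = (\<integral>\<^sup>+t. \<integral>\<^sup>+x. (if 0 \<le> t \<and> t < h x then 1 else 0) \<partial>M \<partial>lborel)"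
    using M1.Fubini[of "\<lambda>(x, t). if 0 \<le> t \<and> t < h x then 1 else 0"] by simp
  finally have left: "(\<integral>\<^sup>+x. ennreal (h x) \<partial>M) =
    (\<integral>\<^sup>+t. \<integral>\<^sup>+x. (if 0 \<le> t \<and> t < h x then 1 else 0) \<partial>M \<partial>lborel)" .
  have "(\<integral>\<^sup>+z. ennreal (h (fst z) - h (snd z)) \<partial>J) =
    (\<integral>\<^sup>+z. \<integral>\<^sup>+t. (if h (snd z) \<le> t \<and> t < h (fst z) then 1 else 0) \<partial>lborel \<partial>J)"
    by (simp only: ennreal_diff_eq_nn_integral)
  also have "\<dots> = (\<integral>\<^sup>+t. \<integral>\<^sup>+z. (if h (snd z) \<le> t \<and> t < h (fst z) then 1 else 0) \<partial>J \<partial>lborel)"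
    using J1.Fubini[of "\<lambda>(z, t). if h (snd z) \<le> t \<and> t < h (fst z) then 1 else 0"] by simp
  finally have right: "(\<integral>\<^sup>+z. ennreal (h (fst z) - h (snd z)) \<partial>J) =
    (\<integral>\<^sup>+t. \<integral>\<^sup>+z. (if h (snd z) \<le> t \<and> t < h (fst z) then 1 else 0) \<partial>J \<partial>lborel)" .
  have level: "ennreal (\<Phi> v) * (\<integral>\<^sup>+x. (if 0 \<le> t \<and> t < h x then 1 else 0) \<partial>M) \<le>
      (\<integral>\<^sup>+z. (if h (snd z) \<le> t \<and> t < h (fst z) then 1 else 0) \<partial>J)" for t
  proof (cases "0 \<le> t")
    case True
    define A where "A = {x \<in> space M. t < h x}"
    have [measurable]: "A \<in> sets M"
      unfolding A_def by measurable
    have "prob A \<le> prob {x \<in> space M. 0 < h x}"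
      using True by (intro finite_measure_mono) (auto simp: A_def)
    then have "\<Phi> v * prob A \<le> measure J (A \<times> (space M - A))"
      using supp by (intro conductance_profile_le) auto
    moreover have "(\<integral>\<^sup>+x. (if 0 \<le> t \<and> t < h x then 1 else 0) \<partial>M) = ennreal (prob A)"
    proof -
      have "(\<integral>\<^sup>+x. (if 0 \<le> t \<and> t < h x then 1 else 0) \<partial>M) = (\<integral>\<^sup>+x. indicator A x \<partial>M)"
        using True by (intro nn_integral_cong) (auto simp: A_def)
      then show ?thesis by (simp add: emeasure_eq_measure)
    qed
    moreover have "(\<integral>\<^sup>+z. (if h (snd z) \<le> t \<and> t < h (fst z) then 1 else 0) \<partial>J) =
      ennreal (measure J (A \<times> (space M - A)))"
    proof -
      have "(\<integral>\<^sup>+z. (if h (snd z) \<le> t \<and> t < h (fst z) then 1 else 0) \<partial>J) =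
        (\<integral>\<^sup>+z. indicator (A \<times> (space M - A)) z \<partial>J)"
        by (intro nn_integral_cong) (auto simp: A_def indicator_def)
      then show ?thesis by (simp add: J.emeasure_eq_measure)
    qed
    ultimately show ?thesis
      by (metis ennreal_leI ennreal_mult'' measure_nonneg)
  qed simp
  show ?thesis
    unfolding left right
    by (subst nn_integral_cmult[symmetric], simp, rule nn_integral_mono[OF level])
qed

text \<open>The co-area bound for the square of \<open>g\<close>, added over both directions, gives
  \<open>2 * \<Phi> v * G\<close> as a lower bound for the integral of
  \<open>\<bar>g x - g y\<bar> * (g x + g y)\<close>. Cauchy-Schwarz bounds that integral by the
  root of \<open>energy g * (4 * G)\<close>; after squaring, one factor \<open>G\<close>
  cancels.\<close>

lemma energy_support:
  assumes g: "g \<in> L2 M" and nonneg: "\<And>x. 0 \<le> g x"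
    and supp: "prob {x \<in> space M. 0 < g x} \<le> v" and "0 \<le> \<Phi> v"
  shows "(\<Phi> v)\<^sup>2 * (\<integral>x. (g x)\<^sup>2 \<partial>M) \<le> energy g"
proof -
  have [measurable]: "g \<in> borel_measurable M"
    using g by (simp add: L2_def)
  define G where "G = (\<integral>x. (g x)\<^sup>2 \<partial>M)"
  have G: "0 \<le> G" "(\<integral>\<^sup>+x. ennreal ((g x)\<^sup>2) \<partial>M) = ennreal G"
    using g unfolding G_def by (auto simp: L2_real_iff nn_integral_eq_integral)
  note marg = L2_J_marginals[OF g]
  let ?m = "\<lambda>z. g (fst z) - g (snd z)" and ?p = "\<lambda>z. g (fst z) + g (snd z)"
  have L2: "?m \<in> L2 J" "?p \<in> L2 J"
    using L2_diff[OF marg] L2_add[OF marg] by auto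
  have half: "ennreal (\<Phi> v) * ennreal G \<le> (\<integral>\<^sup>+z. ennreal ((g (fst z))\<^sup>2 - (g (snd z))\<^sup>2) \<partial>J)"
    using coarea_conductance[of "\<lambda>x. (g x)\<^sup>2" v] supp nonneg
    by (auto simp: G less_le cong: conj_cong)
  have swap: "(\<integral>\<^sup>+z. ennreal ((g (snd z))\<^sup>2 - (g (fst z))\<^sup>2) \<partial>J) = (\<integral>\<^sup>+z. ennreal ((g (fst z))\<^sup>2 - (g (snd z))\<^sup>2) \<partial>J)"
    using nn_integral_J_swap[of "\<lambda>x y. ennreal ((g x)\<^sup>2 - (g y)\<^sup>2)"]
    by (simp add: case_prod_beta')
  have "ennreal (2 * (\<Phi> v * G)) = ennreal (\<Phi> v) * ennreal G + ennreal (\<Phi> v) * ennreal G"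
    using G \<open>0 \<le> \<Phi> v\<close> by (simp flip: ennreal_mult ennreal_plus)
  also have "\<dots> \<le> (\<integral>\<^sup>+z. ennreal ((g (fst z))\<^sup>2 - (g (snd z))\<^sup>2) \<partial>J) +
      (\<integral>\<^sup>+z. ennreal ((g (snd z))\<^sup>2 - (g (fst z))\<^sup>2) \<partial>J)"
    unfolding swap by (intro add_mono half)
  also have "\<dots> = (\<integral>\<^sup>+z. ennreal ((g (fst z))\<^sup>2 - (g (snd z))\<^sup>2) + ennreal ((g (snd z))\<^sup>2 - (g (fst z))\<^sup>2) \<partial>J)"
    by (intro nn_integral_add[symmetric]) auto
  also have "\<dots> = (\<integral>\<^sup>+z. ennreal \<bar>?m z * ?p z\<bar> \<partial>J)"
  proof (intro nn_integral_cong)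
    fix z
    have "?m z * ?p z = (g (fst z))\<^sup>2 - (g (snd z))\<^sup>2"
      by (simp add: power2_eq_square algebra_simps)
    then show "ennreal ((g (fst z))\<^sup>2 - (g (snd z))\<^sup>2) + ennreal ((g (snd z))\<^sup>2 - (g (fst z))\<^sup>2) = ennreal \<bar>?m z * ?p z\<bar>"
      by (cases "(g (fst z))\<^sup>2 \<le> (g (snd z))\<^sup>2") (auto simp: ennreal_neg)
  qed
  also have "\<dots> = ennreal (\<integral>z. \<bar>?m z * ?p z\<bar> \<partial>J)"
    using L2_mult_integrable[OF L2] by (intro nn_integral_eq_integral integrable_abs) auto
  finally have "2 * (\<Phi> v * G) \<le> (\<integral>z. \<bar>?m z * ?p z\<bar> \<partial>J)"
    by (simp add: ennreal_le_iff)
  also have "\<dots> \<le> L2_norm J ?m * L2_norm J ?p"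
    by (rule L2_Cauchy_Schwarz[OF L2])
  finally have "(2 * (\<Phi> v * G))\<^sup>2 \<le> (L2_norm J ?m * L2_norm J ?p)\<^sup>2"
    using G \<open>0 \<le> \<Phi> v\<close> by (intro power_mono) auto
  also have "\<dots> = energy g * (\<integral>z. (?p z)\<^sup>2 \<partial>J)"
    by (simp add: power_mult_distrib L2_norm_sq energy_def)
  also have "\<dots> \<le> energy g * (4 * G)"
  proof (rule mult_left_mono[OF _ energy_nonneg])
    have "(\<integral>z. (?p z)\<^sup>2 \<partial>J) \<le> (\<integral>z. 2 * (g (fst z))\<^sup>2 + 2 * (g (snd z))\<^sup>2 \<partial>J)"
    proof (rule integral_mono)
      show "(?p z)\<^sup>2 \<le> 2 * (g (fst z))\<^sup>2 + 2 * (g (snd z))\<^sup>2" for z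
        using sum_squares_bound[of "g (fst z)" "g (snd z)"] by (simp add: power2_sum)
    qed (use L2 marg in \<open>auto simp: L2_real_iff\<close>)
    also have "\<dots> = 4 * G"
      using marg by (simp add: L2_real_iff G_def integral_J_fst[of "\<lambda>x. (g x)\<^sup>2"] integral_J_snd[of "\<lambda>x. (g x)\<^sup>2"])
    finally show "(\<integral>z. (?p z)\<^sup>2 \<partial>J) \<le> 4 * G" .
  qed
  finally have "((\<Phi> v)\<^sup>2 * G) * G \<le> energy g * G"
    by (simp add: power_mult_distrib power2_eq_square algebra_simps)
  then show ?thesis
    using G(1) energy_nonneg[of g] unfolding G_def[symmetric] by (cases "G = 0") auto
qed

lemma energy_contraction:
  assumes f: "f \<in> L2 M" and g: "g \<in> L2 M" and le: "\<And>x y. \<bar>g x - g y\<bar> \<le> \<bar>f x - f y\<bar>"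
  shows "energy g \<le> energy f"
  unfolding energy_def
  by (rule integral_mono[OF energy_integrable[OF g] energy_integrable[OF f]]) (use le in \<open>simp add: abs_le_square_iff\<close>)

lemma L2_pos_part:
  fixes f :: "'a \<Rightarrow> real"
  assumes f: "f \<in> L2 M"
  shows "(\<lambda>x. max (f x) 0) \<in> L2 M"
  using f by (rule L2_bound) (use f in \<open>auto simp: L2_def\<close>)

lemma energy_pos_neg_parts:
  assumes f: "f \<in> L2 M"
  shows "energy (\<lambda>x. max (f x) 0) + energy (\<lambda>x. max (- f x) 0) \<le> energy f"
proof -
  have p: "(\<lambda>x. max (f x) 0) \<in> L2 M" "(\<lambda>x. max (- f x) 0) \<in> L2 M"
    using L2_pos_part[OF f] L2_pos_part[OF L2_cmult[OF f, of "-1"]] by auto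
  have "(\<integral>z. (max (f (fst z)) 0 - max (f (snd z)) 0)\<^sup>2 + (max (- f (fst z)) 0 - max (- f (snd z)) 0)\<^sup>2 \<partial>J) \<le> energy f"
    unfolding energy_def
  proof (rule integral_mono)
    have "(max a 0 - max b 0)\<^sup>2 + (max (- a) 0 - max (- b) 0)\<^sup>2 \<le> (a - b)\<^sup>2" for a b :: real
    proof -
      have "0 \<le> max a 0 * max (- b) 0" "0 \<le> max b 0 * max (- a) 0" by auto
      moreover have zero: "max a 0 * max (- a) 0 = 0" "max b 0 * max (- b) 0 = 0"
        by (auto simp: max_def)
      moreover have "(a - b)\<^sup>2 = ((max a 0 - max b 0) - (max (- a) 0 - max (- b) 0))\<^sup>2"
        by (rule arg_cong[where f="\<lambda>x. x\<^sup>2"]) (auto simp: max_def)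
      moreover have "\<dots> = (max a 0 - max b 0)\<^sup>2 + (max (- a) 0 - max (- b) 0)\<^sup>2
        + 2 * (max a 0 * max (- b) 0) + 2 * (max b 0 * max (- a) 0)
        - 2 * (max a 0 * max (- a) 0) - 2 * (max b 0 * max (- b) 0)"
        by (simp only: power2_eq_square) (simp only: algebra_simps)
      ultimately show ?thesis by linarith
    qed
    then show "(max (f (fst z)) 0 - max (f (snd z)) 0)\<^sup>2 + (max (- f (fst z)) 0 - max (- f (snd z)) 0)\<^sup>2
      \<le> (f (fst z) - f (snd z))\<^sup>2" for z .
  qed (use energy_integrable[OF f] energy_integrable[OF p(1)] energy_integrable[OF p(2)] in auto)
  then show ?thesis
    using energy_integrable[OF p(1)] energy_integrable[OF p(2)] by (simp add: energy_def)
qed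

lemma energy_shift: "energy (\<lambda>x. f x - c) = energy f"
  by (simp add: energy_def)

lemma Cheeger:
  assumes f: "f \<in> L2 M" and mean: "(\<integral>x. f x \<partial>M) = 0" and nonneg: "0 \<le> \<Phi> (1/2)"
  shows "(\<Phi> (1/2))\<^sup>2 * (\<integral>x. (f x)\<^sup>2 \<partial>M) \<le> energy f"
proof -
  have [measurable]: "f \<in> borel_measurable M"
    using f by (simp add: L2_def)
  obtain m where m: "prob {x \<in> space M. m < f x} \<le> 1/2" "prob {x \<in> space M. f x < m} \<le> 1/2"
    by (rule median_exists[of f]) auto
  define g where "g = (\<lambda>x. f x - m)"
  have g: "g \<in> L2 M"
    unfolding g_def by (intro L2_diff f L2_const)
  let ?p = "\<lambda>x. max (g x) 0" and ?n = "\<lambda>x. max (- g x) 0"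
  have p: "?p \<in> L2 M" "?n \<in> L2 M"
    using L2_pos_part[OF g] L2_pos_part[OF L2_cmult[OF g, of "-1"]] by auto
  \<comment> \<open>As \<open>f\<close> has mean 0, recentring at the median adds exactly the square
    of \<open>m\<close> to the squared norm and leaves the energy unchanged. Both parts of
    \<open>f - m\<close> then have support of mass at most 1/2.\<close>
  have "(\<integral>x. (f x)\<^sup>2 \<partial>M) \<le> (\<integral>x. (f x)\<^sup>2 \<partial>M) + m\<^sup>2" by simp
  also have "\<dots> = (\<integral>x. (f x)\<^sup>2 + m\<^sup>2 - 2 * m * f x \<partial>M)"
    using f L2_integrable[OF f] mean by (simp add: L2_real_iff prob_space)
  also have "\<dots> = (\<integral>x. (?p x)\<^sup>2 + (?n x)\<^sup>2 \<partial>M)"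
    by (intro Bochner_Integration.integral_cong) (auto simp: g_def max_def power2_eq_square algebra_simps)
  also have "\<dots> = (\<integral>x. (?p x)\<^sup>2 \<partial>M) + (\<integral>x. (?n x)\<^sup>2 \<partial>M)"
    using p by (simp add: L2_real_iff)
  finally have "(\<Phi> (1/2))\<^sup>2 * (\<integral>x. (f x)\<^sup>2 \<partial>M) \<le>
      (\<Phi> (1/2))\<^sup>2 * (\<integral>x. (?p x)\<^sup>2 \<partial>M) + (\<Phi> (1/2))\<^sup>2 * (\<integral>x. (?n x)\<^sup>2 \<partial>M)"
    by (simp flip: distrib_left add: mult_left_mono)
  also have "\<dots> \<le> energy ?p + energy ?n"
    using m by (intro add_mono energy_support p nonneg) (auto simp: g_def less_max_iff_disj)
  also have "\<dots> \<le> energy f"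
    using energy_pos_neg_parts[OF g] energy_shift[of f m] by (simp add: g_def)
  finally show ?thesis .
qed

lemma form_le: "f \<in> L2 M \<Longrightarrow> form f f \<le> (\<integral>x. (f x)\<^sup>2 \<partial>M)"
  using energy_eq[of f] energy_nonneg[of f] by simp

lemma form_kernel_op: "f \<in> L2 M \<Longrightarrow> form f (T f) = (\<integral>x. (T f x)\<^sup>2 \<partial>M)"
  using form_eq[of "T f" f] form_sym[of "T f" f] kernel_op_L2[of f]
  by (simp add: power2_eq_square L2_def)

end

locale positive_reversible_kernel = reversible_kernel +
  assumes positive: "positive_kernel M P"
begin

lemma form_nonneg: "f \<in> L2 M \<Longrightarrow> 0 \<le> form f f"
  using positive by (simp add: positive_kernel_def form_eq)

text \<open>The operator inequality \<open>P^2 \<le> P\<close> for a positive contraction, read off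
  from the form at \<open>f - T f\<close>.\<close>

lemma kernel_op_sq_le_form:
  assumes f: "f \<in> L2 M"
  shows "(\<integral>x. (T f x)\<^sup>2 \<partial>M) \<le> form f f"
proof -
  have Tf: "T f \<in> L2 M" using f by (rule kernel_op_L2)
  have "0 \<le> form (\<lambda>x. f x - 1 * T f x) (\<lambda>x. f x - 1 * T f x)"
    using L2_diff[OF f Tf] by (intro form_nonneg) simp
  also have "\<dots> = form f f - 2 * (\<integral>x. (T f x)\<^sup>2 \<partial>M) + form (T f) (T f)"
    using form_expand[OF f Tf, of 1] by (simp add: form_kernel_op[OF f])
  finally show ?thesis
    using form_le[OF Tf] by simp
qed

text \<open>Cheeger gives only a bound \<open>l\<close> for the quadratic form. To pass to the norm,
  positivity is used at \<open>f - t * T f\<close>; bounding both diagonal terms by \<open>l\<close>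
  leaves \<open>l * N - 2 * t * b + t^2 * l * b\<close>, which is smallest at
  \<open>t = 1/l\<close>. There \<open>b \<le> l^2 * N\<close> results. The assumption
  \<open>\<Phi> (1/2) \<le> 1\<close> keeps \<open>l\<close> positive.\<close>

lemma kernel_op_norm_le:
  fixes f :: "'a \<Rightarrow> real"
  assumes f: "f \<in> L2_0 M" and \<Phi>: "0 \<le> \<Phi> (1/2)" "\<Phi> (1/2) \<le> 1"
  shows "L2_norm M (T f) \<le> (1 - (\<Phi> (1/2))\<^sup>2 / 2) * L2_norm M f"
proof -
  define l where "l = 1 - (\<Phi> (1/2))\<^sup>2 / 2"
  have "(\<Phi> (1/2))\<^sup>2 \<le> 1"
    using \<Phi> by (simp add: power_le_one)
  then have l: "0 < l" by (simp add: l_def)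
  have f2: "f \<in> L2 M" and mean: "(\<integral>x. f x \<partial>M) = 0"
    using f by (auto simp: L2_0_def)
  have Tf: "T f \<in> L2 M" using f2 by (rule kernel_op_L2)
  have mean_T: "(\<integral>x. T f x \<partial>M) = 0"
    using integral_kernel_op[OF L2_integrable[OF f2]] mean by simp
  have form_bound: "form h h \<le> l * (\<integral>x. (h x)\<^sup>2 \<partial>M)" if "h \<in> L2 M" "(\<integral>x. h x \<partial>M) = 0" for h
    using Cheeger[OF that \<Phi>(1)] energy_eq[OF that(1)] by (simp add: l_def algebra_simps)
  define b N where "b = (\<integral>x. (T f x)\<^sup>2 \<partial>M)" and "N = (\<integral>x. (f x)\<^sup>2 \<partial>M)"
  have "0 \<le> form (\<lambda>x. f x - (1/l) * T f x) (\<lambda>x. f x - (1/l) * T f x)"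
    by (intro form_nonneg L2_diff L2_cmult f2 Tf)
  also have "\<dots> = form f f - 2 * (1/l) * b + (1/l)\<^sup>2 * form (T f) (T f)"
    using form_expand[OF f2 Tf, of "1/l"] by (simp add: form_kernel_op[OF f2] b_def)
  also have "\<dots> \<le> l * N - 2 * (1/l) * b + (1/l)\<^sup>2 * (l * b)"
    using form_bound[OF f2 mean] form_bound[OF Tf mean_T]
    by (intro add_mono mult_left_mono) (auto simp: b_def N_def)
  also have "\<dots> = l * N - b / l"
    using l by (simp add: power2_eq_square field_simps)
  finally have "b \<le> l\<^sup>2 * N"
    using l by (simp add: field_simps power2_eq_square)
  then have "(L2_norm M (T f))\<^sup>2 \<le> (l * L2_norm M f)\<^sup>2"
    by (simp add: L2_norm_sq power_mult_distrib b_def N_def)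
  then show ?thesis
    unfolding l_def[symmetric] by (rule power2_le_imp_le) (use l in simp)
qed

text \<open>Truncation does not increase the energy, and the truncated function has support of mass
  at most \<open>1/c = 4/u\<close> by Markov's inequality. The squared norm drops by at least half
  of the energy, since \<open>\<parallel>T f\<parallel>^2 \<le> form f f\<close>.\<close>

lemma chi_squared_step:
  assumes f: "f \<in> L2 M" and nonneg: "\<And>x. 0 \<le> f x" and int: "(\<integral>x. f x \<partial>M) = 1"
    and u: "u = (\<integral>x. (f x)\<^sup>2 \<partial>M) - 1" "0 < u" and \<Phi>: "0 \<le> \<Phi> (4/u)"
  shows "(\<integral>x. (T f x)\<^sup>2 \<partial>M) - 1 \<le> u * (1 - (\<Phi> (4/u))\<^sup>2 / 4)"
proof -
  have [measurable]: "f \<in> borel_measurable M"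
    using f by (simp add: L2_def)
  define c where "c = u / 4"
  define g where "g = (\<lambda>x. max (f x - c) 0)"
  have g: "g \<in> L2 M"
    unfolding g_def by (intro L2_pos_part L2_diff f L2_const)
  have c: "0 < c" using u by (simp add: c_def)
  \<comment> \<open>The level \<open>c = u/4\<close> makes the loss \<open>2 * c\<close> equal to
    \<open>u/2\<close>. The pointwise bound below expands the square where \<open>f \<ge> c\<close>;
    elsewhere its left side is at most 0.\<close>
  have "u / 2 \<le> (\<integral>x. (f x)\<^sup>2 - 2 * c * f x \<partial>M)"
    using f L2_integrable[OF f] u by (simp add: L2_real_iff int c_def field_simps)
  also have "\<dots> \<le> (\<integral>x. (g x)\<^sup>2 \<partial>M)"
  proof (rule integral_mono)
    show "(f x)\<^sup>2 - 2 * c * f x \<le> (g x)\<^sup>2" for x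
    proof (cases "c \<le> f x")
      case False
      then have "f x * (f x - 2 * c) \<le> 0"
        using nonneg[of x] c by (intro mult_nonneg_nonpos) auto
      then show ?thesis
        using False by (simp add: g_def power2_eq_square algebra_simps)
    qed (simp add: g_def power2_diff)
  qed (use f g L2_integrable[OF f] in \<open>auto simp: L2_real_iff\<close>)
  finally have "(\<Phi> (4/u))\<^sup>2 * (u / 2) \<le> (\<Phi> (4/u))\<^sup>2 * (\<integral>x. (g x)\<^sup>2 \<partial>M)"
    by (rule mult_left_mono) simp
  also have "\<dots> \<le> energy g"
  proof (rule energy_support[OF g _ _ \<Phi>])
    have "prob {x \<in> space M. 0 < g x} \<le> prob {x \<in> space M. c \<le> f x}"
      by (intro finite_measure_mono) (auto simp: g_def)
    also have "\<dots> \<le> (\<integral>x. f x \<partial>M) / c"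
      using integral_Markov_inequality_measure[of M f "{}" c] L2_integrable[OF f] nonneg c by simp
    also have "\<dots> = 4 / u"
      by (simp add: int c_def)
    finally show "prob {x \<in> space M. 0 < g x} \<le> 4 / u" .
  qed (simp add: g_def)
  also have "energy g \<le> energy f"
    by (rule energy_contraction[OF f g]) (auto simp: g_def)
  finally have "(\<Phi> (4/u))\<^sup>2 * (u / 2) \<le> energy f" .
  moreover have "u * (1 - (\<Phi> (4/u))\<^sup>2 / 4) = u - (\<Phi> (4/u))\<^sup>2 * (u / 2) / 2"
    by (simp add: right_diff_distrib)
  ultimately show ?thesis
    using kernel_op_sq_le_form[OF f] energy_eq[OF f] u(1) by linarith
qed

end

section \<open>Isoperimetry and conductance\<close>

lemma enlargement_iff: "x \<in> enlargement d A r \<longleftrightarrow> (\<exists>y\<in>A. d x y < r)"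
  by (simp add: enlargement_def INF_less_iff)

text \<open>Measurability comes for free: a set outside \<open>sets M\<close> has measure 0 by
  convention, while the strict growth with \<open>c \<ge> 0\<close> makes the measure of the
  enlargement positive.\<close>

lemma eventually_enlargement:
  assumes c: "0 \<le> c" "ereal c < minkowski_content d M A"
  shows "\<forall>\<^sub>F r in at_right 0. enlargement d A r \<in> sets M \<and>
    measure M A + c * r \<le> measure M (enlargement d A r)"
proof -
  have "\<forall>\<^sub>F r in at_right 0. ereal c < ereal ((measure M (enlargement d A r) - measure M A) / r)"
    using c(2) unfolding minkowski_content_def by (rule less_LiminfD)
  moreover have "\<forall>\<^sub>F r in at_right (0::real). 0 < r"
    by (simp add: eventually_at_filter)
  ultimately show ?thesis
  proof eventually_elim
    case (elim r)
    then have less: "measure M A + c * r < measure M (enlargement d A r)"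
      by (simp add: field_simps)
    have "0 \<le> measure M A + c * r"
      using c(1) elim(2) by simp
    with less have "measure M (enlargement d A r) \<noteq> 0"
      by linarith
    then have "enlargement d A r \<in> sets M"
      using measure_notin_sets by blast
    with less show ?case by simp
  qed
qed

text \<open>Since enlargements of Borel sets need not be Borel, the proof grows Borel sets inside the
  enlargements of \<open>A\<close>. The supremum of the radii reached is attained by a countable union.\<close>

lemma separation_isoperimetry:
  assumes "prob_space M" and met: "Metric_space UNIV d"
    and minorant: "isoperimetric_minorant d M I" and reg: "regular_minorant I"
    and A [measurable]: "A \<in> sets M" and B [measurable]: "B \<in> sets M" and "0 < \<delta>"
    and sep: "\<And>x y. x \<in> A \<Longrightarrow> y \<in> B \<Longrightarrow> \<delta> \<le> d x y"
    and a: "0 < a" "a \<le> 1/2" "a \<le> measure M A" "a \<le> measure M B"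
  shows "\<delta> * I a \<le> measure M (space M - (A \<union> B))"
proof -
  interpret prob_space M by fact
  interpret d: Metric_space UNIV d by fact
  have mono: "I p \<le> I q" if "0 < p" "p \<le> q" "q \<le> 1/2" for p q
    using reg that by (auto simp: regular_minorant_def mono_on_def)
  have symm: "I (1 - p) = I p" if "0 < p" "p < 1" for p
    using reg that by (auto simp: regular_minorant_def)
  \<comment> \<open>The growing set always has mass in \<open>[a, 1 - a]\<close>; monotonicity up to
    1/2 and symmetry make \<open>I a\<close> the minimum there.\<close>
  have I_ge: "I a \<le> I p" if "a \<le> p" "p \<le> 1 - a" for p
    using mono[of a p] mono[of a "1 - p"] symm[of p] that a by (cases "p \<le> 1/2") auto
  \<comment> \<open>The set \<open>A\<close> is adjoined because the enlargement of radius 0 is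
    empty.\<close>
  define E where "E r = A \<union> enlargement d A r" for r
  have E_disj: "E r \<inter> B = {}" if "0 \<le> r" "r < \<delta>" for r
  proof -
    have "x \<notin> B" if "x \<in> E r" for x
    proof
      assume "x \<in> B"
      obtain y where "y \<in> A" "x = y \<or> d x y < r"
        using \<open>x \<in> E r\<close> by (auto simp: E_def enlargement_iff)
      then have "d y x < \<delta>"
        using \<open>0 < \<delta>\<close> \<open>r < \<delta>\<close> d.commute[of x y] by (auto simp: d.zero)
      then show False
        using sep[OF \<open>y \<in> A\<close> \<open>x \<in> B\<close>] by simp
    qed
    then show ?thesis by auto
  qed
  \<comment> \<open>A lower limit guarantees growth only at rates strictly below it, so the claim is
    first shown for each \<open>c < I a\<close>.\<close>
  have key: "c * \<delta> \<le> measure M (space M - (A \<union> B))" if c: "0 \<le> c" "c < I a" for c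
  proof -
    define R where "R = {r. 0 \<le> r \<and> r < \<delta> \<and> (\<exists>C\<in>sets M. C \<subseteq> E r \<and> prob A + c * r \<le> prob C)}"
    have "0 \<in> R"
      using \<open>0 < \<delta>\<close> A by (auto simp: R_def E_def)
    then have ne: "R \<noteq> {}" by auto
    have bdd: "bdd_above R"
      by (rule bdd_aboveI[of _ \<delta>]) (simp add: R_def)
    define s where "s = Sup R"
    have s: "0 \<le> s" "s \<le> \<delta>"
      using cSup_upper[OF \<open>0 \<in> R\<close> bdd] cSup_least[OF ne, of \<delta>] by (auto simp: s_def R_def)
    have "\<exists>r\<in>R. s - 1 / real (Suc n) < r" for n
      using less_cSup_iff[OF ne bdd, of "s - 1 / real (Suc n)"] by (simp add: s_def)
    then obtain \<rho> where \<rho>: "\<And>n. \<rho> n \<in> R" "\<And>n. s - 1 / real (Suc n) < \<rho> n"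
      by metis
    then have "\<forall>n. \<exists>C\<in>sets M. C \<subseteq> E (\<rho> n) \<and> prob A + c * \<rho> n \<le> prob C"
      by (auto simp: R_def)
    then obtain C where C: "\<And>n. C n \<in> sets M" "\<And>n. C n \<subseteq> E (\<rho> n)"
        "\<And>n. prob A + c * \<rho> n \<le> prob (C n)"
      by metis
    define U where "U = (\<Union>n. C n)"
    have U [measurable]: "U \<in> sets M"
      unfolding U_def by (rule sets.countable_nat_UN) (use C(1) in auto)
    have "\<rho> n \<le> s" for n
      using cSup_upper[OF \<rho>(1) bdd] by (simp add: s_def)
    then have "E (\<rho> n) \<subseteq> E s" for n
      unfolding E_def by (fastforce simp: enlargement_iff dest: less_le_trans)
    then have U_E: "U \<subseteq> E s"
      using C(2) by (fastforce simp: U_def)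
    have U_disj: "U \<inter> B = {}"
      using C(2) E_disj[of "\<rho> _"] \<rho>(1) by (fastforce simp: U_def R_def)
    have "prob A + c * s - c * (1 / real (Suc n)) \<le> prob U" for n
    proof -
      have "c * (s - 1 / real (Suc n)) \<le> c * \<rho> n"
        using \<rho>(2)[of n] c by (intro mult_left_mono) auto
      moreover have "prob (C n) \<le> prob U"
        by (rule finite_measure_mono[OF _ U]) (auto simp: U_def)
      ultimately show ?thesis
        using C(3)[of n] by (simp add: right_diff_distrib)
    qed
    moreover have "(\<lambda>n. prob A + c * s - c * (1 / real (Suc n))) \<longlonglongrightarrow> prob A + c * s - c * 0"
      by (intro tendsto_intros LIMSEQ_Suc[OF lim_1_over_n])
    ultimately have U_ge: "prob A + c * s \<le> prob U"
      by (intro LIMSEQ_le_const2[of _ "prob A + c * s" "prob U"]) auto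
    have U_le: "prob U + prob B \<le> 1"
      using finite_measure_Union[OF U B U_disj] prob_le_1[of "U \<union> B"] by simp
    \<comment> \<open>If \<open>s < \<delta>\<close>, the content of \<open>U\<close> exceeds
      \<open>c\<close>, so some enlargement of \<open>U\<close> keeps the rate \<open>c\<close>. The
      triangle inequality places it inside \<open>E (s + r)\<close>, which contradicts the choice of
      \<open>s\<close>.\<close>
    have "s = \<delta>"
    proof (rule ccontr)
      assume "s \<noteq> \<delta>"
      with s have "s < \<delta>" by simp
      have "0 \<le> c * s" using c s by simp
      with U_ge U_le a have p: "a \<le> prob U" "prob U \<le> 1 - a" by linarith+
      with a have "ereal (I (prob U)) \<le> isoperimetric_profile d M (prob U)"
        using minorant by (auto simp: isoperimetric_minorant_def)
      also have "\<dots> \<le> minkowski_content d M U"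
        unfolding isoperimetric_profile_def by (rule INF_lower) simp
      finally have "ereal (I (prob U)) \<le> minkowski_content d M U" .
      moreover have "ereal c < ereal (I (prob U))"
        using c(2) I_ge[OF p] by simp
      ultimately have "ereal c < minkowski_content d M U"
        by (rule less_le_trans[rotated])
      then have "\<forall>\<^sub>F r in at_right 0. enlargement d U r \<in> sets M \<and>
          prob U + c * r \<le> prob (enlargement d U r)"
        by (rule eventually_enlargement[OF c(1)])
      moreover have "\<forall>\<^sub>F r in at_right 0. 0 < r \<and> r < \<delta> - s"
        using eventually_at_right[of 0 "\<delta> - s"] \<open>s < \<delta>\<close> by (auto intro!: exI[of _ "\<delta> - s"])
      ultimately have "\<forall>\<^sub>F r in at_right 0. (0 < r \<and> r < \<delta> - s) \<and> enlargement d U r \<in> sets M \<and>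
          prob U + c * r \<le> prob (enlargement d U r)"
        by eventually_elim auto
      then obtain r where r: "0 < r" "r < \<delta> - s" "enlargement d U r \<in> sets M"
          "prob U + c * r \<le> prob (enlargement d U r)"
        using eventually_happens'[OF trivial_limit_at_right_real] by blast
      have "enlargement d U r \<subseteq> E (s + r)"
      proof
        fix x assume "x \<in> enlargement d U r"
        then obtain y where y: "y \<in> E s" "d x y < r"
          using U_E by (auto simp: enlargement_iff)
        then obtain z where z: "z \<in> A" "y = z \<or> d y z < s"
          by (auto simp: E_def enlargement_iff)
        then have "d x z < s + r"
          using y(2) s(1) d.triangle[of x y z] by auto
        then show "x \<in> E (s + r)"
          using z(1) by (auto simp: E_def enlargement_iff)
      qed
      then have "s + r \<in> R"
        using r s U_ge by (auto simp: R_def distrib_left intro!: bexI[of _ "enlargement d U r"])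
      then show False
        using cSup_upper[OF _ bdd, of "s + r"] r by (simp add: s_def)
    qed
    have "measure M (space M - (A \<union> B)) = 1 - prob (A \<union> B)"
      by (rule prob_compl) simp
    also have "prob (A \<union> B) = prob A + prob B"
      using E_disj[of 0] \<open>0 < \<delta>\<close> by (intro finite_measure_Union) (auto simp: E_def)
    finally show ?thesis
      using U_ge U_le \<open>s = \<delta>\<close> by simp
  qed
  have "0 < I a"
    using minorant a by (auto simp: isoperimetric_minorant_def)
  show ?thesis
  proof (rule field_le_epsilon)
    fix e :: real assume "0 < e"
    define c where "c = max 0 (I a - e / \<delta>)"
    have "c * \<delta> \<le> measure M (space M - (A \<union> B))"
      using \<open>0 < I a\<close> \<open>0 < e\<close> \<open>0 < \<delta>\<close> by (intro key) (auto simp: c_def)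
    moreover have "(I a - e / \<delta>) * \<delta> \<le> c * \<delta>"
      using \<open>0 < \<delta>\<close> by (intro mult_right_mono) (auto simp: c_def)
    moreover have "(I a - e / \<delta>) * \<delta> = \<delta> * I a - e"
      using \<open>0 < \<delta>\<close> by (simp add: field_simps)
    ultimately show "\<delta> * I a \<le> measure M (space M - (A \<union> B)) + e"
      by linarith
  qed
qed

lemma concave_on_slope_antimono:
  fixes I :: "real \<Rightarrow> real"
  assumes conc: "concave_on {0<..<1} I" and pos: "\<And>p. 0 < p \<Longrightarrow> p < 1 \<Longrightarrow> 0 < I p"
    and xy: "0 < x" "x \<le> y" "y < 1"
  shows "I y / y \<le> I x / x"
proof (cases "x = y")
  case False
  with xy have "x < y" by simp
  have "((\<lambda>z. (x - z) / (y - z) * I y) \<longlongrightarrow> (x - 0) / (y - 0) * I y) (at_right 0)"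
    using xy by (intro tendsto_intros) auto
  moreover have "\<forall>\<^sub>F z in at_right 0. (x - z) / (y - z) * I y \<le> I x"
  proof -
    have "(x - z) / (y - z) * I y \<le> I x" if z: "0 < z" "z < x" for z
    proof -
      define t where "t = (x - z) / (y - z)"
      have t: "0 \<le> t" "t \<le> 1"
        using z \<open>x < y\<close> by (auto simp: t_def)
      have "(1 - t) * z + t * y = z + t * (y - z)"
        by (simp add: algebra_simps)
      also have "\<dots> = x"
        using z \<open>x < y\<close> by (simp add: t_def)
      finally have x: "(1 - t) * z + t * y = x" .
      have "(1 - t) * I z + t * I y \<le> I ((1 - t) * z + t * y)"
        using concave_onD[OF conc t, of z y] z xy by simp
      moreover have "0 \<le> (1 - t) * I z"
        using t pos[of z] z xy by simp
      ultimately show ?thesis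
        unfolding t_def[symmetric] x by simp
    qed
    then show ?thesis
      using eventually_at_right[of 0 x] xy by (auto intro!: exI[of _ x])
  qed
  ultimately have "(x - 0) / (y - 0) * I y \<le> I x"
    by (rule tendsto_upperbound) simp
  then show ?thesis
    using xy by (simp add: field_simps)
qed simp

section \<open>Flow out of a set under close coupling\<close>

context reversible_kernel
begin

lemma measure_J_swap:
  assumes [measurable]: "A \<in> sets M" "B \<in> sets M"
  shows "measure J (A \<times> B) = measure J (B \<times> A)"
proof -
  have "measure J (A \<times> B) = measure (distr J (M \<Otimes>\<^sub>M M) (\<lambda>(x, y). (y, x))) (A \<times> B)"
    by (simp add: distr_J_swap)
  also have "\<dots> = measure J (B \<times> A)"
    using sets.sets_into_space[OF assms(1)] sets.sets_into_space[OF assms(2)]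
    by (subst measure_distr) (auto intro!: arg_cong[where f="measure J"])
  finally show ?thesis .
qed

lemma measure_J_lower:
  assumes [measurable]: "A \<in> sets M" "B \<in> sets M" "S \<in> sets M" and "S \<subseteq> A" "0 \<le> e"
    and e: "\<And>x. x \<in> S \<Longrightarrow> e \<le> measure (P x) B"
  shows "e * prob S \<le> measure J (A \<times> B)"
proof -
  have "ennreal (e * prob S) = (\<integral>\<^sup>+x. ennreal e * indicator S x \<partial>M)"
    using \<open>0 \<le> e\<close> by (simp add: nn_integral_cmult_indicator emeasure_eq_measure ennreal_mult)
  also have "\<dots> \<le> (\<integral>\<^sup>+x\<in>A. emeasure (P x) B \<partial>M)"
  proof (rule nn_integral_mono)
    fix x assume "x \<in> space M"
    then interpret Px: prob_space "P x" by (rule kernel_space)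
    show "ennreal e * indicator S x \<le> emeasure (P x) B * indicator A x"
      using \<open>S \<subseteq> A\<close> e[of x] by (auto simp: Px.emeasure_eq_measure split: split_indicator)
  qed
  also have "\<dots> = emeasure J (A \<times> B)"
    by (rule emeasure_joint_law[symmetric]) (auto intro: prob_space_axioms kernel)
  finally show ?thesis
    by (simp add: J.emeasure_eq_measure)
qed

text \<open>Under the two bounds \<open>A\<close> has mass above \<open>1 - \<epsilon>/2\<close> for
  \<open>P x\<close> and below \<open>\<epsilon>/2\<close> for \<open>P y\<close>, so
  \<open>A\<close> alone shows a total variation distance above
  \<open>1 - \<epsilon>\<close>.\<close>

lemma close_coupling_overlap:
  assumes close: "close_coupling d \<delta> \<epsilon> P" and A: "A \<in> sets M" and xy: "x \<in> space M" "y \<in> space M"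
    and less: "measure (P x) (space M - A) < \<epsilon>/2" "measure (P y) A < \<epsilon>/2"
  shows "\<delta> < d x y"
proof (rule ccontr)
  assume "\<not> \<delta> < d x y"
  then have tv: "tv_dist (P x) (P y) \<le> 1 - \<epsilon>"
    using close by (auto simp: close_coupling_def)
  interpret Px: prob_space "P x" using xy by (simp add: kernel_space)
  interpret Py: prob_space "P y" using xy by (simp add: kernel_space)
  have "\<bar>measure (P x) A - measure (P y) A\<bar> \<le> tv_dist (P x) (P y)"
    unfolding tv_dist_def
  proof (rule cSUP_upper)
    show "A \<in> sets (P x)" using A kernel_space(2)[OF xy(1)] by simp
    have "\<bar>measure (P x) S - measure (P y) S\<bar> \<le> 1" for S
      using Px.prob_le_1[of S] Py.prob_le_1[of S] measure_nonneg[of "P x" S] measure_nonneg[of "P y" S]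
      by linarith
    then show "bdd_above ((\<lambda>S. \<bar>measure (P x) S - measure (P y) S\<bar>) ` sets (P x))"
      by (intro bdd_aboveI[of _ 1]) auto
  qed
  moreover have "measure (P x) (space M - A) = 1 - measure (P x) A"
    using Px.prob_compl[of A] A kernel_space[OF xy(1)] by simp
  ultimately show False
    using tv less by linarith
qed

text \<open>Points outside \<open>A1\<close> and \<open>B1\<close> cross with probability at least
  \<open>\<epsilon>/2\<close>. By reversibility the flows in the two directions agree, so the
  crossing points of \<open>A\<close> and those of its complement each bound the same quantity;
  adding both bounds costs a factor 2.\<close>

lemma flow_lower_bound:
  assumes met: "Metric_space UNIV d" and minorant: "isoperimetric_minorant d M I"
    and reg: "regular_minorant I" and close: "close_coupling d \<delta> \<epsilon> P" and pos: "0 < \<delta>" "0 < \<epsilon>"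
    and A [measurable]: "A \<in> sets M" and p: "0 < prob A" "prob A \<le> 1/2"
  shows "\<epsilon>/4 * min (prob A) (\<delta> * I (prob A / 2)) \<le> measure J (A \<times> (space M - A))"
    (is "_ \<le> ?F")
proof -
  have [measurable]: "(\<lambda>x. measure (P x) S) \<in> borel_measurable M" if "S \<in> sets M" for S
    using that by (rule measurable_compose[OF kernel measurable_measure_prob_algebra])
  define A1 where "A1 = {x \<in> A. measure (P x) (space M - A) < \<epsilon>/2}"
  define B1 where "B1 = {x \<in> space M - A. measure (P x) A < \<epsilon>/2}"
  have AM: "A \<subseteq> space M" by (rule sets.sets_into_space) simp
  have "A1 = A \<inter> {x \<in> space M. measure (P x) (space M - A) < \<epsilon>/2}"
    "B1 = (space M - A) \<inter> {x \<in> space M. measure (P x) A < \<epsilon>/2}"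
    using AM by (auto simp: A1_def B1_def)
  then have [measurable]: "A1 \<in> sets M" "B1 \<in> sets M" by simp_all
  have flow_A: "\<epsilon>/2 * prob (A - A1) \<le> ?F"
    using pos by (intro measure_J_lower) (auto simp: A1_def)
  have flow_B: "\<epsilon>/2 * prob (space M - A - B1) \<le> ?F"
    unfolding measure_J_swap[OF A sets.compl_sets[OF A]]
    using pos by (intro measure_J_lower) (auto simp: B1_def)
  have A1: "prob (A - A1) = prob A - prob A1"
    by (intro finite_measure_Diff) (auto simp: A1_def)
  have B1: "prob (space M - A - B1) = 1 - prob A - prob B1"
    by (subst finite_measure_Diff) (auto simp: B1_def prob_compl)
  \<comment> \<open>If both crossing sets have mass below \<open>prob A / 2\<close>, then
    \<open>B1\<close> has mass above \<open>1 - 3/2 * prob A\<close>, which is at least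
    \<open>prob A / 2\<close> because \<open>prob A \<le> 1/2\<close>.\<close>
  consider "prob A / 2 \<le> prob (A - A1)" | "prob A / 2 \<le> prob (space M - A - B1)"
    | "prob A / 2 \<le> prob A1" "prob A / 2 \<le> prob B1"
    using p A1 B1 by linarith
  then show ?thesis
  proof cases
    case 1
    then have "\<epsilon>/2 * (prob A / 2) \<le> \<epsilon>/2 * prob (A - A1)"
      using pos by (intro mult_left_mono) auto
    moreover have "\<epsilon>/4 * min (prob A) (\<delta> * I (prob A / 2)) \<le> \<epsilon>/4 * prob A"
      using pos by (intro mult_left_mono) auto
    ultimately show ?thesis using flow_A by simp
  next
    case 2
    then have "\<epsilon>/2 * (prob A / 2) \<le> \<epsilon>/2 * prob (space M - A - B1)"
      using pos by (intro mult_left_mono) auto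
    moreover have "\<epsilon>/4 * min (prob A) (\<delta> * I (prob A / 2)) \<le> \<epsilon>/4 * prob A"
      using pos by (intro mult_left_mono) auto
    ultimately show ?thesis using flow_B by simp
  next
    case 3
    have "\<delta> * I (prob A / 2) \<le> prob (space M - (A1 \<union> B1))"
    proof (rule separation_isoperimetry[OF prob_space_axioms met minorant reg])
      fix x y assume "x \<in> A1" "y \<in> B1"
      then have "\<delta> < d x y"
        using AM by (intro close_coupling_overlap[OF close A]) (auto simp: A1_def B1_def)
      then show "\<delta> \<le> d x y" by simp
    qed (use pos p 3 in auto)
    also have "space M - (A1 \<union> B1) = (A - A1) \<union> (space M - A - B1)"
      using AM by (auto simp: A1_def B1_def)
    also have "prob \<dots> = prob (A - A1) + prob (space M - A - B1)"
      by (intro finite_measure_Union) auto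
    finally have "\<epsilon>/2 * (\<delta> * I (prob A / 2)) \<le> \<epsilon>/2 * (prob (A - A1) + prob (space M - A - B1))"
      using pos by (intro mult_left_mono) auto
    also have "\<dots> \<le> 2 * ?F"
      using flow_A flow_B by (simp add: distrib_left)
    finally have "\<epsilon>/4 * (\<delta> * I (prob A / 2)) \<le> ?F" by simp
    moreover have "\<epsilon>/4 * min (prob A) (\<delta> * I (prob A / 2)) \<le> \<epsilon>/4 * (\<delta> * I (prob A / 2))"
      using pos by (intro mult_left_mono) auto
    ultimately show ?thesis by simp
  qed
qed

text \<open>The flow bound involves the mass of the set itself; the antitone slope of
  \<open>I\<close> replaces that mass by the larger \<open>v\<close>. The assumption
  \<open>ex\<close> ensures that the real infimum is not over the empty set, where its value would
  be meaningless.\<close>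

lemma conductance_profile_lower_bound:
  assumes met: "Metric_space UNIV d" and minorant: "isoperimetric_minorant d M I"
    and reg: "regular_minorant I" and conc: "concave_on {0<..<1} I"
    and close: "close_coupling d \<delta> \<epsilon> P" and pos: "0 < \<delta>" "0 < \<epsilon>"
    and v: "0 < v" "v \<le> 1/2" and ex: "\<exists>A\<in>sets M. 0 < prob A \<and> prob A \<le> v"
  shows "1/4 * \<epsilon> * min 1 (1/2 * \<delta> * (I (v/2) / (v/2))) \<le> conductance_profile M P v"
  unfolding conductance_profile_def
proof (rule cINF_greatest)
  fix A assume "A \<in> {A \<in> sets M. 0 < prob A \<and> prob A \<le> v}"
  then have A: "A \<in> sets M" "0 < prob A" "prob A \<le> v" by auto
  let ?p = "prob A"
  have "I (v/2) / (v/2) \<le> I (?p/2) / (?p/2)"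
    using minorant A v by (intro concave_on_slope_antimono[OF conc]) (auto simp: isoperimetric_minorant_def)
  then have "\<delta>/2 * (I (v/2) / (v/2)) \<le> \<delta>/2 * (I (?p/2) / (?p/2))"
    using pos by (intro mult_left_mono) auto
  also have "\<dots> = \<delta> * I (?p/2) / ?p"
    by simp
  finally have "min 1 (1/2 * \<delta> * (I (v/2) / (v/2))) \<le> min 1 (\<delta> * I (?p/2) / ?p)"
    by simp
  also have "\<dots> = min ?p (\<delta> * I (?p/2)) / ?p"
    using A by (auto simp: min_def field_simps)
  finally have "1/4 * \<epsilon> * min 1 (1/2 * \<delta> * (I (v/2) / (v/2))) \<le> \<epsilon>/4 * (min ?p (\<delta> * I (?p/2)) / ?p)"
    using pos mult_left_mono[of "min 1 (1/2 * \<delta> * (I (v/2) / (v/2)))" "min ?p (\<delta> * I (?p/2)) / ?p" "\<epsilon>/4"]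
    by (simp only: mult.commute[of "1/4"] divide_real_def) simp
  also have "\<dots> = \<epsilon>/4 * min ?p (\<delta> * I (?p/2)) / ?p"
    by simp
  also have "\<dots> \<le> measure J (A \<times> (space M - A)) / ?p"
    using A v flow_lower_bound[OF met minorant reg close pos A(1,2)] by (intro divide_right_mono) auto
  finally show "1/4 * \<epsilon> * min 1 (1/2 * \<delta> * (I (v/2) / (v/2))) \<le> measure J (A \<times> (space M - A)) / ?p" .
qed (use ex in auto)

end

section \<open>Spectral gap\<close>

lemma L2_norm_minus: "L2_norm M (\<lambda>x. - f x) = L2_norm M f"
  by (simp add: L2_norm_def)

lemma L2_norm_cmult:
  fixes f :: "'a \<Rightarrow> 'b::{banach, second_countable_topology, real_normed_field}"
  shows "L2_norm M (\<lambda>x. c * f x) = norm c * L2_norm M f"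
  by (simp add: L2_norm_def norm_mult power_mult_distrib real_sqrt_mult)

lemma L2_norm_cong_AE:
  fixes f g :: "'a \<Rightarrow> 'b::{banach, second_countable_topology}"
  assumes [measurable]: "f \<in> borel_measurable M" "g \<in> borel_measurable M" and "AE x in M. f x = g x"
  shows "L2_norm M f = L2_norm M g"
  unfolding L2_norm_def
  by (intro arg_cong[where f=sqrt] integral_cong_AE) (use assms(3) in auto)

lemma L2_norm_eq_0:
  fixes f :: "'a \<Rightarrow> 'b::{banach, second_countable_topology}"
  assumes "f \<in> L2 M" "L2_norm M f = 0"
  shows "AE x in M. f x = 0"
  using assms integral_nonneg_eq_0_iff_AE[of M "\<lambda>x. (norm (f x))\<^sup>2"]
  by (simp add: L2_def L2_norm_def)

lemma (in finite_measure) L2_0_diff: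
  fixes f g :: "'a \<Rightarrow> 'b::{banach, second_countable_topology, real_normed_field}"
  assumes "f \<in> L2_0 M" "g \<in> L2_0 M"
  shows "(\<lambda>x. f x - g x) \<in> L2_0 M"
  using assms by (simp add: L2_0_def L2_diff L2_integrable)

text \<open>The integrals of the norms are summable since their partial sums stay below the integral
  of the pointwise sum. The measure is left general because both \<open>M\<close> and almost every
  \<open>P x\<close> are needed.\<close>

lemma integral_suminf_dominated:
  fixes t :: "nat \<Rightarrow> 'a \<Rightarrow> 'b::{banach, second_countable_topology}"
  assumes t: "\<And>n. integrable M (t n)" and sum: "AE x in M. summable (\<lambda>n. norm (t n x))"
    and h: "integrable M (\<lambda>x. \<Sum>n. norm (t n x))"
  shows "(\<integral>x. (\<Sum>n. t n x) \<partial>M) = (\<Sum>n. \<integral>x. t n x \<partial>M)"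
proof (rule integral_suminf[OF t sum])
  show "summable (\<lambda>n. \<integral>x. norm (t n x) \<partial>M)"
  proof (rule summableI_nonneg_bounded)
    fix N
    have "(\<Sum>n<N. \<integral>x. norm (t n x) \<partial>M) = (\<integral>x. (\<Sum>n<N. norm (t n x)) \<partial>M)"
      using t by (intro Bochner_Integration.integral_sum[symmetric]) auto
    also have "\<dots> \<le> (\<integral>x. (\<Sum>n. norm (t n x)) \<partial>M)"
      using t h sum by (intro integral_mono_AE) (auto elim!: eventually_mono intro!: sum_le_suminf)
    finally show "(\<Sum>n<N. \<integral>x. norm (t n x) \<partial>M) \<le> (\<integral>x. (\<Sum>n. norm (t n x)) \<partial>M)" .
  qed simp
qed

text \<open>The argument behind completeness: the partial sums of the norms increase and have norm
  at most \<open>K\<close>, so by monotone convergence their limit is square-integrable and hence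
  finite almost everywhere.\<close>

lemma L2_series_dominated:
  fixes t :: "nat \<Rightarrow> 'a \<Rightarrow> 'b::{banach, second_countable_topology}"
  assumes t: "\<And>n. t n \<in> L2 M" and K: "\<And>N. (\<Sum>n<N. L2_norm M (t n)) \<le> K"
  shows "AE x in M. summable (\<lambda>n. norm (t n x))"
    and "(\<lambda>x. \<Sum>n. norm (t n x)) \<in> L2 M"
proof -
  have [measurable]: "t n \<in> borel_measurable M" for n
    using t by (simp add: L2_def)
  define S where "S N x = (\<Sum>n<N. norm (t n x))" for N x
  have [measurable]: "S N \<in> borel_measurable M" for N
    unfolding S_def by measurable
  have S_nonneg: "0 \<le> S N x" for N x
    by (simp add: S_def sum_nonneg)
  have S: "S N \<in> L2 M \<and> L2_norm M (S N) \<le> (\<Sum>n<N. L2_norm M (t n))" for N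
  proof (induction N)
    case 0
    then show ?case by (simp add: S_def L2_def L2_norm_def)
  next
    case (Suc N)
    have "(\<lambda>x. norm (t N x)) \<in> L2 M" "L2_norm M (\<lambda>x. norm (t N x)) = L2_norm M (t N)"
      using t[of N] by (auto simp: L2_def L2_norm_def)
    moreover have "S (Suc N) = (\<lambda>x. S N x + norm (t N x))"
      by (simp add: S_def fun_eq_iff)
    ultimately show ?case
      using Suc L2_add[of "S N" M "\<lambda>x. norm (t N x)"] L2_norm_triangle[of "S N" M "\<lambda>x. norm (t N x)"]
      by auto
  qed
  have "0 \<le> K" using K[of 0] by simp
  have S_int: "(\<integral>\<^sup>+x. ennreal ((S N x)\<^sup>2) \<partial>M) \<le> ennreal (K\<^sup>2)" for N
  proof -
    have "(\<integral>\<^sup>+x. ennreal ((S N x)\<^sup>2) \<partial>M) = ennreal ((L2_norm M (S N))\<^sup>2)"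
      using S[of N] by (simp add: L2_norm_eq_nn_integral)
    also have "\<dots> \<le> ennreal (K\<^sup>2)"
      using S[of N] K[of N] by (intro ennreal_leI power_mono) auto
    finally show ?thesis .
  qed
  have mono: "incseq (\<lambda>N x. ennreal ((S N x)\<^sup>2))"
    by (auto simp: incseq_def le_fun_def S_def intro!: ennreal_leI power_mono sum_mono2 sum_nonneg)
  have "(\<integral>\<^sup>+x. (SUP N. ennreal ((S N x)\<^sup>2)) \<partial>M) = (SUP N. \<integral>\<^sup>+x. ennreal ((S N x)\<^sup>2) \<partial>M)"
    by (rule nn_integral_monotone_convergence_SUP[OF mono]) simp
  also have "\<dots> \<le> ennreal (K\<^sup>2)"
    by (rule SUP_least) (rule S_int)
  finally have fin: "(\<integral>\<^sup>+x. (SUP N. ennreal ((S N x)\<^sup>2)) \<partial>M) < \<infinity>"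
    by (auto simp: order.strict_trans1)
  have "AE x in M. (SUP N. ennreal ((S N x)\<^sup>2)) \<noteq> \<infinity>"
    by (rule nn_integral_PInf_AE) (use fin in auto)
  then show sum: "AE x in M. summable (\<lambda>n. norm (t n x))"
  proof eventually_elim
    case (elim x)
    then obtain b where b: "0 \<le> b" "(SUP N. ennreal ((S N x)\<^sup>2)) = ennreal b"
      by (cases "SUP N. ennreal ((S N x)\<^sup>2)") auto
    have "S N x \<le> sqrt b" for N
    proof -
      have "ennreal ((S N x)\<^sup>2) \<le> ennreal b"
        unfolding b(2)[symmetric] by (rule SUP_upper) simp
      then show ?thesis
        using b(1) by (intro real_le_rsqrt) simp
    qed
    then show ?case
      by (intro summableI_nonneg_bounded[of _ "sqrt b"]) (auto simp: S_def)
  qed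
  have "(\<integral>\<^sup>+x. ennreal ((norm (\<Sum>n. norm (t n x)))\<^sup>2) \<partial>M) \<le> (\<integral>\<^sup>+x. (SUP N. ennreal ((S N x)\<^sup>2)) \<partial>M)"
  proof (rule nn_integral_mono_AE)
    show "AE x in M. ennreal ((norm (\<Sum>n. norm (t n x)))\<^sup>2) \<le> (SUP N. ennreal ((S N x)\<^sup>2))"
      using sum
    proof eventually_elim
      case (elim x)
      have "(\<lambda>N. ennreal ((S N x)\<^sup>2)) \<longlonglongrightarrow> ennreal ((\<Sum>n. norm (t n x))\<^sup>2)"
        using summable_LIMSEQ[OF elim] unfolding S_def
        by (intro tendsto_ennrealI tendsto_intros)
      then have "ennreal ((\<Sum>n. norm (t n x))\<^sup>2) \<le> (SUP N. ennreal ((S N x)\<^sup>2))"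
        by (rule LIMSEQ_le_const2) (auto intro!: exI[of _ 0] SUP_upper)
      then show ?case by simp
    qed
  qed
  also note fin
  finally show "(\<lambda>x. \<Sum>n. norm (t n x)) \<in> L2 M"
    unfolding L2_iff_nn_integral by simp
qed

section \<open>The resolvent on complex mean-zero functions\<close>

context reversible_kernel
begin

text \<open>By invariance the integral of \<open>P x N\<close> over \<open>x\<close> is the mass of
  \<open>N\<close>; so a null set of \<open>M\<close> is null for almost every
  \<open>P x\<close>.\<close>

lemma AE_kernel:
  assumes "AE x in M. Q x"
  shows "AE x in M. AE y in P x. Q y"
proof -
  from assms obtain N where N: "{x \<in> space M. \<not> Q x} \<subseteq> N" "N \<in> sets M" "emeasure M N = 0"
    by (rule AE_E)
  have "(\<integral>\<^sup>+x. \<integral>\<^sup>+y. indicator N y \<partial>P x \<partial>M) = 0"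
    using N by (subst nn_integral_kernel) auto
  then have "AE x in M. (\<integral>\<^sup>+y. indicator N y \<partial>P x) = 0"
    using N(2) by (subst (asm) nn_integral_0_iff_AE) auto
  then show ?thesis
    using AE_space
  proof eventually_elim
    case (elim x)
    then have "N \<in> null_sets (P x)"
      using N(2) kernel_space(2)[OF elim(2)] by (auto simp: null_sets_def)
    then show ?case
      by (rule AE_I') (use N(1) kernel_space(3)[OF elim(2)] in auto)
  qed
qed

lemma kernel_op_diff_AE:
  fixes f g :: "'a \<Rightarrow> 'b::{banach, second_countable_topology}"
  assumes "integrable M f" "integrable M g"
  shows "AE x in M. T (\<lambda>x. f x - g x) x = T f x - T g x"
  using AE_kernel_integrable[OF assms(1)] AE_kernel_integrable[OF assms(2)]
  by eventually_elim (simp add: kernel_op_def)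

lemma L2_Re_Im:
  fixes f :: "'a \<Rightarrow> complex"
  assumes f: "f \<in> L2 M"
  shows "(\<lambda>x. Re (f x)) \<in> L2 M" "(\<lambda>x. Im (f x)) \<in> L2 M"
proof -
  have [measurable]: "f \<in> borel_measurable M" using f by (simp add: L2_def)
  show "(\<lambda>x. Re (f x)) \<in> L2 M" "(\<lambda>x. Im (f x)) \<in> L2 M"
    by (rule L2_bound[OF f]; simp add: abs_Re_le_cmod abs_Im_le_cmod)+
qed

lemma kernel_op_complex:
  fixes f :: "'a \<Rightarrow> complex"
  assumes f: "f \<in> L2 M"
  shows "AE x in M. Re (T f x) = T (\<lambda>x. Re (f x)) x \<and> Im (T f x) = T (\<lambda>x. Im (f x)) x"
  using AE_kernel_integrable[OF L2_integrable[OF f]]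
  by eventually_elim (simp add: kernel_op_def)

lemma L2_0_Re_Im:
  fixes f :: "'a \<Rightarrow> complex"
  assumes f: "f \<in> L2_0 M"
  shows "(\<lambda>x. Re (f x)) \<in> L2_0 M" "(\<lambda>x. Im (f x)) \<in> L2_0 M"
  using f L2_Re_Im[of f] L2_integrable[of f] by (auto simp: L2_0_def)

lemma kernel_op_L2_0_complex:
  fixes f :: "'a \<Rightarrow> complex"
  assumes f: "f \<in> L2_0 M"
  shows "T f \<in> L2_0 M"
proof -
  have f2: "f \<in> L2 M" using f by (simp add: L2_0_def)
  note Tf = kernel_op_L2[OF f2]
  have [measurable]: "f \<in> borel_measurable M" using f2 by (simp add: L2_def)
  note ReIm = L2_0_Re_Im[OF f]
  have "Re (\<integral>x. T f x \<partial>M) = (\<integral>x. Re (T f x) \<partial>M)"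
    using L2_integrable[OF Tf] by simp
  also have "\<dots> = (\<integral>x. T (\<lambda>x. Re (f x)) x \<partial>M)"
    by (rule integral_cong_AE) (use kernel_op_complex[OF f2] in auto)
  also have "\<dots> = 0"
    using ReIm(1) by (subst integral_kernel_op) (auto simp: L2_0_def intro!: L2_integrable)
  finally have Re: "Re (\<integral>x. T f x \<partial>M) = 0" .
  have "Im (\<integral>x. T f x \<partial>M) = (\<integral>x. Im (T f x) \<partial>M)"
    using L2_integrable[OF Tf] by simp
  also have "\<dots> = (\<integral>x. T (\<lambda>x. Im (f x)) x \<partial>M)"
    by (rule integral_cong_AE) (use kernel_op_complex[OF f2] in auto)
  also have "\<dots> = 0"
    using ReIm(2) by (subst integral_kernel_op) (auto simp: L2_0_def intro!: L2_integrable)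
  finally have "Im (\<integral>x. T f x \<partial>M) = 0" .
  with Re Tf show ?thesis
    by (simp add: L2_0_def complex_eq_iff)
qed

lemma L2_norm_complex_sq:
  fixes f :: "'a \<Rightarrow> complex"
  assumes f: "f \<in> L2 M"
  shows "(L2_norm M f)\<^sup>2 = (L2_norm M (\<lambda>x. Re (f x)))\<^sup>2 + (L2_norm M (\<lambda>x. Im (f x)))\<^sup>2"
  using L2_Re_Im[OF f] by (simp add: L2_norm_sq cmod_power2 L2_real_iff)

text \<open>The spectrum is complex while positivity and Cheeger are real. \<open>T\<close> acts
  separately on real and imaginary parts, and the squared norms add up, so the constant
  \<open>l\<close> survives.\<close>

lemma kernel_op_norm_le_complex:
  fixes f :: "'a \<Rightarrow> complex"
  assumes f: "f \<in> L2_0 M" and l: "0 \<le> l"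
    and le: "\<And>g :: 'a \<Rightarrow> real. g \<in> L2_0 M \<Longrightarrow> L2_norm M (T g) \<le> l * L2_norm M g"
  shows "L2_norm M (T f) \<le> l * L2_norm M f"
proof (rule power2_le_imp_le)
  have f2: "f \<in> L2 M" using f by (simp add: L2_0_def)
  have [measurable]: "f \<in> borel_measurable M" using f2 by (simp add: L2_def)
  let ?R = "\<lambda>x. Re (f x)" and ?I = "\<lambda>x. Im (f x)"
  have "(L2_norm M (T f))\<^sup>2 = (L2_norm M (\<lambda>x. Re (T f x)))\<^sup>2 + (L2_norm M (\<lambda>x. Im (T f x)))\<^sup>2"
    by (rule L2_norm_complex_sq[OF kernel_op_L2[OF f2]])
  also have "L2_norm M (\<lambda>x. Re (T f x)) = L2_norm M (T ?R)"
    by (rule L2_norm_cong_AE) (use kernel_op_complex[OF f2] in auto)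
  also have "L2_norm M (\<lambda>x. Im (T f x)) = L2_norm M (T ?I)"
    by (rule L2_norm_cong_AE) (use kernel_op_complex[OF f2] in auto)
  also have "(L2_norm M (T ?R))\<^sup>2 + (L2_norm M (T ?I))\<^sup>2 \<le> (l * L2_norm M ?R)\<^sup>2 + (l * L2_norm M ?I)\<^sup>2"
    using L2_0_Re_Im[OF f] by (intro add_mono power_mono le) auto
  also have "\<dots> = (l * L2_norm M f)\<^sup>2"
    by (simp add: L2_norm_complex_sq[OF f2] power_mult_distrib distrib_left)
  finally show "(L2_norm M (T f))\<^sup>2 \<le> (l * L2_norm M f)\<^sup>2" .
qed (use l in simp)

text \<open>Triangle inequality for \<open>c * f = T f - (T f - c * f)\<close>. It yields both the
  bounded inverse and the uniqueness of the preimage.\<close>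

lemma resolvent_bound:
  fixes f :: "'a \<Rightarrow> complex"
  assumes f: "f \<in> L2_0 M" and le: "L2_norm M (T f) \<le> l * L2_norm M f" and l: "l < cmod c"
  shows "L2_norm M f \<le> 1 / (cmod c - l) * L2_norm M (\<lambda>x. T f x - c * f x)"
proof -
  have f2: "f \<in> L2 M" using f by (simp add: L2_0_def)
  note Tf = kernel_op_L2[OF f2]
  have "cmod c * L2_norm M f = L2_norm M (\<lambda>x. T f x + - (T f x - c * f x))"
    using L2_norm_cmult[of M c f] by simp
  also have "\<dots> \<le> L2_norm M (T f) + L2_norm M (\<lambda>x. - (T f x - c * f x))"
    using L2_cmult[OF L2_diff[OF Tf L2_cmult[OF f2, of c]], of "-1"]
    by (intro L2_norm_triangle Tf) simp
  also have "L2_norm M (\<lambda>x. - (T f x - c * f x)) = L2_norm M (\<lambda>x. T f x - c * f x)"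
    by (rule L2_norm_minus)
  finally have "(cmod c - l) * L2_norm M f \<le> L2_norm M (\<lambda>x. T f x - c * f x)"
    using le by (simp add: left_diff_distrib)
  then show ?thesis
    using l by (simp add: pos_le_divide_eq mult.commute)
qed

lemma Neumann_series:
  fixes g :: "'a \<Rightarrow> complex"
  assumes le: "\<And>f :: 'a \<Rightarrow> complex. f \<in> L2_0 M \<Longrightarrow> L2_norm M (T f) \<le> l * L2_norm M f"
    and l: "0 \<le> l" "l < cmod c" and g: "g \<in> L2_0 M"
  shows "\<exists>f\<in>L2_0 M. AE x in M. T f x - c * f x = g x"
proof -
  have "0 < cmod c" using l by linarith
  then have "c \<noteq> 0" and ratio: "l / cmod c < 1"
    using l by (auto simp: pos_divide_less_eq)
  define G where "G n = (T ^^ n) g" for n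
  have G_Suc: "G (Suc n) = T (G n)" for n by (simp add: G_def)
  have G: "G n \<in> L2_0 M \<and> L2_norm M (G n) \<le> l ^ n * L2_norm M g" for n
  proof (induction n)
    case (Suc n)
    then have "L2_norm M (G (Suc n)) \<le> l * (l ^ n * L2_norm M g)"
      unfolding G_Suc using le[of "G n"] l(1) by (meson mult_left_mono order_trans)
    then show ?case
      using Suc kernel_op_L2_0_complex[of "G n"] by (simp add: G_Suc mult.assoc)
  qed (simp add: G_def g)
  then have G2: "G n \<in> L2 M" "(\<integral>x. G n x \<partial>M) = 0" for n
    by (auto simp: L2_0_def)
  \<comment> \<open>The solution is minus the sum of \<open>T^n g / c^(n+1)\<close>, a series
    dominated in norm by a geometric one with ratio \<open>l / cmod c\<close>.\<close>
  define t where "t n x = (1 / c ^ Suc n) * G n x" for n x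
  have t: "t n \<in> L2 M" for n
    unfolding t_def by (intro L2_cmult G2)
  have t_norm: "L2_norm M (t n) \<le> (L2_norm M g / cmod c) * (l / cmod c) ^ n" for n
  proof -
    have "L2_norm M (t n) = L2_norm M (G n) / cmod c ^ Suc n"
      unfolding t_def L2_norm_cmult by (simp add: norm_divide norm_mult norm_power)
    also have "\<dots> \<le> (l ^ n * L2_norm M g) / cmod c ^ Suc n"
      using G[of n] by (intro divide_right_mono) auto
    also have "\<dots> = (L2_norm M g / cmod c) * (l / cmod c) ^ n"
      by (simp add: power_divide)
    finally show ?thesis .
  qed
  define K where "K = (\<Sum>n. (L2_norm M g / cmod c) * (l / cmod c) ^ n)"
  have K: "(\<Sum>n<N. L2_norm M (t n)) \<le> K" for N
  proof -
    have "(\<Sum>n<N. L2_norm M (t n)) \<le> (\<Sum>n<N. (L2_norm M g / cmod c) * (l / cmod c) ^ n)"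
      by (intro sum_mono t_norm)
    also have "\<dots> \<le> K"
      unfolding K_def using l ratio by (intro sum_le_suminf summable_mult summable_geometric) auto
    finally show ?thesis .
  qed
  note sum = L2_series_dominated(1)[of t M K, OF t K] and dom = L2_series_dominated(2)[of t M K, OF t K]
  have [measurable]: "t n \<in> borel_measurable M" for n
    using t by (simp add: L2_def)
  define f where "f x = - (\<Sum>n. t n x)" for x
  have "(\<lambda>x. \<Sum>n. t n x) \<in> L2 M"
  proof (rule L2_bound[OF dom])
    show "AE x in M. norm (\<Sum>n. t n x) \<le> norm (\<Sum>n. norm (t n x))"
      using sum by eventually_elim (simp add: summable_norm order.trans[OF summable_norm abs_ge_self])
  qed simp
  then have f: "f \<in> L2 M"
    using L2_cmult[of "\<lambda>x. \<Sum>n. t n x" M "-1"] by (simp add: f_def[abs_def])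
  have "(\<integral>x. (\<Sum>n. t n x) \<partial>M) = (\<Sum>n. \<integral>x. t n x \<partial>M)"
    by (rule integral_suminf_dominated[OF L2_integrable[OF t] sum L2_integrable[OF dom]])
  also have "\<dots> = 0"
    using G2 by (simp add: t_def)
  finally have "f \<in> L2_0 M"
    using f by (simp add: L2_0_def f_def[abs_def])
  \<comment> \<open>Applying \<open>T\<close> termwise is an exchange of sum and integral under
    \<open>P x\<close>, so summability and domination, known under \<open>M\<close>, are carried
    over to almost every \<open>P x\<close>.\<close>
  moreover have "AE x in M. \<forall>n. integrable (P x) (t n)"
    by (simp add: AE_all_countable AE_kernel_integrable L2_integrable t)
  then have "AE x in M. T f x - c * f x = g x"
    using sum AE_kernel[OF sum] AE_kernel_integrable[OF L2_integrable[OF dom]]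
  proof eventually_elim
    case (elim x)
    have "T f x = - (\<Sum>n. \<integral>y. t n y \<partial>P x)"
      unfolding kernel_op_def f_def
      using integral_suminf_dominated[OF _ elim(3,4)] elim(1) by simp
    also have "(\<lambda>n. \<integral>y. t n y \<partial>P x) = (\<lambda>n. (1 / c ^ Suc n) * G (Suc n) x)"
      by (simp add: t_def G_Suc kernel_op_def)
    finally have T: "T f x = - (\<Sum>n. (1 / c ^ Suc n) * G (Suc n) x)" .
    have "summable (\<lambda>n. t n x)"
      using elim(2) by (rule summable_norm_cancel)
    from summable_mult[OF this, of c] suminf_mult[OF this, of c]
    have s: "summable (\<lambda>n. (1 / c ^ n) * G n x)" and c: "c * (\<Sum>n. t n x) = (\<Sum>n. (1 / c ^ n) * G n x)"
      using \<open>c \<noteq> 0\<close> by (simp_all add: t_def)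
    \<comment> \<open>Up to sign, the series of \<open>T f\<close> is that of \<open>c * f\<close>
      without its first term, which is \<open>g\<close>; the difference \<open>T f - c * f\<close>
      telescopes to \<open>g\<close>.\<close>
    have "(\<Sum>n. (1 / c ^ Suc n) * G (Suc n) x) = (\<Sum>n. (1 / c ^ n) * G n x) - (1 / c ^ 0) * G 0 x"
      by (rule suminf_split_head[OF s])
    then show "T f x - c * f x = g x"
      by (simp add: T f_def c G_def)
  qed
  ultimately show ?thesis by blast
qed

lemma resolvent_set_0I:
  assumes le: "\<And>f :: 'a \<Rightarrow> complex. f \<in> L2_0 M \<Longrightarrow> L2_norm M (T f) \<le> l * L2_norm M f"
    and l: "0 \<le> l" "l < cmod c"
  shows "c \<in> resolvent_set_0 M P"
  unfolding resolvent_set_0_def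
proof (intro CollectI conjI ballI)
  note bound = resolvent_bound[OF _ le l(2)]
  show "\<exists>C. \<forall>f\<in>L2_0 M. L2_norm M f \<le> C * L2_norm M (\<lambda>x. T f x - c * f x)"
    using bound by blast
  fix g :: "'a \<Rightarrow> complex" assume "g \<in> L2_0 M"
  from Neumann_series[OF le l this] obtain f where f: "f \<in> L2_0 M" "AE x in M. T f x - c * f x = g x"
    by auto
  have "AE x in M. f' x = f x" if f': "f' \<in> L2_0 M" "AE x in M. T f' x - c * f' x = g x" for f'
  proof -
    define h where "h x = f' x - f x" for x
    have h: "h \<in> L2_0 M"
      unfolding h_def using f'(1) f(1) by (rule L2_0_diff)
    then have h2: "h \<in> L2 M" by (simp add: L2_0_def)
    have [measurable]: "h \<in> borel_measurable M"
      using h2 by (simp add: L2_def)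
    have "AE x in M. T h x = T f' x - T f x"
      unfolding h_def using f(1) f'(1)
      by (intro kernel_op_diff_AE L2_integrable) (auto simp: L2_0_def)
    with f(2) f'(2) have "AE x in M. T h x - c * h x = 0"
      by eventually_elim (simp add: h_def right_diff_distrib diff_eq_eq)
    then have "L2_norm M (\<lambda>x. T h x - c * h x) = L2_norm M (\<lambda>x. 0 :: complex)"
      by (intro L2_norm_cong_AE) auto
    then have "L2_norm M h \<le> 0"
      using bound[OF h h] by (simp add: L2_norm_def)
    then have "L2_norm M h = 0"
      using L2_norm_nonneg[of M h] by linarith
    from L2_norm_eq_0[OF h2 this] show ?thesis
      by eventually_elim (simp add: h_def)
  qed
  with f show "\<exists>f\<in>L2_0 M. (AE x in M. T f x - c * f x = g x) \<and>
      (\<forall>f'\<in>L2_0 M. (AE x in M. T f' x - c * f' x = g x) \<longrightarrow> (AE x in M. f' x = f x))"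
    by blast
qed

end

lemma (in positive_reversible_kernel) spectral_gap_ge:
  assumes \<Phi>: "0 \<le> \<Phi> (1/2)" "\<Phi> (1/2) \<le> 1"
  shows "ereal ((\<Phi> (1/2))\<^sup>2 / 2) \<le> spectral_gap M P"
proof -
  define l where "l = 1 - (\<Phi> (1/2))\<^sup>2 / 2"
  have "(\<Phi> (1/2))\<^sup>2 \<le> 1"
    using \<Phi> by (simp add: power_le_one)
  then have l: "0 \<le> l" by (simp add: l_def)
  have le: "L2_norm M (T f) \<le> l * L2_norm M f" if "f \<in> L2_0 M" for f :: "'a \<Rightarrow> complex"
    using that l kernel_op_norm_le[OF _ \<Phi>] unfolding l_def by (rule kernel_op_norm_le_complex)
  have "cmod c \<le> l" if "c \<in> spectrum_0 M P" for c
    using that resolvent_set_0I[OF le l, of c] by (force simp: spectrum_0_def)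
  \<comment> \<open>The supremum is taken in \<open>ereal\<close>, so the termwise bound would also
    cover an empty spectrum.\<close>
  then have "(SUP c\<in>spectrum_0 M P. ereal (cmod c)) \<le> ereal l"
    by (intro SUP_least) simp
  then have "1 - ereal l \<le> spectral_gap M P"
    unfolding spectral_gap_def by (intro ereal_minus_mono) auto
  then show ?thesis
    by (simp add: l_def one_ereal_def)
qed

section \<open>Chi-squared divergence along the chain\<close>

lemma (in prob_space) chi_squared_density:
  fixes f :: "'a \<Rightarrow> real"
  assumes [measurable]: "f \<in> borel_measurable M" and nonneg: "\<And>x. 0 \<le> f x"
  shows "chi_squared (density M (\<lambda>x. ennreal (f x))) M = (\<integral>\<^sup>+x. ennreal ((f x - 1)\<^sup>2) \<partial>M)"
proof -
  let ?N = "density M (\<lambda>x. ennreal (f x))"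
  have "absolutely_continuous M ?N"
    by (rule absolutely_continuousI_density) simp
  moreover have "AE x in M. ennreal (f x) = RN_deriv M ?N x"
    by (rule RN_deriv_unique) auto
  then have "AE x in M. ennreal ((enn2real (RN_deriv M ?N x) - 1)\<^sup>2) = ennreal ((f x - 1)\<^sup>2)"
  proof eventually_elim
    case (elim x)
    from arg_cong[OF elim, of enn2real] nonneg[of x] show ?case by simp
  qed
  then have "(\<integral>\<^sup>+x. ennreal ((enn2real (RN_deriv M ?N x) - 1)\<^sup>2) \<partial>M) = (\<integral>\<^sup>+x. ennreal ((f x - 1)\<^sup>2) \<partial>M)"
    by (rule nn_integral_cong_AE)
  ultimately show ?thesis
    by (simp add: chi_squared_def)
qed

lemma (in prob_space) chi_squared_density_L2:
  fixes f :: "'a \<Rightarrow> real"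
  assumes f: "f \<in> L2 M" and nonneg: "\<And>x. 0 \<le> f x" and int: "(\<integral>x. f x \<partial>M) = 1"
  shows "chi_squared (density M (\<lambda>x. ennreal (f x))) M = ennreal ((\<integral>x. (f x)\<^sup>2 \<partial>M) - 1)"
    and "(\<integral>x. (f x - 1)\<^sup>2 \<partial>M) = (\<integral>x. (f x)\<^sup>2 \<partial>M) - 1"
proof -
  have f1: "(\<lambda>x. f x - 1) \<in> L2 M"
    by (intro L2_diff f L2_const)
  have "(\<integral>x. (f x - 1)\<^sup>2 \<partial>M) = (\<integral>x. (f x)\<^sup>2 - 2 * f x + 1 \<partial>M)"
    by (simp add: power2_diff algebra_simps)
  also have "\<dots> = (\<integral>x. (f x)\<^sup>2 \<partial>M) - 1"
    using f L2_integrable[OF f] by (simp add: L2_real_iff int prob_space)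
  finally show eq: "(\<integral>x. (f x - 1)\<^sup>2 \<partial>M) = (\<integral>x. (f x)\<^sup>2 \<partial>M) - 1" .
  have "chi_squared (density M (\<lambda>x. ennreal (f x))) M = ennreal (\<integral>x. (f x - 1)\<^sup>2 \<partial>M)"
    using f f1 nonneg by (subst chi_squared_density) (auto simp: L2_real_iff nn_integral_eq_integral)
  then show "chi_squared (density M (\<lambda>x. ennreal (f x))) M = ennreal ((\<integral>x. (f x)\<^sup>2 \<partial>M) - 1)"
    by (simp add: eq)
qed

lemma (in prob_space) real_density_exists:
  assumes "prob_space N" "sets N = sets M" "absolutely_continuous M N"
  obtains f :: "'a \<Rightarrow> real" where "f \<in> borel_measurable M" "\<And>x. 0 \<le> f x" "integrable M f"
    "(\<integral>x. f x \<partial>M) = 1" "N = density M (\<lambda>x. ennreal (f x))"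
proof -
  interpret N: prob_space N by fact
  define f where "f x = enn2real (RN_deriv M N x)" for x
  have [measurable]: "f \<in> borel_measurable M"
    unfolding f_def by measurable
  have "AE x in M. RN_deriv M N x \<noteq> \<infinity>"
    by (rule RN_deriv_finite) (use assms N.sigma_finite_measure_axioms in auto)
  then have "density M (\<lambda>x. ennreal (f x)) = density M (RN_deriv M N)"
    by (intro density_cong) (auto elim!: eventually_mono simp: f_def less_top)
  then have N: "N = density M (\<lambda>x. ennreal (f x))"
    using density_RN_deriv[of N] assms by simp
  have "emeasure N (space N) = (\<integral>\<^sup>+x. ennreal (f x) \<partial>M)"
    using sets_eq_imp_space_eq[OF assms(2)] by (subst N) (simp add: emeasure_density cong: nn_integral_cong)
  then have int: "(\<integral>\<^sup>+x. ennreal (f x) \<partial>M) = 1"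
    by (simp add: N.emeasure_space_1)
  have nonneg: "0 \<le> f x" for x by (simp add: f_def)
  have 1: "integrable M f"
    using int nonneg by (intro integrableI_nonneg) auto
  have 2: "(\<integral>x. f x \<partial>M) = 1"
    using int nonneg by (subst integral_eq_nn_integral) auto
  show ?thesis
    by (rule that[OF _ nonneg 1 2 N]) simp
qed

context reversible_kernel
begin

lemma kernel_op_nonneg: "(\<And>x. 0 \<le> f x) \<Longrightarrow> 0 \<le> T f x" for f :: "'a \<Rightarrow> real"
  unfolding kernel_op_def by (rule Bochner_Integration.integral_nonneg)

text \<open>One step of the chain applies the adjoint of \<open>P\<close> to the density. The swap
  of coordinates under \<open>J\<close> identifies the adjoint with \<open>T\<close>.\<close>

lemma bind_density_kernel:
  fixes f :: "'a \<Rightarrow> real"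
  assumes f: "integrable M f" and nonneg: "\<And>x. 0 \<le> f x"
  shows "density M (\<lambda>x. ennreal (f x)) \<bind> P = density M (\<lambda>x. ennreal (T f x))"
proof (rule measure_eqI)
  let ?N = "density M (\<lambda>x. ennreal (f x))"
  have [measurable]: "f \<in> borel_measurable M" using f by simp
  have P: "P \<in> ?N \<rightarrow>\<^sub>M subprob_algebra M"
    using kernel_subprob by (simp cong: measurable_cong_sets)
  show sets: "sets (?N \<bind> P) = sets (density M (\<lambda>x. ennreal (T f x)))"
    by (subst sets_bind[where N=M]) (auto simp: kernel_space(2) not_empty)
  fix S assume "S \<in> sets (?N \<bind> P)"
  then have [measurable]: "S \<in> sets M" by (simp add: sets)
  have "emeasure (?N \<bind> P) S = (\<integral>\<^sup>+x. emeasure (P x) S \<partial>?N)"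
    using not_empty by (intro emeasure_bind[OF _ P]) auto
  also have "\<dots> = (\<integral>\<^sup>+x. ennreal (f x) * emeasure (P x) S \<partial>M)"
    by (subst nn_integral_density) auto
  also have "\<dots> = (\<integral>\<^sup>+x. \<integral>\<^sup>+y. ennreal (f x) * indicator S y \<partial>P x \<partial>M)"
    by (intro nn_integral_cong) (simp add: nn_integral_cmult kernel_space)
  also have "\<dots> = (\<integral>\<^sup>+(x, y). ennreal (f x) * indicator S y \<partial>J)"
    by (subst nn_integral_J) auto
  also have "\<dots> = (\<integral>\<^sup>+(x, y). ennreal (f y) * indicator S x \<partial>J)"
    using nn_integral_J_swap[of "\<lambda>x y. ennreal (f x) * indicator S y"] by simp
  also have "\<dots> = (\<integral>\<^sup>+x. \<integral>\<^sup>+y. ennreal (f y) * indicator S x \<partial>P x \<partial>M)"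
    by (subst nn_integral_J) auto
  also have "\<dots> = (\<integral>\<^sup>+x. ennreal (T f x) * indicator S x \<partial>M)"
  proof (rule nn_integral_cong_AE)
    show "AE x in M. (\<integral>\<^sup>+y. ennreal (f y) * indicator S x \<partial>P x) = ennreal (T f x) * indicator S x"
      using AE_kernel_integrable[OF f]
    proof eventually_elim
      case (elim x)
      then have "(\<integral>\<^sup>+y. ennreal (f y) \<partial>P x) = ennreal (T f x)"
        unfolding kernel_op_def by (rule nn_integral_eq_integral) (simp add: nonneg)
      then show ?case by (auto split: split_indicator)
    qed
  qed
  also have "\<dots> = emeasure (density M (\<lambda>x. ennreal (T f x))) S"
    by (subst emeasure_density) auto
  finally show "emeasure (?N \<bind> P) S = emeasure (density M (\<lambda>x. ennreal (T f x))) S" .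
qed

lemma kernel_op_iterate:
  fixes f :: "'a \<Rightarrow> real"
  assumes f: "f \<in> L2 M" "\<And>x. 0 \<le> f x" "(\<integral>x. f x \<partial>M) = 1"
  shows "(T ^^ n) f \<in> L2 M \<and> (\<forall>x. 0 \<le> (T ^^ n) f x) \<and> (\<integral>x. (T ^^ n) f x \<partial>M) = 1"
proof (induction n)
  case (Suc n)
  then have g: "(T ^^ n) f \<in> L2 M" "\<And>x. 0 \<le> (T ^^ n) f x" "(\<integral>x. (T ^^ n) f x \<partial>M) = 1"
    by blast+
  have "(T ^^ Suc n) f = T ((T ^^ n) f)" by simp
  then show ?case
    using integral_kernel_op[OF L2_integrable[OF g(1)]] g(3)
    by (simp only: kernel_op_L2[OF g(1)] kernel_op_nonneg[OF g(2)] simp_thms)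
qed (simp only: funpow_0 f simp_thms)

lemma push_iter_density:
  fixes f :: "'a \<Rightarrow> real"
  assumes f: "f \<in> L2 M" "\<And>x. 0 \<le> f x" "(\<integral>x. f x \<partial>M) = 1"
  shows "push_iter (density M (\<lambda>x. ennreal (f x))) P n = density M (\<lambda>x. ennreal ((T ^^ n) f x))"
proof (induction n)
  case (Suc n)
  have g: "(T ^^ n) f \<in> L2 M" "\<And>x. 0 \<le> (T ^^ n) f x"
    using kernel_op_iterate[OF f, of n] by auto
  have "push_iter (density M (\<lambda>x. ennreal (f x))) P (Suc n) =
      push_iter (density M (\<lambda>x. ennreal (f x))) P n \<bind> P"
    by (simp add: push_iter_def)
  then show ?case
    unfolding Suc bind_density_kernel[OF L2_integrable[OF g(1)] g(2)] by simp
qed (simp add: push_iter_def)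

lemma chi_squared_push_iter:
  fixes f :: "'a \<Rightarrow> real"
  assumes f: "f \<in> L2 M" "\<And>x. 0 \<le> f x" "(\<integral>x. f x \<partial>M) = 1"
  shows "chi_squared (push_iter (density M (\<lambda>x. ennreal (f x))) P n) M =
    ennreal ((\<integral>x. ((T ^^ n) f x)\<^sup>2 \<partial>M) - 1)"
proof -
  have g: "(T ^^ n) f \<in> L2 M" "\<And>x. 0 \<le> (T ^^ n) f x" "(\<integral>x. (T ^^ n) f x \<partial>M) = 1"
    using kernel_op_iterate[OF f, of n] by auto
  show ?thesis
    unfolding push_iter_density[OF f] by (rule chi_squared_density_L2(1)[OF g])
qed

end

text \<open>The norm bound for mean-zero functions, applied to \<open>f - 1\<close>: its squared
  norm is the divergence, and \<open>T\<close> fixes constants.\<close>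

lemma (in positive_reversible_kernel) chi_squared_contraction:
  fixes f :: "'a \<Rightarrow> real"
  assumes f: "f \<in> L2 M" "\<And>x. 0 \<le> f x" "(\<integral>x. f x \<partial>M) = 1"
    and \<Phi>: "0 \<le> \<Phi> (1/2)" "\<Phi> (1/2) \<le> 1"
  shows "(\<integral>x. (T f x)\<^sup>2 \<partial>M) - 1 \<le> (1 - (\<Phi> (1/2))\<^sup>2 / 2)\<^sup>2 * ((\<integral>x. (f x)\<^sup>2 \<partial>M) - 1)"
proof -
  have [measurable]: "f \<in> borel_measurable M" using f(1) by (simp add: L2_def)
  define g where "g = (\<lambda>x. f x - 1)"
  have g: "g \<in> L2_0 M"
    unfolding g_def L2_0_def using f L2_integrable[OF f(1)]
    by (auto intro!: L2_diff L2_const simp: prob_space)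
  have Tf: "T f \<in> L2 M" "\<And>x. 0 \<le> T f x" "(\<integral>x. T f x \<partial>M) = 1"
    using kernel_op_L2[OF f(1)] kernel_op_nonneg[OF f(2)] integral_kernel_op[OF L2_integrable[OF f(1)]] f(3)
    by auto
  have "AE x in M. T g x = T f x - 1"
    unfolding g_def
    using kernel_op_diff_AE[OF L2_integrable[OF f(1)] integrable_const[of 1]] AE_space
  proof eventually_elim
    case (elim x)
    then have "T (\<lambda>x. 1 :: real) x = 1"
      using prob_space.prob_space[OF kernel_space(1)] by (simp add: kernel_op_def)
    with elim(1) show ?case by simp
  qed
  then have "(L2_norm M (T g))\<^sup>2 = (L2_norm M (\<lambda>x. T f x - 1))\<^sup>2"
    by (subst L2_norm_cong_AE[of "T g" M "\<lambda>x. T f x - 1"]) (auto simp: g_def)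
  also have "\<dots> = (\<integral>x. (T f x)\<^sup>2 \<partial>M) - 1"
    using chi_squared_density_L2(2)[OF Tf] by (simp add: L2_norm_sq)
  finally have lhs: "(L2_norm M (T g))\<^sup>2 = (\<integral>x. (T f x)\<^sup>2 \<partial>M) - 1" .
  have "(L2_norm M (T g))\<^sup>2 \<le> ((1 - (\<Phi> (1/2))\<^sup>2 / 2) * L2_norm M g)\<^sup>2"
    by (intro power_mono kernel_op_norm_le[OF g \<Phi>]) simp
  also have "(L2_norm M g)\<^sup>2 = (\<integral>x. (f x)\<^sup>2 \<partial>M) - 1"
    using chi_squared_density_L2(2)[OF f] by (simp add: L2_norm_sq g_def)
  then have "((1 - (\<Phi> (1/2))\<^sup>2 / 2) * L2_norm M g)\<^sup>2 =
      (1 - (\<Phi> (1/2))\<^sup>2 / 2)\<^sup>2 * ((\<integral>x. (f x)\<^sup>2 \<partial>M) - 1)"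
    by (simp add: power_mult_distrib)
  finally show ?thesis
    by (simp add: lhs)
qed

section \<open>The mixing-time recursion\<close>

text \<open>Potential for the recursion \<open>u \<mapsto> u * (1 - \<kappa> * min 1 (w (2/u))\<^sup>2)\<close> in the variable
  \<open>\<xi> = 2/u\<close>: each step moves \<open>\<xi>\<close> to the right across at least one unit of its integral. The
  point \<open>a\<close> separates the region where \<open>w \<ge> 1\<close> from the one where \<open>w \<le> 1\<close>.\<close>

definition step_density :: "real \<Rightarrow> real \<Rightarrow> (real \<Rightarrow> real) \<Rightarrow> real \<Rightarrow> real" where
  "step_density \<kappa> a w \<xi> = (if \<xi> < a then 1 / \<xi> else 1 / ((w \<xi>)\<^sup>2 * \<xi>)) / \<kappa>"

lemma nn_integral_inverse_Icc:
  fixes x y r :: real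
  assumes "0 < x" "x \<le> y" "0 \<le> r"
  shows "(\<integral>\<^sup>+\<xi>. ennreal (r / \<xi>) * indicator {x..y} \<xi> \<partial>lborel) = ennreal (r * (ln y - ln x))"
proof -
  have "(\<integral>\<^sup>+\<xi>. ennreal (r / \<xi>) * indicator {x..y} \<xi> \<partial>lborel) = ennreal (r * ln y - r * ln x)"
  proof (rule nn_integral_FTC_Icc)
    show "DERIV (\<lambda>\<xi>. r * ln \<xi>) \<xi> :> r / \<xi>" if "\<xi> \<in> {x..y}" for \<xi>
      using that assms by (auto intro!: derivative_eq_intros)
  qed (use assms in auto)
  then show ?thesis by (simp add: right_diff_distrib)
qed

text \<open>Let \<open>r = \<kappa> * (min 1 (w x))^2\<close>. A step from \<open>x\<close> to
  \<open>y\<close> multiplies \<open>\<xi>\<close> by at least \<open>1 / (1 - r)\<close>, so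
  \<open>ln y - ln x \<ge> - ln (1 - r) \<ge> r\<close>. As \<open>w\<close> is antitone, the
  density is at least \<open>1 / (r * \<xi>)\<close> on \<open>[x, y)\<close> off the point
  \<open>a\<close>, so its integral there is at least 1. The condition \<open>8 < u n\<close> keeps
  all points below 1/4.\<close>

lemma step_density_recursion:
  fixes u :: "nat \<Rightarrow> real" and w :: "real \<Rightarrow> real"
  assumes \<kappa>: "0 < \<kappa>" "\<kappa> < 1"
    and w_pos: "\<And>\<xi>. 0 < \<xi> \<Longrightarrow> \<xi> \<le> 1/4 \<Longrightarrow> 0 < w \<xi>"
    and w_anti: "\<And>x y. 0 < x \<Longrightarrow> x \<le> y \<Longrightarrow> y \<le> 1/4 \<Longrightarrow> w y \<le> w x"
    and w_meas: "step_density \<kappa> a w \<in> borel_measurable (restrict_space borel {0<..<1/4})"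
    and a: "\<And>\<xi>. 0 < \<xi> \<Longrightarrow> \<xi> \<le> 1/4 \<Longrightarrow> \<xi> < a \<Longrightarrow> 1 \<le> w \<xi>"
      "\<And>\<xi>. 0 < \<xi> \<Longrightarrow> \<xi> < 1/4 \<Longrightarrow> a < \<xi> \<Longrightarrow> w \<xi> \<le> 1"
    and dec: "\<And>n. u (Suc n) \<le> u n"
    and step: "\<And>n. 8 \<le> u n \<Longrightarrow> u (Suc n) \<le> u n * (1 - \<kappa> * (min 1 (w (2 / u n)))\<^sup>2)"
    and n: "8 < u n"
  shows "ennreal (real n) \<le>
    (\<integral>\<^sup>+\<xi>. ennreal (step_density \<kappa> a w \<xi>) * indicator {2 / u 0..<2 / u n} \<xi> \<partial>lborel)"
  using n
proof (induction n)
  case (Suc n)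
  let ?q = "\<lambda>\<xi>. ennreal (step_density \<kappa> a w \<xi>)"
  have un: "8 < u n" using dec[of n] Suc.prems by simp
  have "u n \<le> u 0" by (induction n) (use dec order_trans in auto)
  with un have u0: "8 < u 0" "2 / u 0 \<le> 2 / u n" by (auto simp: frac_le)
  define x y where "x = 2 / u n" and "y = 2 / u (Suc n)"
  have xy: "0 < x" "x \<le> y" "y < 1/4"
    using un Suc.prems dec[of n] by (auto simp: x_def y_def frac_le pos_divide_less_eq)
  \<comment> \<open>The density is assumed measurable only on the open interval up to 1/4; the
    indicator confines it to that interval.\<close>
  have meas: "(\<lambda>\<xi>. ?q \<xi> * indicator {s..<t} \<xi>) \<in> borel_measurable borel" if "0 < s" "t < 1/4" for s t
  proof -
    have "(\<lambda>\<xi>. ?q \<xi>) \<in> borel_measurable (restrict_space borel {0<..<1/4})"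
      using w_meas by measurable
    then have m: "(\<lambda>\<xi>. ?q \<xi> * indicator {0<..<1/4} \<xi>) \<in> borel_measurable borel"
      by (subst (asm) borel_measurable_restrict_space_iff_ennreal) auto
    have "(\<lambda>\<xi>. ?q \<xi> * indicator {0<..<1/4} \<xi> * indicator {s..<t} \<xi>) \<in> borel_measurable borel"
      using m by (rule borel_measurable_times_ennreal) simp
    also have "(\<lambda>\<xi>. ?q \<xi> * indicator {0<..<1/4} \<xi> * indicator {s..<t} \<xi>) = (\<lambda>\<xi>. ?q \<xi> * indicator {s..<t} \<xi>)"
      using that by (auto simp: fun_eq_iff split: split_indicator)
    finally show ?thesis .
  qed
  define r where "r = \<kappa> * (min 1 (w x))\<^sup>2"
  have "0 < w x" using xy by (intro w_pos) auto
  then have min: "0 < min 1 (w x)" "(min 1 (w x))\<^sup>2 \<le> 1" by (auto simp: power_le_one)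
  have "r \<le> \<kappa> * 1"
    unfolding r_def using \<kappa> min by (intro mult_left_mono) auto
  with \<kappa>(2) have "r < 1" by linarith
  moreover have "0 < r"
    unfolding r_def using \<kappa>(1) min(1) by simp
  ultimately have r: "0 < r" "r < 1" by auto
  have "u (Suc n) \<le> u n * (1 - r)"
    using step[of n] un by (simp add: r_def x_def)
  then have "1 / (1 - r) \<le> y / x"
    using un Suc.prems r by (simp add: x_def y_def field_simps)
  then have "ln (1 / (1 - r)) \<le> ln (y / x)"
    using r xy by simp
  then have "- ln (1 - r) \<le> ln y - ln x"
    using r xy by (simp add: ln_div)
  moreover have "ln (1 - r) \<le> - r"
    using ln_le_minus_one[of "1 - r"] r by simp
  ultimately have "1 \<le> 1 / r * (ln y - ln x)"
    using r by (simp add: field_simps)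
  then have "1 \<le> (\<integral>\<^sup>+\<xi>. ennreal (1 / r / \<xi>) * indicator {x..y} \<xi> \<partial>lborel)"
    using nn_integral_inverse_Icc[of x y "1/r"] xy r by (simp flip: ennreal_1)
  also have "\<dots> \<le> (\<integral>\<^sup>+\<xi>. ?q \<xi> * indicator {x..<y} \<xi> \<partial>lborel)"
  proof (rule nn_integral_mono_AE)
    \<comment> \<open>Nothing is assumed about \<open>w\<close> relative to 1 at \<open>a\<close>
      itself beyond the antitone property; \<open>a\<close> and the endpoint \<open>y\<close> form a
      null set.\<close>
    have "1 / r / \<xi> \<le> step_density \<kappa> a w \<xi>" if \<xi>: "x \<le> \<xi>" "\<xi> < y" "\<xi> \<noteq> a" for \<xi>
    proof -
      have w\<xi>: "0 < w \<xi>" "w \<xi> \<le> w x"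
        using \<xi> xy by (auto intro!: w_pos w_anti)
      have "\<xi> > 0" using \<xi> xy by simp
      show ?thesis
      proof (cases "\<xi> < a")
        case True
        then have "1 \<le> w x" using a(1)[of \<xi>] \<xi> xy w\<xi> by simp
        with True show ?thesis by (simp add: r_def step_density_def mult.commute)
      next
        case False
        then have "w \<xi> \<le> min 1 (w x)"
          using a(2)[of \<xi>] \<xi> xy w\<xi> by simp
        then have "\<kappa> * (w \<xi>)\<^sup>2 \<le> r"
          unfolding r_def using w\<xi> \<kappa> by (intro mult_left_mono power_mono) auto
        then have "1 / r / \<xi> \<le> 1 / (\<kappa> * (w \<xi>)\<^sup>2) / \<xi>"
          using w\<xi> \<kappa> \<open>0 < \<xi>\<close> by (intro divide_right_mono divide_left_mono) (auto simp: r)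
        also have "\<dots> = step_density \<kappa> a w \<xi>"
          using False by (simp add: step_density_def)
        finally show ?thesis .
      qed
    qed
    then show "AE \<xi> in lborel. ennreal (1 / r / \<xi>) * indicator {x..y} \<xi> \<le> ?q \<xi> * indicator {x..<y} \<xi>"
      using AE_lborel_singleton[of a] AE_lborel_singleton[of y]
      by (auto elim!: eventually_elim2 intro!: ennreal_leI split: split_indicator)
  qed
  finally have one: "1 \<le> (\<integral>\<^sup>+\<xi>. ?q \<xi> * indicator {x..<y} \<xi> \<partial>lborel)" .
  have "ennreal (real (Suc n)) = ennreal (real n) + 1"
    by (simp add: ennreal_plus[symmetric] del: ennreal_plus flip: ennreal_1)
  also have "\<dots> \<le> (\<integral>\<^sup>+\<xi>. ?q \<xi> * indicator {2 / u 0..<x} \<xi> \<partial>lborel) + (\<integral>\<^sup>+\<xi>. ?q \<xi> * indicator {x..<y} \<xi> \<partial>lborel)"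
    using Suc.IH[OF un] one unfolding x_def by (rule add_mono)
  also have "\<dots> = (\<integral>\<^sup>+\<xi>. ?q \<xi> * indicator {2 / u 0..<x} \<xi> + ?q \<xi> * indicator {x..<y} \<xi> \<partial>lborel)"
    using meas[of "2 / u 0" x] meas[of x y] xy u0 by (intro nn_integral_add[symmetric]) auto
  also have "\<dots> \<le> (\<integral>\<^sup>+\<xi>. ?q \<xi> * indicator {2 / u 0..<y} \<xi> \<partial>lborel)"
    using u0 xy by (intro nn_integral_mono) (auto simp: x_def split: split_indicator)
  finally show ?case by (simp add: y_def)
qed simp

text \<open>Below \<open>a\<close> the density \<open>1 / (\<kappa> * \<xi>)\<close> integrates to a
  logarithm. Above it, \<open>w \<xi> = \<delta> * I \<xi> / (2 * \<xi>)\<close> turns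
  \<open>1 / (\<kappa> * (w \<xi>)^2 * \<xi>)\<close> into
  \<open>4 / (\<kappa> * \<delta>^2)\<close> times \<open>\<xi> / (I \<xi>)^2\<close>.\<close>

lemma step_density_integral:
  fixes I :: "real \<Rightarrow> real"
  assumes pos: "0 < \<kappa>" "0 < \<delta>" and I: "\<And>\<xi>. 0 < \<xi> \<Longrightarrow> \<xi> < 1 \<Longrightarrow> 0 < I \<xi>"
    and cont: "continuous_on {0<..<1} I" and x: "0 < x" "x \<le> 1/4" and "a \<le> 1/4"
  shows "(\<integral>\<^sup>+\<xi>. ennreal (step_density \<kappa> a (\<lambda>\<xi>. 1/2 * \<delta> * (I \<xi> / \<xi>)) \<xi>) * indicator {x..<1/4} \<xi> \<partial>lborel)
    \<le> ennreal ((ln (max x a) - ln x) / \<kappa>) +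
      ennreal (4 / (\<kappa> * \<delta>\<^sup>2)) * (\<integral>\<^sup>+\<xi>\<in>{max x a..1/4}. ennreal (\<xi> / (I \<xi>)\<^sup>2) \<partial>lborel)"
    (is "?L \<le> _")
proof -
  let ?y = "max x a"
  have cont': "continuous_on {?y..1/4} (\<lambda>\<xi>. \<xi> / (I \<xi>)\<^sup>2)"
    using x I by (intro continuous_intros continuous_on_subset[OF cont]) (auto simp: less_imp_neq[THEN not_sym])
  have m: "(\<lambda>\<xi>. ennreal (\<xi> / (I \<xi>)\<^sup>2) * indicator {?y..1/4} \<xi>) \<in> borel_measurable borel"
  proof -
    have "(\<lambda>\<xi>. indicator {?y..1/4} \<xi> *\<^sub>R (\<xi> / (I \<xi>)\<^sup>2)) \<in> borel_measurable borel"
      by (rule borel_measurable_continuous_on_indicator[OF _ cont']) simp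
    then have "(\<lambda>\<xi>. ennreal (indicator {?y..1/4} \<xi> *\<^sub>R (\<xi> / (I \<xi>)\<^sup>2))) \<in> borel_measurable borel"
      by simp
    also have "(\<lambda>\<xi>. ennreal (indicator {?y..1/4} \<xi> *\<^sub>R (\<xi> / (I \<xi>)\<^sup>2))) =
        (\<lambda>\<xi>. ennreal (\<xi> / (I \<xi>)\<^sup>2) * indicator {?y..1/4} \<xi>)"
      by (auto simp: fun_eq_iff split: split_indicator)
    finally show ?thesis .
  qed
  have "?L \<le> (\<integral>\<^sup>+\<xi>. ennreal (1/\<kappa> / \<xi>) * indicator {x..?y} \<xi> +
      ennreal (4 / (\<kappa> * \<delta>\<^sup>2)) * (ennreal (\<xi> / (I \<xi>)\<^sup>2) * indicator {?y..1/4} \<xi>) \<partial>lborel)"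
  proof (rule nn_integral_mono)
    fix \<xi> :: real
    have "ennreal (step_density \<kappa> a (\<lambda>\<xi>. 1/2 * \<delta> * (I \<xi> / \<xi>)) \<xi>) =
        ennreal (4 / (\<kappa> * \<delta>\<^sup>2)) * ennreal (\<xi> / (I \<xi>)\<^sup>2)" if "a \<le> \<xi>" "x \<le> \<xi>" "\<xi> < 1/4"
    proof -
      have "0 < \<xi>" "0 < I \<xi>" using that x I[of \<xi>] by auto
      then have "step_density \<kappa> a (\<lambda>\<xi>. 1/2 * \<delta> * (I \<xi> / \<xi>)) \<xi> = 4 / (\<kappa> * \<delta>\<^sup>2) * (\<xi> / (I \<xi>)\<^sup>2)"
        using that pos by (simp add: step_density_def power2_eq_square field_simps)
      then show ?thesis
        using pos \<open>0 < \<xi>\<close> by (subst ennreal_mult[symmetric]) simp_all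
    qed
    then show "ennreal (step_density \<kappa> a (\<lambda>\<xi>. 1/2 * \<delta> * (I \<xi> / \<xi>)) \<xi>) * indicator {x..<1/4} \<xi> \<le>
      ennreal (1/\<kappa> / \<xi>) * indicator {x..?y} \<xi> +
      ennreal (4 / (\<kappa> * \<delta>\<^sup>2)) * (ennreal (\<xi> / (I \<xi>)\<^sup>2) * indicator {?y..1/4} \<xi>)"
    proof (cases "\<xi> < a")
      case True
      then show ?thesis
        by (auto simp: step_density_def mult.commute split: split_indicator)
    qed (auto split: split_indicator)
  qed
  also have "\<dots> = ennreal (1/\<kappa> * (ln ?y - ln x)) +
      ennreal (4 / (\<kappa> * \<delta>\<^sup>2)) * (\<integral>\<^sup>+\<xi>\<in>{?y..1/4}. ennreal (\<xi> / (I \<xi>)\<^sup>2) \<partial>lborel)"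
    using m x pos nn_integral_inverse_Icc[of x ?y "1/\<kappa>"]
    by (subst nn_integral_add, simp, simp, subst nn_integral_cmult) auto
  finally show ?thesis by simp
qed

lemma step_density_measurable:
  fixes I :: "real \<Rightarrow> real"
  assumes cont: "continuous_on {0<..<1} I"
  shows "step_density \<kappa> a (\<lambda>\<xi>. 1/2 * \<delta> * (I \<xi> / \<xi>)) \<in> borel_measurable (restrict_space borel {0<..<1/4})"
proof -
  have "continuous_on {0<..<1/4} I"
    by (rule continuous_on_subset[OF cont]) auto
  then have [measurable]: "I \<in> borel_measurable (restrict_space borel {0<..<1/4})"
    by (rule borel_measurable_continuous_on_restrict)
  have [measurable]: "(\<lambda>\<xi>::real. \<xi>) \<in> borel_measurable (restrict_space borel {0<..<1/4})"
    by (rule measurable_restrict_space1) simp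
  show ?thesis
    unfolding step_density_def[abs_def] by measurable
qed

section \<open>Joining the early and the late phase\<close>

lemma geometric_phase:
  fixes u :: "nat \<Rightarrow> real"
  assumes u: "\<And>n. 0 \<le> u n" and contr: "\<And>n. u (Suc n) \<le> (1 - \<gamma>)\<^sup>2 * u n" and \<gamma>: "0 < \<gamma>" "\<gamma> \<le> 1"
  shows "u (m + k) \<le> exp (- 2 * \<gamma> * real k) * u m"
proof (induction k)
  case (Suc k)
  have "(1 - \<gamma>)\<^sup>2 \<le> (exp (- \<gamma>))\<^sup>2"
    using \<gamma> exp_ge_add_one_self[of "- \<gamma>"] by (intro power_mono) auto
  then have "(1 - \<gamma>)\<^sup>2 * u (m + k) \<le> (exp (- \<gamma>))\<^sup>2 * (exp (- 2 * \<gamma> * real k) * u m)"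
    using Suc u by (intro mult_mono) auto
  also have "(exp (- \<gamma>))\<^sup>2 * (exp (- 2 * \<gamma> * real k) * u m) = exp (- 2 * \<gamma> * real (Suc k)) * u m"
    by (simp add: algebra_simps flip: exp_add exp_double)
  finally show ?case
    using contr[of "m + k"] by simp
qed simp

lemma two_phase_mixing:
  fixes u :: "nat \<Rightarrow> real"
  assumes u: "\<And>n. 0 \<le> u n" and contr: "\<And>n. u (Suc n) \<le> (1 - \<gamma>)\<^sup>2 * u n" and \<gamma>: "0 < \<gamma>" "\<gamma> \<le> 1"
    and R: "0 \<le> R" "\<And>n. 8 < u n \<Longrightarrow> real n \<le> R"
    and e: "0 < e" and n: "2 + R + 1 / (2 * \<gamma>) * ln (max (min (u 0) 8 / e) 1) \<le> real n"
  shows "u n \<le> e"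
proof -
  have "(1 - \<gamma>)\<^sup>2 \<le> 1" using \<gamma> by (simp add: power_le_one)
  then have "(1 - \<gamma>)\<^sup>2 * u n \<le> 1 * u n" for n
    by (rule mult_right_mono) (rule u)
  then have "u (Suc n) \<le> u n" for n
    using contr[of n] order_trans by fastforce
  then have "u n \<le> u 0" for n
    by (induction n) (auto intro: order_trans)
  \<comment> \<open>Every index with \<open>u > 8\<close> is at most \<open>R\<close>, so the first
    integer above \<open>R\<close> ends the early phase. Starting at or below 8, that phase is
    empty, and \<open>m = 0\<close> retains the factor \<open>min (u 0) 8\<close>.\<close>
  define m where "m = (if 8 < u 0 then nat \<lfloor>R\<rfloor> + 1 else 0)"
  have "real m \<le> R + 1" using R(1) by (auto simp: m_def)
  have "u m \<le> 8"
  proof (rule ccontr)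
    assume *: "\<not> u m \<le> 8"
    then have "8 < u 0" using \<open>u m \<le> u 0\<close> by simp
    then have "R < real m" using R(1) by (simp add: m_def) linarith
    with R(2)[of m] * show False by simp
  qed
  with \<open>u m \<le> u 0\<close> have um: "u m \<le> min (u 0) 8" by simp
  define L where "L = ln (max (min (u 0) 8 / e) 1)"
  have "0 \<le> L" by (simp add: L_def)
  then have "0 \<le> 1 / (2 * \<gamma>) * L" using \<gamma> by simp
  with n \<open>real m \<le> R + 1\<close> have "m \<le> n"
    unfolding L_def[symmetric] by linarith
  define k where "k = n - m"
  have "1 / (2 * \<gamma>) * L \<le> real k"
    using n \<open>real m \<le> R + 1\<close> \<open>m \<le> n\<close> unfolding L_def[symmetric] k_def by simp
  then have "L \<le> 2 * \<gamma> * real k"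
    using \<gamma> by (simp add: field_simps)
  have "u n \<le> exp (- 2 * \<gamma> * real k) * u m"
    using geometric_phase[where u=u, OF u contr \<gamma>, of m k] \<open>m \<le> n\<close> by (simp add: k_def)
  also have "\<dots> \<le> exp (- L) * min (u 0) 8"
    using \<open>L \<le> 2 * \<gamma> * real k\<close> um u[of m] by (intro mult_mono) auto
  also have "\<dots> = min (u 0) 8 / max (min (u 0) 8 / e) 1"
    by (simp add: L_def exp_minus divide_inverse mult.commute)
  also have "\<dots> \<le> e"
  proof -
    have "min (u 0) 8 = e * (min (u 0) 8 / e)" using e by simp
    also have "\<dots> \<le> e * max (min (u 0) 8 / e) 1"
      using e by (intro mult_left_mono) auto
    finally show ?thesis
      by (subst pos_divide_le_eq) auto
  qed
  finally show ?thesis .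
qed

text \<open>Supplies the nonempty index set that the infimum in the profile requires. Balls
  shrinking to a point have mass tending to 0, yet each has positive mass as both its volume and the
  density are positive.\<close>

lemma density_small_positive_set:
  fixes \<rho> :: "'a::euclidean_space \<Rightarrow> real"
  assumes "prob_space (density lborel (\<lambda>x. ennreal (\<rho> x)))"
    and [measurable]: "\<rho> \<in> borel_measurable borel" and pos: "\<And>x. 0 < \<rho> x" and "0 < v"
  shows "\<exists>A\<in>sets borel. 0 < measure (density lborel (\<lambda>x. ennreal (\<rho> x))) A \<and>
    measure (density lborel (\<lambda>x. ennreal (\<rho> x))) A \<le> v"
proof -
  let ?M = "density lborel (\<lambda>x. ennreal (\<rho> x))"
  interpret prob_space ?M by fact
  define C where "C n = cball (0 :: 'a) (1 / real (Suc n))" for n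
  have "decseq C"
    unfolding C_def decseq_def
    by (intro allI impI subset_cball divide_left_mono) auto
  moreover have "range C \<subseteq> sets ?M"
    by (auto simp: C_def)
  ultimately have "(\<lambda>n. prob (C n)) \<longlonglongrightarrow> prob (\<Inter>n. C n)"
    by (intro finite_Lim_measure_decseq)
  also have "(\<Inter>n. C n) = {0}"
  proof -
    have "x = 0" if "\<And>n. norm x \<le> 1 / real (Suc n)" for x :: 'a
    proof -
      have "norm x \<le> 0"
        using that by (intro LIMSEQ_le_const[OF LIMSEQ_Suc[OF lim_1_over_n]]) auto
      then show ?thesis by simp
    qed
    then show ?thesis by (auto simp: C_def)
  qed
  also have "prob {0} = 0"
  proof -
    have "emeasure ?M {0} = 0"
      by (subst emeasure_density) (auto simp: nn_integral_0_iff_AE AE_lborel_singleton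
          intro!: eventually_mono[OF AE_lborel_singleton[of 0]])
    then show ?thesis by (simp add: measure_def)
  qed
  finally have "\<forall>\<^sub>F n in sequentially. prob (C n) < v"
    using \<open>0 < v\<close> by (rule order_tendstoD(2))
  then obtain n where n: "prob (C n) < v"
    by (auto simp: eventually_sequentially)
  have "prob (C n) \<noteq> 0"
  proof
    assume "prob (C n) = 0"
    then have "emeasure ?M (C n) = 0"
      by (simp add: emeasure_eq_measure)
    moreover have C [measurable]: "C n \<in> sets borel"
      by (simp add: C_def)
    ultimately have "(\<integral>\<^sup>+x\<in>C n. ennreal (\<rho> x) \<partial>lborel) = 0"
      by (simp add: emeasure_density)
    then have "AE x in lborel. ennreal (\<rho> x) * indicator (C n) x = 0"
      by (subst (asm) nn_integral_0_iff_AE) simp_all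
    then have "AE x in lborel. x \<notin> C n"
    proof eventually_elim
      case (elim x)
      then show ?case
        using pos[of x] by (auto split: split_indicator_asm)
    qed
    then have "emeasure lborel (C n) = 0"
      by (subst (asm) AE_iff_measurable[of "C n"]) (auto simp: C_def)
    then have "measure lborel (C n) = 0"
      by (simp add: measure_def)
    then show False
      using content_cball_pos[of "1 / real (Suc n)" "0 :: 'a"] by (simp add: C_def)
  qed
  then have "0 < prob (C n)"
    by (simp add: zero_less_measure_iff)
  with n show ?thesis
    by (intro bexI[of _ "C n"]) (auto simp: C_def)
qed

text \<open>The flow out of \<open>A\<close> is at most the first marginal of \<open>A\<close>. The
  bound is needed for the contraction factor \<open>1 - \<Phi>^2/2\<close> to be positive.\<close>

lemma (in reversible_kernel) conductance_profile_le_1: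
  assumes "A \<in> sets M" "0 < prob A" "prob A \<le> v"
  shows "\<Phi> v \<le> 1"
proof -
  have "\<Phi> v * prob A \<le> measure J (A \<times> (space M - A))"
    using assms by (intro conductance_profile_le) auto
  also have "\<dots> \<le> measure J (fst -` A \<inter> space J)"
    using assms(1) sets.sets_into_space[OF assms(1)] measurable_sets[OF measurable_fst, of A M M]
    by (intro J.finite_measure_mono) (auto simp: space_pair_measure)
  also have "\<dots> = measure (distr J M fst) A"
    using assms(1) by (intro measure_distr[symmetric]) auto
  finally show ?thesis
    using assms by (simp add: distr_J_fst)
qed

text \<open>As the slope of \<open>I\<close> is antitone, the set behind \<open>v_star\<close> is an
  initial segment, and \<open>s/2\<close> separates the two regimes. An empty set gives
  \<open>s = 0\<close>; the cap 1/2 leaves the second claim intact, since it concerns only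
  \<open>\<xi> < 1/4\<close>.\<close>

lemma v_star_cases:
  fixes I :: "real \<Rightarrow> real"
  assumes "0 < \<delta>" and anti: "\<And>x y. 0 < x \<Longrightarrow> x \<le> y \<Longrightarrow> y < 1 \<Longrightarrow> I y / y \<le> I x / x"
  obtains s where "v_star \<delta> I = ereal s" "0 \<le> s" "s \<le> 1/2"
    "\<And>\<xi>. 0 < \<xi> \<Longrightarrow> \<xi> < s/2 \<Longrightarrow> 1 \<le> 1/2 * \<delta> * (I \<xi> / \<xi>)"
    "\<And>\<xi>. 0 < \<xi> \<Longrightarrow> \<xi> < 1/4 \<Longrightarrow> s/2 < \<xi> \<Longrightarrow> 1/2 * \<delta> * (I \<xi> / \<xi>) < 1"
proof -
  define V where "V = {v. 0 < v \<and> v < 2 \<and> 1 \<le> 1/2 * \<delta> * (I (v/2) / (v/2))}"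
  have vs: "v_star \<delta> I = min (1/2) (max 0 (SUP v\<in>V. ereal v))"
    by (simp add: v_star_def V_def)
  have half: "(1/2 :: ereal) = ereal (1/2)"
    by (simp add: one_ereal_def)
  have b: "0 \<le> v_star \<delta> I" "v_star \<delta> I \<le> ereal (1/2)"
    unfolding vs half by (simp_all add: min.coboundedI1)
  then obtain s where s: "v_star \<delta> I = ereal s" "0 \<le> s" "s \<le> 1/2"
    by (cases "v_star \<delta> I") auto
  show ?thesis
  proof (rule that[OF s])
    fix \<xi> assume \<xi>: "0 < \<xi>" "\<xi> < s/2"
    have "ereal (2 * \<xi>) < min (1/2) (max 0 (SUP v\<in>V. ereal v))"
      using s(1) \<xi> unfolding vs by simp
    then have "ereal (2 * \<xi>) < (SUP v\<in>V. ereal v)"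
      using \<xi> by (auto simp: less_max_iff_disj)
    then obtain v where v: "v \<in> V" "2 * \<xi> < v"
      by (auto simp: less_SUP_iff)
    then have "1 \<le> 1/2 * \<delta> * (I (v/2) / (v/2))"
      by (simp add: V_def)
    also have "\<dots> \<le> 1/2 * \<delta> * (I \<xi> / \<xi>)"
      using v \<xi> \<open>0 < \<delta>\<close> by (intro mult_left_mono anti) (auto simp: V_def)
    finally show "1 \<le> 1/2 * \<delta> * (I \<xi> / \<xi>)" .
  next
    fix \<xi> assume \<xi>: "0 < \<xi>" "\<xi> < 1/4" "s/2 < \<xi>"
    have "2 * \<xi> \<notin> V"
    proof
      assume "2 * \<xi> \<in> V"
      then have "ereal (2 * \<xi>) \<le> (SUP v\<in>V. ereal v)"
        by (rule SUP_upper)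
      then have "ereal (2 * \<xi>) \<le> v_star \<delta> I"
        unfolding vs half using \<xi> by (auto simp: le_max_iff_disj)
      then show False
        using s(1) \<xi> by simp
    qed
    then show "1/2 * \<delta> * (I \<xi> / \<xi>) < 1"
      using \<xi> by (simp add: V_def)
  qed
qed

text \<open>The hypothesis \<open>less\<close> gives
  \<open>\<xi> / (I \<xi>)^2 \<ge> \<delta>^2 / (4 * \<xi>)\<close>, which is not integrable at 0.
  This settles infinite initial divergence when \<open>v_star\<close> is 0.\<close>

lemma nn_integral_profile_infinite:
  fixes I :: "real \<Rightarrow> real"
  assumes "0 < \<delta>" and I: "\<And>\<xi>. 0 < \<xi> \<Longrightarrow> \<xi> < 1 \<Longrightarrow> 0 < I \<xi>"
    and less: "\<And>\<xi>. 0 < \<xi> \<Longrightarrow> \<xi> < 1/4 \<Longrightarrow> 1/2 * \<delta> * (I \<xi> / \<xi>) < 1"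
  shows "(\<integral>\<^sup>+\<xi>\<in>{0..1/4}. ennreal (\<xi> / (I \<xi>)\<^sup>2) \<partial>lborel) = \<infinity>"
proof -
  let ?N = "\<integral>\<^sup>+\<xi>\<in>{0..1/4}. ennreal (\<xi> / (I \<xi>)\<^sup>2) \<partial>lborel"
  have lower: "ennreal (real n) \<le> ?N" for n
  proof -
    \<comment> \<open>Chosen so that the integral of \<open>\<delta>^2 / (4 * \<xi>)\<close> from
      \<open>x\<close> to 1/4 equals \<open>n\<close>.\<close>
    define x where "x = 1/4 * exp (- (4 / \<delta>\<^sup>2 * real n))"
    have x: "0 < x" "x \<le> 1/4"
      using \<open>0 < \<delta>\<close> by (auto simp: x_def)
    have "ln x = ln (1/4) - 4 / \<delta>\<^sup>2 * real n"
      unfolding x_def by (subst ln_mult) auto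
    then have "ln (1/4) - ln x = 4 / \<delta>\<^sup>2 * real n"
      by simp
    then have "ennreal (real n) = ennreal (\<delta>\<^sup>2/4 * (ln (1/4) - ln x))"
      using \<open>0 < \<delta>\<close> by simp
    also have "\<dots> = (\<integral>\<^sup>+\<xi>. ennreal (\<delta>\<^sup>2/4 / \<xi>) * indicator {x..1/4} \<xi> \<partial>lborel)"
      using x by (intro nn_integral_inverse_Icc[symmetric]) auto
    also have "\<dots> \<le> ?N"
    proof (rule nn_integral_mono_AE)
      have "\<delta>\<^sup>2/4 / \<xi> \<le> \<xi> / (I \<xi>)\<^sup>2" if "x \<le> \<xi>" "\<xi> < 1/4" for \<xi>
      proof -
        have \<xi>: "0 < \<xi>" "0 < I \<xi>" using that x I[of \<xi>] by auto
        then have "\<delta> * I \<xi> \<le> 2 * \<xi>"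
          using less[of \<xi>] that by (simp add: field_simps)
        then have "(\<delta> * I \<xi>)\<^sup>2 \<le> (2 * \<xi>)\<^sup>2"
          using \<xi> \<open>0 < \<delta>\<close> by (intro power_mono) auto
        then show ?thesis
          using \<xi> by (simp add: power2_eq_square field_simps)
      qed
      then show "AE \<xi> in lborel. ennreal (\<delta>\<^sup>2/4 / \<xi>) * indicator {x..1/4} \<xi> \<le>
          ennreal (\<xi> / (I \<xi>)\<^sup>2) * indicator {0..1/4} \<xi>"
        using AE_lborel_singleton[of "1/4"] x
        by (auto elim!: eventually_mono intro!: ennreal_leI split: split_indicator)
    qed
    finally show ?thesis .
  qed
  show ?thesis
  proof (rule ccontr)
    assume "?N \<noteq> \<infinity>"
    then obtain b where b: "0 \<le> b" "?N = ennreal b"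
      by (cases ?N) auto
    obtain n where "b < real n" using reals_Archimedean2 by blast
    then show False
      using lower[of n] b by simp
  qed
qed

lemma nat_le_phase_bound:
  fixes u :: "nat \<Rightarrow> real" and I :: "real \<Rightarrow> real"
  assumes \<kappa>: "0 < \<kappa>" "\<kappa> < 1" and "0 < \<delta>"
    and I: "\<And>\<xi>. 0 < \<xi> \<Longrightarrow> \<xi> < 1 \<Longrightarrow> 0 < I \<xi>" and cont: "continuous_on {0<..<1} I"
    and anti: "\<And>x y. 0 < x \<Longrightarrow> x \<le> y \<Longrightarrow> y < 1 \<Longrightarrow> I y / y \<le> I x / x"
    and "a \<le> 1/4"
    and a: "\<And>\<xi>. 0 < \<xi> \<Longrightarrow> \<xi> < a \<Longrightarrow> 1 \<le> 1/2 * \<delta> * (I \<xi> / \<xi>)"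
      "\<And>\<xi>. 0 < \<xi> \<Longrightarrow> \<xi> < 1/4 \<Longrightarrow> a < \<xi> \<Longrightarrow> 1/2 * \<delta> * (I \<xi> / \<xi>) < 1"
    and dec: "\<And>n. u (Suc n) \<le> u n"
    and step: "\<And>n. 8 \<le> u n \<Longrightarrow>
      u (Suc n) \<le> u n * (1 - \<kappa> * (min 1 (1/2 * \<delta> * (I (2 / u n) / (2 / u n))))\<^sup>2)"
    and n: "8 < u n"
    and N: "(\<integral>\<^sup>+\<xi>\<in>{max (2 / u 0) a..1/4}. ennreal (\<xi> / (I \<xi>)\<^sup>2) \<partial>lborel) = ennreal N" "0 \<le> N"
  shows "real n \<le> (ln (max (2 / u 0) a) - ln (2 / u 0)) / \<kappa> + 4 / (\<kappa> * \<delta>\<^sup>2) * N"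
proof -
  let ?w = "\<lambda>\<xi>. 1/2 * \<delta> * (I \<xi> / \<xi>)"
  have "u n \<le> u 0" by (induction n) (use dec order_trans in auto)
  with n have u0: "8 < u 0" by simp
  then have x: "0 < 2 / u 0" "2 / u 0 \<le> 1/4" by (auto simp: divide_simps)
  then have ln_max: "ln (2 / u 0) \<le> ln (max (2 / u 0) a)"
    by (intro ln_mono) auto
  have "ennreal (real n) \<le>
      (\<integral>\<^sup>+\<xi>. ennreal (step_density \<kappa> a ?w \<xi>) * indicator {2 / u 0..<2 / u n} \<xi> \<partial>lborel)"
  proof (rule step_density_recursion[where u=u, OF \<kappa> _ _ step_density_measurable[OF cont] _ _ dec step n])
    show "0 < ?w \<xi>" if "0 < \<xi>" "\<xi> \<le> 1/4" for \<xi>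
      using I[of \<xi>] that \<open>0 < \<delta>\<close> by simp
    show "?w y \<le> ?w x" if "0 < x" "x \<le> y" "y \<le> 1/4" for x y
      using anti[of x y] that \<open>0 < \<delta>\<close> by (intro mult_left_mono) auto
  qed (use a in \<open>auto intro: less_imp_le\<close>)
  also have "\<dots> \<le> (\<integral>\<^sup>+\<xi>. ennreal (step_density \<kappa> a ?w \<xi>) * indicator {2 / u 0..<1/4} \<xi> \<partial>lborel)"
  proof (rule nn_integral_mono)
    have "2 / u n < 1/4" using n by (simp add: pos_divide_less_eq)
    then show "ennreal (step_density \<kappa> a ?w \<xi>) * indicator {2 / u 0..<2 / u n} \<xi> \<le>
        ennreal (step_density \<kappa> a ?w \<xi>) * indicator {2 / u 0..<1/4} \<xi>" for \<xi>
      by (auto split: split_indicator)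
  qed
  also have "\<dots> \<le> ennreal ((ln (max (2 / u 0) a) - ln (2 / u 0)) / \<kappa>) + ennreal (4 / (\<kappa> * \<delta>\<^sup>2)) * ennreal N"
    using step_density_integral[OF \<kappa>(1) \<open>0 < \<delta>\<close> I cont x \<open>a \<le> 1/4\<close>] by (simp only: N)
  also have "\<dots> = ennreal ((ln (max (2 / u 0) a) - ln (2 / u 0)) / \<kappa> + 4 / (\<kappa> * \<delta>\<^sup>2) * N)"
    using x \<kappa> N(2) ln_max by (subst ennreal_mult[symmetric], simp, simp, subst ennreal_plus[symmetric]) auto
  finally show ?thesis
    using x \<kappa> N(2) ln_max by (subst (asm) ennreal_le_iff) (auto intro!: add_nonneg_nonneg divide_nonneg_nonneg)
qed

text \<open>With \<open>\<xi> = 2/U\<close> the ratio is \<open>(s/2) / \<xi>\<close>, so the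
  logarithm is the early part of the potential. For \<open>s = 0\<close> the conventions give
  \<open>U / \<infinity> = 0\<close> and \<open>-\<infinity>\<close> as its logarithm, and the
  maximum returns 0.\<close>

lemma log_ereal_ratio:
  assumes "0 \<le> s" "0 < U"
  shows "max (log_ereal (ereal U / (4 * (1 / ereal s)))) 0 = ereal (ln (max (2/U) (s/2)) - ln (2/U))"
proof (cases "s = 0")
  case True
  have "4 * (1 / ereal 0) = \<infinity>"
    by (simp add: divide_ereal_def)
  then have "ereal U / (4 * (1 / ereal s)) = 0"
    unfolding True by (simp only:) simp
  then show ?thesis
    using True assms by (simp add: log_ereal_def)
next
  case False
  with assms have s: "0 < s" by simp
  have "4 * (1 / ereal s) = ereal (4 / s)"
    using s by (simp add: one_ereal_def numeral_eq_ereal)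
  then have "ereal U / (4 * (1 / ereal s)) = ereal ((s/2) / (2/U))"
    using s assms by simp
  then have "log_ereal (ereal U / (4 * (1 / ereal s))) = ereal (ln ((s/2) / (2/U)))"
    using mult_pos_pos[OF s assms(2)] by (simp add: log_ereal_def not_le)
  also have "ln ((s/2) / (2/U)) = ln (s/2) - ln (2/U)"
    by (subst ln_div) (use s assms in auto)
  finally have "max (log_ereal (ereal U / (4 * (1 / ereal s)))) 0 = ereal (max (ln (s/2) - ln (2/U)) 0)"
    by (simp add: max_def)
  also have "max (ln (s/2) - ln (2/U)) 0 = ln (max (2/U) (s/2)) - ln (2/U)"
    using s assms by (auto simp: max_def)
  finally show ?thesis .
qed

lemma min_one_power2: "0 \<le> x \<Longrightarrow> (min 1 x)\<^sup>2 = min 1 (x\<^sup>2)" for x :: real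
  by (cases "x \<le> 1") (simp_all add: power_le_one one_le_power min_absorb1 min_absorb2)

lemma (in positive_reversible_kernel) chi_squared_mixing_time:
  fixes f :: "'a \<Rightarrow> real" and I :: "real \<Rightarrow> real"
  defines "u \<equiv> \<lambda>n. (\<integral>x. ((T ^^ n) f x)\<^sup>2 \<partial>M) - 1"
  assumes pos: "0 < \<delta>" "0 < \<epsilon>" and "\<epsilon> \<le> 1"
    and I: "\<And>\<xi>. 0 < \<xi> \<Longrightarrow> \<xi> < 1 \<Longrightarrow> 0 < I \<xi>" and cont: "continuous_on {0<..<1} I"
    and anti: "\<And>x y. 0 < x \<Longrightarrow> x \<le> y \<Longrightarrow> y < 1 \<Longrightarrow> I y / y \<le> I x / x"
    and lower: "\<And>v. 0 < v \<Longrightarrow> v \<le> 1/2 \<Longrightarrow> 1/4 * \<epsilon> * min 1 (1/2 * \<delta> * (I (v/2) / (v/2))) \<le> \<Phi> v"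
    and \<Phi>_le_1: "\<Phi> (1/2) \<le> 1"
    and f: "f \<in> L2 M" "\<And>x. 0 \<le> f x" "(\<integral>x. f x \<partial>M) = 1"
    and "s \<le> 1/2"
    and s: "\<And>\<xi>. 0 < \<xi> \<Longrightarrow> \<xi> < s/2 \<Longrightarrow> 1 \<le> 1/2 * \<delta> * (I \<xi> / \<xi>)"
      "\<And>\<xi>. 0 < \<xi> \<Longrightarrow> \<xi> < 1/4 \<Longrightarrow> s/2 < \<xi> \<Longrightarrow> 1/2 * \<delta> * (I \<xi> / \<xi>) < 1"
    and R: "0 \<le> R" "8 < u 0 \<Longrightarrow>
      R = 2^6 / \<epsilon>\<^sup>2 * (ln (max (2 / u 0) (s/2)) - ln (2 / u 0)) + 2^8 / (\<epsilon>\<^sup>2 * \<delta>\<^sup>2) * N"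
    and N: "8 < u 0 \<Longrightarrow>
      (\<integral>\<^sup>+\<xi>\<in>{max (2 / u 0) (s/2)..1/4}. ennreal (\<xi> / (I \<xi>)\<^sup>2) \<partial>lborel) = ennreal N" "0 \<le> N"
    and e: "0 < e"
    and n: "2 + R + 2^4 * max 1 (1 / (2\<^sup>2 * \<delta>\<^sup>2 * (I (1/4))\<^sup>2)) / \<epsilon>\<^sup>2 * ln (max (min (u 0) 8 / e) 1) \<le> real n"
  shows "u n \<le> e"
proof -
  \<comment> \<open>Here \<open>\<kappa>\<close> is \<open>(\<epsilon>/4)^2 / 4\<close>, from the
    one-step bound, and \<open>\<gamma>\<close> is the lower bound for
    \<open>\<Phi> (1/2)^2 / 2\<close>; then \<open>1/\<kappa>\<close>, \<open>4/\<kappa>\<close> and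
    \<open>1/(2 * \<gamma>)\<close> are the three coefficients, up to powers of
    \<open>\<delta>\<close>.\<close>
  define \<kappa> where "\<kappa> = \<epsilon>\<^sup>2 / 2^6"
  define m where "m = min 1 (4 * \<delta>\<^sup>2 * (I (1/4))\<^sup>2)"
  define \<gamma> where "\<gamma> = \<epsilon>\<^sup>2 / 2^5 * m"
  have \<epsilon>2: "0 < \<epsilon>\<^sup>2" "\<epsilon>\<^sup>2 \<le> 1"
    using pos \<open>\<epsilon> \<le> 1\<close> by (auto simp: power_le_one)
  then have \<kappa>: "0 < \<kappa>" "\<kappa> < 1"
    by (auto simp: \<kappa>_def)
  have I4: "0 < I (1/4)" using I by simp
  then have m: "0 < m" "m \<le> 1" using pos by (auto simp: m_def)
  have m_sq: "(min 1 (2 * \<delta> * I (1/4)))\<^sup>2 = m"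
    using pos I4 by (simp add: m_def min_one_power2 power_mult_distrib)
  have "1/4 * \<epsilon> * min 1 (2 * \<delta> * I (1/4)) \<le> \<Phi> (1/2)"
    using lower[of "1/2"] by simp
  moreover have "0 \<le> 1/4 * \<epsilon> * min 1 (2 * \<delta> * I (1/4))"
    using pos I4 by simp
  ultimately have "(1/4 * \<epsilon> * min 1 (2 * \<delta> * I (1/4)))\<^sup>2 \<le> (\<Phi> (1/2))\<^sup>2" and \<Phi>_nonneg: "0 \<le> \<Phi> (1/2)"
    by (auto intro: power_mono)
  then have "1/16 * \<epsilon>\<^sup>2 * m \<le> (\<Phi> (1/2))\<^sup>2"
    by (simp only: power_mult_distrib m_sq) (simp add: power2_eq_square)
  then have \<gamma>_le: "\<gamma> \<le> (\<Phi> (1/2))\<^sup>2 / 2"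
    by (simp add: \<gamma>_def mult.commute)
  have "(\<Phi> (1/2))\<^sup>2 \<le> 1"
    using \<Phi>_nonneg \<Phi>_le_1 by (simp add: power_le_one)
  with \<gamma>_le have "\<gamma> \<le> 1" by linarith
  moreover have "0 < \<gamma>"
    using \<epsilon>2(1) m(1) by (simp add: \<gamma>_def)
  ultimately have \<gamma>: "0 < \<gamma>" "\<gamma> \<le> 1" by auto
  have g: "(T ^^ n) f \<in> L2 M" "\<And>x. 0 \<le> (T ^^ n) f x" "(\<integral>x. (T ^^ n) f x \<partial>M) = 1" for n
    using kernel_op_iterate[OF f, of n] by auto
  have u_nonneg: "0 \<le> u n" for n
    unfolding u_def chi_squared_density_L2(2)[OF g, symmetric] by (rule Bochner_Integration.integral_nonneg) simp
  have contr: "u (Suc n) \<le> (1 - \<gamma>)\<^sup>2 * u n" for n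
  proof -
    have "u (Suc n) \<le> (1 - (\<Phi> (1/2))\<^sup>2 / 2)\<^sup>2 * u n"
      using chi_squared_contraction[OF g \<Phi>_nonneg \<Phi>_le_1, of n] by (simp add: u_def)
    also have "\<dots> \<le> (1 - \<gamma>)\<^sup>2 * u n"
      using \<gamma>_le \<open>(\<Phi> (1/2))\<^sup>2 \<le> 1\<close> u_nonneg by (intro mult_right_mono power_mono) auto
    finally show ?thesis .
  qed
  have "(1 - \<gamma>)\<^sup>2 \<le> 1"
    using \<gamma> by (simp add: power_le_one)
  then have "(1 - \<gamma>)\<^sup>2 * u n \<le> 1 * u n" for n
    by (rule mult_right_mono) (rule u_nonneg)
  then have dec: "u (Suc n) \<le> u n" for n
    using contr[of n] order_trans by fastforce
  \<comment> \<open>For \<open>u \<ge> 8\<close> the profile bound is available at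
    \<open>v = 4/u\<close>, where its argument \<open>v/2\<close> is \<open>2/u\<close>; this is the
    origin of the variable \<open>\<xi>\<close>.\<close>
  have step: "u (Suc n) \<le> u n * (1 - \<kappa> * (min 1 (1/2 * \<delta> * (I (2 / u n) / (2 / u n))))\<^sup>2)"
    if "8 \<le> u n" for n
  proof -
    let ?w = "min 1 (1/2 * \<delta> * (I (2 / u n) / (2 / u n)))"
    have v: "0 < 4 / u n" "4 / u n \<le> 1/2" "2 / u n < 1"
      using that by (auto simp: divide_simps)
    have le: "1/4 * \<epsilon> * ?w \<le> \<Phi> (4 / u n)"
      using lower[OF v(1,2)] by simp
    have w: "0 \<le> 1/4 * \<epsilon> * ?w"
      using pos I[of "2 / u n"] v that by auto
    have "\<kappa> * ?w\<^sup>2 = (1/4 * \<epsilon> * ?w)\<^sup>2 / 4"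
      by (simp only: \<kappa>_def power_mult_distrib) (simp add: power2_eq_square)
    also have "\<dots> \<le> (\<Phi> (4 / u n))\<^sup>2 / 4"
      using le w by (intro divide_right_mono power_mono) auto
    finally have "u n * (1 - (\<Phi> (4 / u n))\<^sup>2 / 4) \<le> u n * (1 - \<kappa> * ?w\<^sup>2)"
      using that by (intro mult_left_mono) auto
    moreover have "u (Suc n) \<le> u n * (1 - (\<Phi> (4 / u n))\<^sup>2 / 4)"
      using chi_squared_step[OF g, of "u n" n] that le w by (simp add: u_def)
    ultimately show ?thesis by simp
  qed
  show ?thesis
  proof (rule two_phase_mixing[where u=u and \<gamma>=\<gamma> and R=R, OF u_nonneg contr \<gamma> R(1) _ e])
    fix n assume "8 < u n"
    have "u n \<le> u 0" by (induction n) (use dec order_trans in auto)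
    with \<open>8 < u n\<close> have u0: "8 < u 0" by simp
    have "real n \<le> (ln (max (2 / u 0) (s/2)) - ln (2 / u 0)) / \<kappa> + 4 / (\<kappa> * \<delta>\<^sup>2) * N"
      by (rule nat_le_phase_bound[where u=u and I=I and \<kappa>=\<kappa> and \<delta>=\<delta> and a="s/2",
            OF \<kappa> pos(1) I cont anti _ s dec step \<open>8 < u n\<close> N(1)[OF u0] N(2)])
        (use \<open>s \<le> 1/2\<close> in auto)
    also have "\<dots> = R"
      by (simp add: R(2)[OF u0] \<kappa>_def)
    finally show "real n \<le> R" .
  next
    have "max 1 (1 / (2\<^sup>2 * \<delta>\<^sup>2 * (I (1/4))\<^sup>2)) = 1 / m"
      using pos I4 by (auto simp: m_def max_def min_def field_simps)
    then have eq: "2^4 * max 1 (1 / (2\<^sup>2 * \<delta>\<^sup>2 * (I (1/4))\<^sup>2)) / \<epsilon>\<^sup>2 = 1 / (2 * \<gamma>)"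
      by (simp add: \<gamma>_def)
    show "2 + R + 1 / (2 * \<gamma>) * ln (max (min (u 0) 8 / e) 1) \<le> real n"
      using n unfolding eq .
  qed
qed

theorem theorem18:
  fixes \<pi> :: "(real ^ 'n) measure"
    and \<rho> :: "real ^ 'n \<Rightarrow> real"
    and d :: "real ^ 'n \<Rightarrow> real ^ 'n \<Rightarrow> real"
    and P :: "real ^ 'n \<Rightarrow> (real ^ 'n) measure"
    and I :: "real \<Rightarrow> real"
    and \<delta> \<epsilon> :: real
  assumes "prob_space \<pi>"
    and "\<rho> \<in> borel_measurable borel" and "\<forall>x. 0 < \<rho> x"
    and "\<pi> = density lborel (\<lambda>x. ennreal (\<rho> x))"
    and "Metric_space UNIV d"
    and "isoperimetric_minorant d \<pi> I" and "regular_minorant I" and "concave_on {0<..<1} I"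
    and "\<epsilon> > 0" and "\<delta> > 0"
    and "P \<in> borel \<rightarrow>\<^sub>M prob_algebra borel"
    and "close_coupling d \<delta> \<epsilon> P" and "reversible \<pi> P" and "positive_kernel \<pi> P"
  shows
    "(\<forall>v\<in>{0<..1/2}.
        conductance_profile \<pi> P v \<ge> 1/4 * \<epsilon> * min 1 (1/2 * \<delta> * (I (v/2) / (v/2)))) \<and>
     conductance \<pi> P \<ge> 1/4 * \<epsilon> * min 1 (2 * \<delta> * I (1/4)) \<and>
     spectral_gap \<pi> P \<ge> ereal (1/2 * (conductance \<pi> P)\<^sup>2) \<and>
     1/2 * (conductance \<pi> P)\<^sup>2 \<ge> 1/2^5 * \<epsilon>\<^sup>2 * min 1 (4 * \<delta>\<^sup>2 * (I (1/4))\<^sup>2) \<and>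
     (\<forall>\<epsilon>mix\<in>{0<..<8::real}. \<forall>\<mu>.
        prob_space \<mu> \<and> sets \<mu> = sets borel \<and> absolutely_continuous \<pi> \<mu> \<longrightarrow>
        (let u0 = enn2ereal (chi_squared \<mu> \<pi>); vs = v_star \<delta> I in
         \<forall>n::nat.
           ereal (real n) \<ge>
             2 + ereal (2^6 / \<epsilon>\<^sup>2) * max (log_ereal (u0 / (4 * (1 / vs)))) 0
             + ereal (2^8 / (\<epsilon>\<^sup>2 * \<delta>\<^sup>2)) *
               enn2ereal (\<integral>\<^sup>+\<xi>\<in>{real_of_ereal (max (min (2 * (1 / u0)) (1/4)) (vs / 2))..1/4}.
                            ennreal (\<xi> / (I \<xi>)\<^sup>2) \<partial>lborel)
             + ereal (2^4 * max 1 (1 / (2\<^sup>2 * \<delta>\<^sup>2 * (I (1/4))\<^sup>2)) / \<epsilon>\<^sup>2) *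
               log_ereal (max (min u0 8 / ereal \<epsilon>mix) 1)
           \<longrightarrow> chi_squared (push_iter \<mu> P n) \<pi> \<le> ennreal \<epsilon>mix))"
proof -
  interpret prob_space \<pi> by fact
  have sets_\<pi>: "sets \<pi> = sets borel"
    using assms(4) by simp
  have "prob_algebra \<pi> = prob_algebra borel"
    unfolding prob_algebra_def by (simp add: subprob_algebra_cong[OF sets_\<pi>])
  then have kernel: "P \<in> \<pi> \<rightarrow>\<^sub>M prob_algebra \<pi>"
    using assms(11) by (simp add: measurable_cong_sets[OF sets_\<pi> refl])
  interpret positive_reversible_kernel \<pi> P
    by unfold_locales (rule kernel assms(13,14))+
  have I: "0 < I \<xi>" if "0 < \<xi>" "\<xi> < 1" for \<xi>
    using assms(6) that by (auto simp: isoperimetric_minorant_def)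
  have cont: "continuous_on {0<..<1} I"
    using assms(7) by (simp add: regular_minorant_def)
  have anti: "I y / y \<le> I x / x" if "0 < x" "x \<le> y" "y < 1" for x y
    using that by (intro concave_on_slope_antimono[OF assms(8) I])
  have ex: "\<exists>A\<in>sets \<pi>. 0 < prob A \<and> prob A \<le> v" if "0 < v" for v
    using density_small_positive_set[of \<rho> v] assms(1-4) that sets_\<pi> by simp
  have lower: "1/4 * \<epsilon> * min 1 (1/2 * \<delta> * (I (v/2) / (v/2))) \<le> conductance_profile \<pi> P v"
    if "0 < v" "v \<le> 1/2" for v
    using conductance_profile_lower_bound[OF assms(5-8,12,10,9) that ex[OF that(1)]] .
  obtain A where "A \<in> sets \<pi>" "0 < prob A" "prob A \<le> 1/2"
    using ex[of "1/2"] by auto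
  then have le_1: "conductance_profile \<pi> P (1/2) \<le> 1"
    by (rule conductance_profile_le_1)
  \<comment> \<open>Close coupling of a point with itself: the distance is 0, and so is the total
    variation.\<close>
  have "\<epsilon> \<le> 1"
  proof -
    interpret d: Metric_space UNIV d by fact
    have "tv_dist (P 0) (P 0) \<le> 1 - \<epsilon>"
      using assms(10,12) d.zero[of 0 0] by (auto simp: close_coupling_def)
    moreover have "tv_dist (P 0) (P 0) = 0"
      unfolding tv_dist_def using sets.empty_sets by (subst cSUP_const[symmetric]) auto
    ultimately show ?thesis by simp
  qed
  have I4: "0 < I (1/4)" using I by simp
  have low: "1/4 * \<epsilon> * min 1 (2 * \<delta> * I (1/4)) \<le> conductance \<pi> P"
    using lower[of "1/2"] by (simp add: conductance_def)
  have low0: "0 \<le> 1/4 * \<epsilon> * min 1 (2 * \<delta> * I (1/4))"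
    using assms(9,10) I4 by simp
  have nonneg: "0 \<le> conductance_profile \<pi> P (1/2)"
    using low low0 by (simp add: conductance_def)
  have gap: "ereal (1/2 * (conductance \<pi> P)\<^sup>2) \<le> spectral_gap \<pi> P"
    using spectral_gap_ge[OF nonneg le_1] by (simp add: conductance_def)
  have gap_lower: "1/2^5 * \<epsilon>\<^sup>2 * min 1 (4 * \<delta>\<^sup>2 * (I (1/4))\<^sup>2) \<le> 1/2 * (conductance \<pi> P)\<^sup>2"
  proof -
    have "(min 1 (2 * \<delta> * I (1/4)))\<^sup>2 = min 1 (4 * \<delta>\<^sup>2 * (I (1/4))\<^sup>2)"
      using assms(10) I4 by (simp add: min_one_power2 power_mult_distrib)
    then have "(1/4 * \<epsilon> * min 1 (2 * \<delta> * I (1/4)))\<^sup>2 = 1/16 * \<epsilon>\<^sup>2 * min 1 (4 * \<delta>\<^sup>2 * (I (1/4))\<^sup>2)"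
      by (simp only: power_mult_distrib) (simp add: power2_eq_square)
    with power_mono[OF low low0, of 2] show ?thesis by simp
  qed
  have mixing: "chi_squared (push_iter \<mu> P n) \<pi> \<le> ennreal e"
    if e: "0 < e" and \<mu>: "prob_space \<mu>" "sets \<mu> = sets borel" "absolutely_continuous \<pi> \<mu>"
      and u0: "u0 = enn2ereal (chi_squared \<mu> \<pi>)"
      and n: "ereal (real n) \<ge>
             2 + ereal (2^6 / \<epsilon>\<^sup>2) * max (log_ereal (u0 / (4 * (1 / v_star \<delta> I)))) 0
             + ereal (2^8 / (\<epsilon>\<^sup>2 * \<delta>\<^sup>2)) *
               enn2ereal (\<integral>\<^sup>+\<xi>\<in>{real_of_ereal (max (min (2 * (1 / u0)) (1/4)) (v_star \<delta> I / 2))..1/4}.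
                            ennreal (\<xi> / (I \<xi>)\<^sup>2) \<partial>lborel)
             + ereal (2^4 * max 1 (1 / (2\<^sup>2 * \<delta>\<^sup>2 * (I (1/4))\<^sup>2)) / \<epsilon>\<^sup>2) *
               log_ereal (max (min u0 8 / ereal e) 1)"
    for e \<mu> u0 n
  proof -
    obtain s where s: "v_star \<delta> I = ereal s" "0 \<le> s" "s \<le> 1/2"
      "\<And>\<xi>. 0 < \<xi> \<Longrightarrow> \<xi> < s/2 \<Longrightarrow> 1 \<le> 1/2 * \<delta> * (I \<xi> / \<xi>)"
      "\<And>\<xi>. 0 < \<xi> \<Longrightarrow> \<xi> < 1/4 \<Longrightarrow> s/2 < \<xi> \<Longrightarrow> 1/2 * \<delta> * (I \<xi> / \<xi>) < 1"
      by (rule v_star_cases[OF assms(10), of I]) (rule anti that; assumption)+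
    have c: "0 < 2^6 / \<epsilon>\<^sup>2" "0 < 2^8 / (\<epsilon>\<^sup>2 * \<delta>\<^sup>2)"
      using assms(9,10) by auto
    define T1 where "T1 = ereal (2^6 / \<epsilon>\<^sup>2) * max (log_ereal (u0 / (4 * (1 / ereal s)))) 0"
    define K where "K = (\<integral>\<^sup>+\<xi>\<in>{real_of_ereal (max (min (2 * (1 / u0)) (1/4)) (ereal s / 2))..1/4}.
        ennreal (\<xi> / (I \<xi>)\<^sup>2) \<partial>lborel)"
    define T2 where "T2 = ereal (2^8 / (\<epsilon>\<^sup>2 * \<delta>\<^sup>2)) * enn2ereal K"
    define C where "C = 2^4 * max 1 (1 / (2\<^sup>2 * \<delta>\<^sup>2 * (I (1/4))\<^sup>2)) / \<epsilon>\<^sup>2"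
    define T3 where "T3 = ereal C * log_ereal (max (min u0 8 / ereal e) 1)"
    have bound: "2 + T1 + T2 + T3 \<le> ereal (real n)"
      using n unfolding s(1) T1_def T2_def T3_def K_def C_def .
    \<comment> \<open>The prescribed number of steps is at most \<open>n\<close>, and in
      \<open>ereal\<close> one infinite summand would make the whole sum infinite.\<close>
    have T1_finite: "T1 \<noteq> \<infinity>" and T2_finite: "T2 \<noteq> \<infinity>"
      using bound by auto
    have T_nonneg: "0 \<le> T1" "0 \<le> T2"
      using c by (auto simp: T1_def T2_def)
    have K_finite: "K \<noteq> \<infinity>"
      using T2_finite c by (auto simp: T2_def)
    \<comment> \<open>For \<open>u0 = \<infinity>\<close> the required number of steps is infinite:
      through the logarithm if \<open>s > 0\<close>, and through the integral, which then starts at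
      0 and diverges there, if \<open>s = 0\<close>.\<close>
    have u0_finite: "u0 \<noteq> \<infinity>"
    proof
      assume u0: "u0 = \<infinity>"
      show False
      proof (cases "s = 0")
        case True
        then have "K = (\<integral>\<^sup>+\<xi>\<in>{0..1/4}. ennreal (\<xi> / (I \<xi>)\<^sup>2) \<partial>lborel)"
          by (simp add: K_def u0 one_ereal_def numeral_eq_ereal flip: zero_ereal_def)
        also have "\<dots> = \<infinity>"
          using s(5) True by (intro nn_integral_profile_infinite[OF assms(10) I]) auto
        finally show False
          using K_finite by simp
      next
        case False
        then have "4 * (1 / ereal s) = ereal (4 / s)"
          by (simp add: one_ereal_def numeral_eq_ereal)
        then have "u0 / (4 * (1 / ereal s)) = \<infinity>"
          using False s(2) by (simp add: u0)
        then have "T1 = \<infinity>"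
          using c by (simp add: T1_def log_ereal_def)
        with T1_finite show False by simp
      qed
    qed
    obtain f where f: "f \<in> borel_measurable \<pi>" "\<And>x. 0 \<le> f x" "integrable \<pi> f"
        "(\<integral>x. f x \<partial>\<pi>) = 1" "\<mu> = density \<pi> (\<lambda>x. ennreal (f x))"
      by (rule real_density_exists[OF \<mu>(1) \<mu>(2)[folded sets_\<pi>] \<mu>(3)]) (rule that; assumption)
    have "(\<integral>\<^sup>+x. ennreal ((f x - 1)\<^sup>2) \<partial>\<pi>) = chi_squared \<mu> \<pi>"
      unfolding f(5) by (rule chi_squared_density[symmetric, OF f(1,2)])
    also have "\<dots> < \<infinity>"
      using u0_finite by (auto simp: u0 less_top)
    finally have "(\<lambda>x. f x - 1) \<in> L2 \<pi>"
      using f(1) by (simp add: L2_iff_nn_integral)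
    from L2_add[OF this L2_const[of 1]] have f2: "f \<in> L2 \<pi>" by simp
    note f' = f2 f(2,4)
    define u where "u n = (\<integral>x. ((kernel_op P ^^ n) f x)\<^sup>2 \<partial>\<pi>) - 1" for n
    have chi: "chi_squared (push_iter \<mu> P n) \<pi> = ennreal (u n)" for n
      unfolding f(5) u_def by (rule chi_squared_push_iter[OF f'])
    have "0 \<le> u 0"
      unfolding u_def funpow_0 chi_squared_density_L2(2)[OF f', symmetric]
      by (rule Bochner_Integration.integral_nonneg) simp
    then have U: "u0 = ereal (u 0)"
      using chi[of 0] by (simp add: u0 push_iter_def)
    have T3: "T3 = ereal (C * ln (max (min (u 0) 8 / e) 1))"
    proof -
      have "max (min u0 8 / ereal e) 1 = ereal (max (min (u 0) 8 / e) 1)"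
        using e by (simp add: U one_ereal_def numeral_eq_ereal min_def max_def)
      moreover have "log_ereal (ereal x) = ereal (ln x)" if "0 < x" for x
        using that by (simp add: log_ereal_def)
      ultimately have "log_ereal (max (min u0 8 / ereal e) 1) = ereal (ln (max (min (u 0) 8 / e) 1))"
        by (metis less_max_iff_disj zero_less_one)
      then show ?thesis
        unfolding T3_def by (simp only: times_ereal.simps)
    qed
    define N where "N = enn2real K"
    have K: "K = ennreal N" "0 \<le> N"
      using K_finite by (simp_all add: N_def less_top)
    \<comment> \<open>A real lower bound for \<open>T1 + T2\<close>. It is 0 when the chain starts
      at or below 8, where there is no early phase to pay for.\<close>
    define R where "R = (if 8 < u 0 then
      2^6 / \<epsilon>\<^sup>2 * (ln (max (2 / u 0) (s/2)) - ln (2 / u 0)) + 2^8 / (\<epsilon>\<^sup>2 * \<delta>\<^sup>2) * N else 0)"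
    have T12: "ereal R \<le> T1 + T2"
    proof (cases "8 < u 0")
      case True
      have "T1 = ereal (2^6 / \<epsilon>\<^sup>2 * (ln (max (2 / u 0) (s/2)) - ln (2 / u 0)))"
        unfolding T1_def U using True s(2) by (subst log_ereal_ratio) auto
      moreover have "T2 = ereal (2^8 / (\<epsilon>\<^sup>2 * \<delta>\<^sup>2) * N)"
        using K(2) by (simp add: T2_def K(1))
      ultimately show ?thesis
        using True by (simp add: R_def)
    next
      case False
      then show ?thesis
        using add_nonneg_nonneg[OF T_nonneg] by (simp add: R_def flip: zero_ereal_def)
    qed
    have "u n \<le> e"
    proof (rule chi_squared_mixing_time[where N=N and R=R and s=s,
          OF assms(10,9) \<open>\<epsilon> \<le> 1\<close> I cont anti lower le_1 f' s(3,4,5), folded u_def])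
      show "0 \<le> R"
      proof (cases "8 < u 0")
        case True
        then have "ln (2 / u 0) \<le> ln (max (2 / u 0) (s/2))"
          by (intro ln_mono) auto
        then have "0 \<le> 2^6 / \<epsilon>\<^sup>2 * (ln (max (2 / u 0) (s/2)) - ln (2 / u 0)) + 2^8 / (\<epsilon>\<^sup>2 * \<delta>\<^sup>2) * N"
          using c K(2) by (intro add_nonneg_nonneg mult_nonneg_nonneg) auto
        with True show ?thesis by (simp only: R_def if_True)
      qed (simp add: R_def)
      show "R = 2^6 / \<epsilon>\<^sup>2 * (ln (max (2 / u 0) (s/2)) - ln (2 / u 0)) + 2^8 / (\<epsilon>\<^sup>2 * \<delta>\<^sup>2) * N" if "8 < u 0"
        using that by (simp add: R_def)
      show "(\<integral>\<^sup>+\<xi>\<in>{max (2 / u 0) (s/2)..1/4}. ennreal (\<xi> / (I \<xi>)\<^sup>2) \<partial>lborel) = ennreal N" if "8 < u 0"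
      proof -
        have "2 * (1 / u0) = ereal (2 / u 0)"
          using that by (simp add: U one_ereal_def numeral_eq_ereal)
        moreover have "2 / u 0 \<le> 1/4"
          using that by (simp add: divide_simps)
        ultimately have "real_of_ereal (max (min (2 * (1 / u0)) (1/4)) (ereal s / 2)) = max (2 / u 0) (s/2)"
          by (simp add: one_ereal_def numeral_eq_ereal ereal_max[symmetric] del: ereal_max)
        then show ?thesis
          using K(1) by (simp add: K_def)
      qed
      have "ereal (2 + R + C * ln (max (min (u 0) 8 / e) 1)) = 2 + ereal R + T3"
        by (simp add: T3 numeral_eq_ereal)
      also have "\<dots> \<le> 2 + (T1 + T2) + T3"
        using T12 by (intro add_mono) auto
      also have "\<dots> \<le> ereal (real n)"
        using bound by (simp add: add.assoc)
      finally show "2 + R + 2^4 * max 1 (1 / (2\<^sup>2 * \<delta>\<^sup>2 * (I (1/4))\<^sup>2)) / \<epsilon>\<^sup>2 *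
          ln (max (min (u 0) 8 / e) 1) \<le> real n"
        by (simp add: C_def)
    qed (use K e in auto)
    then show ?thesis
      unfolding chi by (rule ennreal_leI)
  qed
  show ?thesis
    unfolding Let_def
  proof (intro conjI ballI allI impI)
    fix v :: real assume "v \<in> {0<..1/2}"
    then show "1/4 * \<epsilon> * min 1 (1/2 * \<delta> * (I (v/2) / (v/2))) \<le> conductance_profile \<pi> P v"
      by (intro lower) auto
  qed (rule low gap gap_lower mixing[OF _ _ _ _ refl]; (assumption | elim conjE, assumption | simp))+
qed

end
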